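(* Let $\mathbb{F}$ be an algebraically closed field of any characteristic. Let $x_7,y_7\in \mathrm{GL}_7(\mathbb{F})$ be such that $H_7=\langle x_7,y_7\rangle$ is an irreducible subgroup of $\mathrm{SL}_7(\mathbb{F})$ and $(x_7,y_7,x_7y_7)$ is a non-rigid $(2,3,7)$-triple, i.e. a triple with the following similarity invariants: $$x_7:\ t+1,\ t^2-1,\ t^2-1,\ t^2-1;\qquad y_7:\ t-1,\ t^3-1,\ t^3-1;\qquad x_7y_7:\ t^7-1.$$ Then $\mathrm{char}\,\mathbb{F}\neq 2$ and $H_7$ is a subgroup of $G_2(\mathbb{F})$.
   Context: The similarity invariants of a square matrix are its non-constant invariant factors (each dividing the next, with product the characteristic polynomial). A triple $(x,y,xy)\in\mathrm{GL}_n(\mathbb{F})^3$ is irreducible if $\langle x,y\rangle$ acts irreducibly on $\mathbb{F}^n$; it is a $(2,3,7)$-triple if the images of $x,y,xy$ in $\mathrm{PGL}_n(\mathbb{F})$ have orders $2,3,7$ respectively. For $H=\langle x,y\rangle$ acting linearly on a finite-dimensional space $V$ via $\Phi$, and $A\subseteq H$, let $d_V^A$ be the dimension of the space of vectors fixed by all $\Phi(a)$, $a\in A$, and $\hat d_V^A$ the dimension of the space of vectors fixed by all $\Phi(a)^T$, $a\in A$; $d_V^a=d_V^{\{a\}}$. Scott's formula states $d_V^x+d_V^y+d_V^{xy}\le \dim V+d_V^H+\hat d_V^H$. An irreducible triple is rigid if equality holds for the conjugation action on $V=\mathrm{Mat}_n(\mathbb{F})$; otherwise it is non-rigid. As is known,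 up to multiplication of the matrices by scalars, the irreducible non-rigid $(2,3,7)$-triples for $n=7$ are those with the displayed similarity invariants; the hypothesis is that the triple has exactly these invariants. A Dickson form on $\mathbb{F}^7$ is an alternating trilinear form which, for some basis $v_0,v_1,v_2,v_3,v_{-1},v_{-2},v_{-3}$ with dual basis $v_i^*$, equals $$v_0^*\wedge v_1^*\wedge v_{-1}^*+v_0^*\wedge v_2^*\wedge v_{-2}^*+v_0^*\wedge v_3^*\wedge v_{-3}^*+v_1^*\wedge v_2^*\wedge v_{-3}^*+v_{-1}^*\wedge v_{-2}^*\wedge v_3^*.$$ $G_2(\mathbb{F})$ is defined as the subgroup of $\mathrm{GL}_7(\mathbb{F})$ fixing a Dickson form. Containment in $G_2(\mathbb{F})$ is understood up to conjugation in $\mathrm{GL}_7(\mathbb{F})$, i.e. the group fixes some Dickson form on $\mathbb{F}^7$. *)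

theory Defs
  imports
    "HOL-Analysis.Analysis"
    "HOL-Computational_Algebra.Polynomial"
    "HOL-Algebra.Generated_Groups"
begin

definition GL :: "('a::field^'n::finite^'n) monoid" where
  "GL = \<lparr>carrier = {A. invertible A}, mult = (**), one = mat 1\<rparr>"

definition SL :: "('a::field^'n::finite^'n) set" where
  "SL = {A. det A = 1}"

text \<open>Matrices act on column vectors. The space \<open>'a^'n\<close> is never zero, so no
  separate non-triviality condition is needed.\<close>

definition acts_irreducibly :: "('a::field^'n::finite^'n) set \<Rightarrow> bool" where
  "acts_irreducibly H \<longleftrightarrow>
     (\<forall>W. vec.subspace W \<and> (\<forall>A\<in>H. \<forall>w\<in>W. A *v w \<in> W) \<longrightarrow> W = {0} \<or> W = UNIV)"

definition charmat :: "'a::field^'n::finite^'n \<Rightarrow> 'a poly^'n^'n" where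
  "charmat A = mat [:0, 1:] - map_matrix (\<lambda>c. [:c:]) A"

text \<open>The invariant factors of \<open>A\<close> are the diagonal entries of the Smith normal form of
  \<open>t I - A\<close>. The linear order on the index type only serves to list them; invertibility of
  \<open>P\<close> and \<open>Q\<close> is over the polynomial ring.\<close>

definition invariant_factors ::
    "'a::field^'n::{finite,linorder}^'n::{finite,linorder} \<Rightarrow> ('n \<Rightarrow> 'a poly) \<Rightarrow> bool" where
  "invariant_factors A d \<longleftrightarrow>
     (\<forall>i. lead_coeff (d i) = 1) \<and>
     (\<forall>i j. i \<le> j \<longrightarrow> d i dvd d j) \<and>
     (\<exists>P Q. invertible P \<and> invertible Q \<and>
        P ** charmat A ** Q = (\<chi> i j. if i = j then d i else 0))"

definition similarity_invariants ::
    "'a::field^'n::{finite,linorder}^'n::{finite,linorder} \<Rightarrow> 'a poly list \<Rightarrow> bool" where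
  "similarity_invariants A fs \<longleftrightarrow>
     (\<exists>d. invariant_factors A d \<and>
        fs = filter (\<lambda>p. degree p > 0) (map d (sorted_list_of_set UNIV)))"

definition alternating_trilinear ::
    "('a::field^'n::finite \<Rightarrow> 'a^'n \<Rightarrow> 'a^'n \<Rightarrow> 'a) \<Rightarrow> bool" where
  "alternating_trilinear f \<longleftrightarrow>
     (\<forall>v w. Vector_Spaces.linear (*s) (*) (\<lambda>u. f u v w)) \<and>
     (\<forall>u w. Vector_Spaces.linear (*s) (*) (\<lambda>v. f u v w)) \<and>
     (\<forall>u v. Vector_Spaces.linear (*s) (*) (\<lambda>w. f u v w)) \<and>
     (\<forall>u v. f u u v = 0 \<and> f u v u = 0 \<and> f v u u = 0)"

text \<open>The wedge product is normalised as a determinant, without a factor \<open>1/6\<close>, so that it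
  is meaningful in every characteristic.\<close>

definition wedge3 ::
    "('v \<Rightarrow> 'a::field) \<Rightarrow> ('v \<Rightarrow> 'a) \<Rightarrow> ('v \<Rightarrow> 'a) \<Rightarrow> 'v \<Rightarrow> 'v \<Rightarrow> 'v \<Rightarrow> 'a" where
  "wedge3 \<alpha> \<beta> \<gamma> u v w =
     det (vector [vector [\<alpha> u, \<alpha> v, \<alpha> w],
                  vector [\<beta> u, \<beta> v, \<beta> w],
                  vector [\<gamma> u, \<gamma> v, \<gamma> w]] :: 'a^3^3)"

definition indexed_basis :: "'i set \<Rightarrow> ('i \<Rightarrow> 'a::field^'n::finite) \<Rightarrow> bool" where
  "indexed_basis I b \<longleftrightarrow>
     inj_on b I \<and> vec.independent (b ` I) \<and> vec.span (b ` I) = UNIV"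

definition dual_basis ::
    "'i set \<Rightarrow> ('i \<Rightarrow> 'a::field^'n::finite) \<Rightarrow> 'i \<Rightarrow> 'a^'n \<Rightarrow> 'a" where
  "dual_basis I b i u = vec.representation (b ` I) u (b i)"

definition Dickson_form :: "('a::field^7 \<Rightarrow> 'a^7 \<Rightarrow> 'a^7 \<Rightarrow> 'a) \<Rightarrow> bool" where
  "Dickson_form f \<longleftrightarrow>
     alternating_trilinear f \<and>
     (\<exists>b :: int \<Rightarrow> 'a^7. indexed_basis {-3..3} b \<and>
       (let e = dual_basis {-3..3} b in
        \<forall>u v w. f u v w =
            wedge3 (e 0) (e 1) (e (-1)) u v w
          + wedge3 (e 0) (e 2) (e (-2)) u v w
          + wedge3 (e 0) (e 3) (e (-3)) u v w
          + wedge3 (e 1) (e 2) (e (-3)) u v w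
          + wedge3 (e (-1)) (e (-2)) (e 3) u v w))"

text \<open>The group \<open>G\<^sub>2\<close> attached to a particular Dickson form \<open>f\<close>; different Dickson forms give
  conjugate subgroups of the general linear group.\<close>

definition G2 :: "('a::field^7 \<Rightarrow> 'a^7 \<Rightarrow> 'a^7 \<Rightarrow> 'a) \<Rightarrow> ('a^7^7) set" where
  "G2 f = {A. invertible A \<and> (\<forall>u v w. f (A *v u) (A *v v) (A *v w) = f u v w)}"

end

theory Submission
  imports Defs
begin

text \<open>The similarity invariants make \<open>x\<close>, \<open>y\<close> and \<open>x y\<close> act, up to signs, as permutations of
  spanning families of seven vectors. Their fixed spaces on symmetric 2-tensors (dimension 28) and on
  alternating 3-tensors (dimension 35) are therefore so large that Scott's formula forces an invariant
  of the group in both spaces: the ranks of \<open>1 - x\<close>, \<open>1 - y\<close>, \<open>1 - x y\<close> sum to less than twice the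
  dimension. The first invariant identifies the space with its dual, and excludes characteristic 2;
  the second one then gives a nonzero invariant alternating trilinear form \<open>f\<close>. In characteristic
  other than 7 an eigenbasis of the 7-cycle \<open>x y\<close> kills all coefficients of \<open>f\<close> except the five of a
  Dickson form. In characteristic 7 the eigenvalues 1, 2, 4 of \<open>y\<close> give a grading, and a change of basis
  inside the eigenspaces brings \<open>f\<close> to the same shape. If one of the five coefficients vanished, the
  vectors with degenerate contraction of \<open>f\<close> would span an invariant proper subspace, so
  rescaling the basis turns \<open>f\<close> into a Dickson form.\<close>

subsection \<open>Cyclic vectors from similarity invariants\<close>

text \<open>The polynomials \<open>t^2 - 1\<close>, \<open>t^3 - 1\<close> and
  \<open>t^7 - 1\<close> become inseparable in characteristic 2, 3 and 7 respectively, so fixed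
  spaces cannot be counted uniformly through eigenvalues. Orbits of signed permutations give rank
  bounds valid over every field: 12 + 18 + 24 = 54 < 56 on symmetric tensors and 16 + 22 + 30 = 68 <
  70 on alternating ones. Scott's formula leaves open whether the invariant is a tensor or a
  functional, that is, a form on the dual space or on the space itself. This ambiguity is why a
  nondegenerate symmetric form has to come before the trilinear one. In characteristic 7 the product
  \<open>x ** y\<close> is a single unipotent Jordan block without eigenbasis, whereas
  \<open>y\<close> is diagonalizable because 2 is a primitive cube root of unity there. Its
  eigenspaces have dimensions 3, 2, 2, which leaves thirteen possible coefficients of
  \<open>f\<close> instead of five; the other eight are removed by base changes inside the
  eigenspaces. Algebraic closedness supplies the seventh roots of unity and one cube root in the
  final rescaling.\<close>

definition poly_act :: "'a::field^'n^'n \<Rightarrow> 'a poly \<Rightarrow> 'a^'n \<Rightarrow> 'a^'n::finite" where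
  "poly_act A p v = (\<Sum>k\<le>degree p. coeff p k *s (((*v) A) ^^ k) v)"

lemma poly_act_bound:
  assumes "degree p \<le> n"
  shows "poly_act A p v = (\<Sum>k\<le>n. coeff p k *s (((*v) A) ^^ k) v)"
  unfolding poly_act_def
  by (rule sum.mono_neutral_left) (use assms in \<open>auto simp: coeff_eq_0\<close>)

lemma funpow_mult_vec_add:
  fixes A :: "'a::field^'n^'n"
  shows "(((*v) A) ^^ k) (u + v) = (((*v) A) ^^ k) u + (((*v) A) ^^ k) v"
  by (induction k) (auto simp: vec.add)

lemma funpow_mult_vec_scale:
  fixes A :: "'a::field^'n^'n"
  shows "(((*v) A) ^^ k) (c *s v) = c *s (((*v) A) ^^ k) v"
  by (induction k) (auto simp: vec.scale)

lemma poly_act_add_vec: "poly_act A p (u + v) = poly_act A p u + poly_act A p v"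
  unfolding poly_act_def funpow_mult_vec_add by (simp add: vec.scale_right_distrib sum.distrib)

lemma poly_act_zero_vec [simp]: "poly_act A p 0 = 0"
  using poly_act_add_vec[of A p 0 0] by simp

lemma poly_act_zero[simp]: "poly_act A 0 v = 0"
  by (simp add: poly_act_def)

lemma poly_act_add: "poly_act A (p + q) v = poly_act A p v + poly_act A q v"
proof -
  let ?n = "max (degree p) (degree q)"
  have "degree (p + q) \<le> ?n" "degree p \<le> ?n" "degree q \<le> ?n" by (auto intro: degree_add_le)
  then show ?thesis
    by (simp add: poly_act_bound[where n = ?n] vec.scale_left_distrib sum.distrib)
qed

lemma poly_act_const [simp]: "poly_act A [:c:] v = c *s v"
  by (simp add: poly_act_def)

lemma poly_act_one [simp]: "poly_act A 1 v = v"
  using poly_act_const[of A 1 v] by (simp add: one_pCons)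

lemma poly_act_shift: "poly_act A (pCons 0 p) v = A *v poly_act A p v"
proof -
  have "poly_act A (pCons 0 p) v = (\<Sum>k\<le>Suc (degree p). coeff (pCons 0 p) k *s (((*v) A) ^^ k) v)"
    by (rule poly_act_bound) (rule degree_pCons_le)
  also have "\<dots> = (\<Sum>k\<le>degree p. coeff p k *s (A *v (((*v) A) ^^ k) v))"
    by (subst sum.atMost_Suc_shift) simp
  finally show ?thesis by (simp add: poly_act_def vec.sum vec.scale)
qed

lemma poly_act_pCons: "poly_act A (pCons c p) v = c *s v + A *v poly_act A p v"
proof -
  have "pCons c p = [:c:] + pCons 0 p" by simp
  then show ?thesis by (metis poly_act_add poly_act_const poly_act_shift)
qed

lemma poly_act_smult: "poly_act A (smult c p) v = c *s poly_act A p v"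
  by (induction p) (auto simp: poly_act_pCons vec.scale vec.scale_right_distrib)

lemma poly_act_mult: "poly_act A (p * q) v = poly_act A p (poly_act A q v)"
  by (induction p)
    (auto simp: poly_act_pCons poly_act_add poly_act_smult)

lemma poly_act_sum: "poly_act A (\<Sum>i\<in>I. p i) v = (\<Sum>i\<in>I. poly_act A (p i) v)"
  by (induction I rule: infinite_finite_induct) (auto simp: poly_act_add)

lemma poly_act_sum_vec: "poly_act A p (\<Sum>i\<in>I. v i) = (\<Sum>i\<in>I. poly_act A p (v i))"
  by (induction I rule: infinite_finite_induct) (auto simp: poly_act_add_vec)

lemma poly_act_diff: "poly_act A (p - q) v = poly_act A p v - poly_act A q v"
  using poly_act_add[of A "p - q" q v] by simp

lemma poly_act_X_power: "poly_act A ([:0, 1:] ^ n) v = (((*v) A) ^^ n) v"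
  by (induction n) (auto simp: poly_act_mult poly_act_pCons)

lemma poly_act_in_subspace:
  assumes "vec.subspace M" "\<And>w. w \<in> M \<Longrightarrow> A *v w \<in> M" "v \<in> M"
  shows "poly_act A p v \<in> M"
  by (induction p) (use assms in \<open>auto simp: poly_act_pCons intro: vec.subspace_0 vec.subspace_add vec.subspace_scale\<close>)

text \<open>The map from polynomial vectors onto the space that sends \<open>t\<close> to the matrix;
  its kernel contains the image of the characteristic matrix.\<close>

definition eval_at :: "'a::field^'n^'n \<Rightarrow> 'a poly^'n \<Rightarrow> 'a^'n::finite" where
  "eval_at A f = (\<Sum>j\<in>UNIV. poly_act A (f $ j) (axis j 1))"

lemma eval_at_sum: "eval_at A (\<Sum>i\<in>I. f i) = (\<Sum>i\<in>I. eval_at A (f i))"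
  unfolding eval_at_def sum_component poly_act_sum by (rule sum.swap)

lemma eval_at_scale: "eval_at A (p *s f) = poly_act A p (eval_at A f)"
  by (simp add: eval_at_def poly_act_mult poly_act_sum_vec)

lemma eval_at_charmat: "eval_at A (charmat A *v f) = 0"
proof -
  have ch: "(charmat A *v f) $ i = [:0, 1:] * f $ i - (\<Sum>j\<in>UNIV. [:A $ i $ j:] * f $ j)" for i
  proof -
    have "(charmat A *v f) $ i
        = (\<Sum>j\<in>UNIV. (if i = j then [:0, 1:] else 0) * f $ j - [:A $ i $ j:] * f $ j)"
      by (simp add: charmat_def matrix_vector_mult_def mat_def map_matrix_def left_diff_distrib)
    also have "\<dots> = [:0, 1:] * f $ i - (\<Sum>j\<in>UNIV. [:A $ i $ j:] * f $ j)"
      unfolding sum_subtractf by (simp add: if_distrib[of "\<lambda>a. a * _"] cong: if_cong)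
    finally show ?thesis .
  qed
  have "eval_at A (charmat A *v f)
    = (\<Sum>i\<in>UNIV. A *v poly_act A (f $ i) (axis i 1))
      - (\<Sum>i\<in>UNIV. \<Sum>j\<in>UNIV. A $ i $ j *s poly_act A (f $ j) (axis i 1))"
    by (simp add: eval_at_def ch poly_act_diff poly_act_sum poly_act_smult poly_act_shift
        sum_subtractf)
  also have "(\<Sum>i\<in>UNIV. \<Sum>j\<in>UNIV. A $ i $ j *s poly_act A (f $ j) (axis i 1))
      = (\<Sum>j\<in>UNIV. poly_act A (f $ j) (A *v axis j 1))"
  proof -
    have col: "A *v axis j 1 = (\<Sum>i\<in>UNIV. poly_act A [:A $ i $ j:] (axis i 1))" for j
      by (simp add: vec_eq_iff matrix_vector_mult_def axis_def if_distrib cong: if_cong)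
    show ?thesis
      by (subst sum.swap) (simp only: col poly_act_sum_vec flip: poly_act_mult poly_act_const, simp add: mult.commute poly_act_smult)
  qed
  also have "(\<Sum>j\<in>UNIV. poly_act A (f $ j) (A *v axis j 1))
      = (\<Sum>j\<in>UNIV. A *v poly_act A (f $ j) (axis j 1))"
  proof (rule sum.cong[OF refl])
    fix j
    have "A *v v = poly_act A [:0, 1:] v" for v by (simp add: poly_act_pCons)
    then show "poly_act A (f $ j) (A *v axis j 1) = A *v poly_act A (f $ j) (axis j 1)"
      by (metis mult.commute poly_act_mult)
  qed
  finally show ?thesis by simp
qed

text \<open>The characteristic matrix presents the space as a module over the polynomial ring, with
  \<open>eval_at A\<close> as quotient map. Once \<open>P ** charmat A ** Q\<close> is diagonal, the
  columns of the inverse of \<open>P\<close> map to generators, and the i-th one is killed by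
  \<open>d i\<close>.\<close>

lemma invariant_factors_cyclic_vectors:
  fixes A :: "'a::field^'n::{finite,linorder}^'n::{finite,linorder}"
  assumes "invariant_factors A d"
  obtains w where "\<And>i. poly_act A (d i) (w i) = 0"
    and "\<And>v. \<exists>g. v = (\<Sum>i\<in>UNIV. poly_act A (g i) (w i))"
proof -
  obtain P Q where P: "invertible P"
    and eq: "P ** charmat A ** Q = (\<chi> i j. if i = j then d i else 0)"
    using assms unfolding invariant_factors_def by blast
  obtain R where R: "P ** R = mat 1" "R ** P = mat 1" using P unfolding invertible_def by blast
  let ?w = "\<lambda>i. eval_at A (R *v axis i 1)"
  have lin: "R *v g = (\<Sum>i\<in>UNIV. g $ i *s (R *v axis i 1))" for g
    by (simp add: vec_eq_iff matrix_vector_mult_def axis_def if_distrib mult.commute cong: if_cong)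
  have 1: "poly_act A (d i) (?w i) = 0" for i
  proof -
    \<comment> \<open>\<open>d i\<close> times the i-th column of \<open>R\<close> lies in the image
      of \<open>charmat A\<close>, which \<open>eval_at A\<close> sends to zero.\<close>
    have "charmat A ** Q = R ** (\<chi> i j. if i = j then d i else 0)"
      by (metis R(2) eq matrix_mul_assoc matrix_mul_lid)
    then have "charmat A *v (Q *v axis i 1) = R *v ((\<chi> i j. if i = j then d i else 0) *v axis i 1)"
      by (simp only: matrix_vector_mul_assoc)
    also have "(\<chi> i j. if i = j then d i else 0) *v axis i 1 = d i *s axis i 1"
      by (simp add: vec_eq_iff matrix_vector_mult_def axis_def if_distrib[of "\<lambda>a. _ * a"] cong: if_cong)
    also have "R *v (d i *s axis i 1) = d i *s (R *v axis i 1)"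
      by (simp add: vec_eq_iff matrix_vector_mult_def axis_def if_distrib mult.commute cong: if_cong)
    finally show ?thesis by (metis eval_at_charmat eval_at_scale)
  qed
  have 2: "\<exists>g. v = (\<Sum>i\<in>UNIV. poly_act A (g i) (?w i))" for v
  proof -
    \<comment> \<open>Constant polynomial vectors already lift every \<open>v\<close> through
      \<open>eval_at A\<close>.\<close>
    let ?c = "(\<chi> i. [:v $ i:])"
    have "v = eval_at A ?c" by (simp add: eval_at_def vec_eq_iff axis_def if_distrib cong: if_cong)
    also have "?c = R *v (P *v ?c)" by (simp add: matrix_vector_mul_assoc R(2))
    finally have "v = (\<Sum>i\<in>UNIV. poly_act A ((P *v ?c) $ i) (?w i))"
      by (subst (asm) lin) (simp add: eval_at_sum eval_at_scale)
    then show ?thesis by (intro exI[of _ "\<lambda>i. (P *v ?c) $ i"])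
  qed
  show thesis using that[of ?w] 1 2 by blast
qed

text \<open>Generation is phrased through invariant subspaces, the form in which it later shows that
  explicit orbits span.\<close>

lemma similarity_invariants_cyclic_vectors:
  fixes A :: "'a::field^'n::{finite,linorder}^'n::{finite,linorder}"
  assumes "similarity_invariants A fs"
  obtains ws where "list_all2 (\<lambda>p w. poly_act A p w = 0) fs ws"
    and "\<And>M. vec.subspace M \<Longrightarrow> (\<And>w. w \<in> M \<Longrightarrow> A *v w \<in> M) \<Longrightarrow> set ws \<subseteq> M \<Longrightarrow> M = UNIV"
proof -
  obtain d where d: "invariant_factors A d"
    and fs: "fs = filter (\<lambda>p. degree p > 0) (map d (sorted_list_of_set UNIV))"
    using assms unfolding similarity_invariants_def by blast
  obtain w where w0: "\<And>i. poly_act A (d i) (w i) = 0"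
    and gen: "\<And>v. \<exists>g. v = (\<Sum>i\<in>UNIV. poly_act A (g i) (w i))"
    using invariant_factors_cyclic_vectors[OF d] by blast
  define inds where "inds = filter (\<lambda>i. degree (d i) > 0) (sorted_list_of_set (UNIV :: 'n set))"
  \<comment> \<open>A monic constant is 1, and 1 annihilates only the zero vector, so the discarded
    invariant factors contribute no generators.\<close>
  have triv: "w i = 0" if "degree (d i) = 0" for i
  proof -
    have "d i = 1" using that d unfolding invariant_factors_def
      by (metis degree_0_id degree_eq_zeroE lead_coeff_pCons(2) one_pCons of_nat_0 pCons_0_0 coeff_pCons_0)
    then show ?thesis using w0[of i] by simp
  qed
  have fs': "fs = map d inds" unfolding fs inds_def by (simp add: filter_map comp_def)
  show thesis
  proof (rule that[of "map w inds"])
    show "list_all2 (\<lambda>p w. poly_act A p w = 0) fs (map w inds)"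
      unfolding fs' by (simp add: list_all2_conv_all_nth w0)
    fix M assume M: "vec.subspace M" "\<And>w. w \<in> M \<Longrightarrow> A *v w \<in> M" "set (map w inds) \<subseteq> M"
    have "w i \<in> M" for i
      using M(1,3) triv[of i] by (cases "degree (d i) = 0") (auto simp: inds_def vec.subspace_0)
    then have "(\<Sum>i\<in>UNIV. poly_act A (g i) (w i)) \<in> M" for g
      by (intro vec.subspace_sum M(1) poly_act_in_subspace M(2)) auto
    then show "M = UNIV" using gen by (metis UNIV_eq_I)
  qed
qed

subsection \<open>Scott's formula\<close>

text \<open>Preimages of a basis of the image, together with a basis of the kernel, span
  \<open>L\<close>.\<close>

lemma dim_le_kernel_plus_image:
  fixes g :: "'a::field^'m \<Rightarrow> 'a^'m" and L :: "('a^'m) set"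
  assumes g: "Vector_Spaces.linear (*s) (*s) g" and L: "vec.subspace L"
  shows "vec.dim L \<le> vec.dim {v \<in> L. g v = 0} + vec.dim (g ` L)"
proof -
  interpret g: Vector_Spaces.linear "(*s)" "(*s)" g by (fact g)
  obtain B where B: "B \<subseteq> {v \<in> L. g v = 0}" "vec.independent B" "{v \<in> L. g v = 0} \<subseteq> vec.span B"
      "card B = vec.dim {v \<in> L. g v = 0}"
    by (rule vec.basis_exists[of "{v \<in> L. g v = 0}"])
  obtain C where C: "C \<subseteq> g ` L" "vec.independent C" "g ` L \<subseteq> vec.span C" "card C = vec.dim (g ` L)"
    by (rule vec.basis_exists[of "g ` L"])
  have fin: "finite B" "finite C" using B(2) C(2) vec.finiteI_independent by auto
  have "\<forall>c\<in>C. \<exists>x. x \<in> L \<and> g x = c" using C(1) by fast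
  then obtain h where "\<forall>c\<in>C. h c \<in> L \<and> g (h c) = c" by (rule bchoice[THEN exE])
  then have h: "\<And>c. c \<in> C \<Longrightarrow> h c \<in> L \<and> g (h c) = c" by blast
  have "L \<subseteq> vec.span (B \<union> h ` C)"
  proof
    fix v assume v: "v \<in> L"
    have "g v \<in> vec.span C" using C(3) v by auto
    also have "vec.span C = g ` vec.span (h ` C)"
    proof -
      have "(\<lambda>c. g (h c)) ` C = C" using h by simp
      then have "C = g ` h ` C" by (simp add: image_image)
      then show ?thesis using g.span_image[of "h ` C"] by simp
    qed
    finally obtain u where u: "u \<in> vec.span (h ` C)" "g v = g u" by (rule imageE)
    have "h ` C \<subseteq> L" using h by blast
    then have "u \<in> L" using u(1) vec.span_minimal[OF _ L] by blast
    then have "v - u \<in> L" "g (v - u) = 0" using v u(2) L by (simp_all add: g.diff vec.subspace_diff)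
    then have "v - u \<in> vec.span B" using B(3) by blast
    then have "(v - u) + u \<in> vec.span (B \<union> h ` C)"
      by (intro vec.span_add subsetD[OF vec.span_mono[OF Un_upper1]] subsetD[OF vec.span_mono[OF Un_upper2]] u(1))
    then show "v \<in> vec.span (B \<union> h ` C)" by simp
  qed
  then have "vec.dim L \<le> card (B \<union> h ` C)" by (rule vec.dim_le_card) (simp add: fin)
  also have "\<dots> \<le> card B + card C"
    using card_Un_le[of B "h ` C"] card_image_le[OF fin(2), of h] by linarith
  finally show ?thesis using B(4) C(4) by simp
qed

lemma exists_functional_vanishing_on:
  fixes U :: "('a::field^'m) set"
  assumes U: "vec.subspace U" and v: "v \<notin> U"
  obtains l where "Vector_Spaces.linear (*s) (*) l" "l v = 1" "\<And>u. u \<in> U \<Longrightarrow> l u = 0"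
proof -
  interpret vp: vector_space_pair "(*s) :: 'a \<Rightarrow> 'a^'m \<Rightarrow> _" "(*) :: 'a \<Rightarrow> 'a \<Rightarrow> 'a"
    by unfold_locales
  obtain B where B: "B \<subseteq> U" "vec.independent B" "U \<subseteq> vec.span B"
    by (rule vec.basis_exists[of U])
  have "vec.span B = U" by (rule vec.span_subspace[OF B(1,3) U])
  then have "vec.independent (insert v B)" using B(2) v by (simp add: vec.independent_insert)
  then have "\<exists>l. Vector_Spaces.linear (*s) (*) l \<and> (\<forall>x\<in>insert v B. l x = (if x = v then 1 else 0))"
    by (rule vp.linear_independent_extend)
  then obtain l where l: "Vector_Spaces.linear (*s) (*) l"
    and lB: "\<forall>x\<in>insert v B. l x = (if x = v then 1 else 0)"
    by (elim exE conjE)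
  have "l u = 0" if "u \<in> U" for u
  proof (rule module_hom.eq_0_on_span[OF l[unfolded linear_iff_module_hom]])
    show "l x = 0" if "x \<in> B" for x using lB B(1) v that by auto
    show "u \<in> vec.span B" using B(3) that by (rule subsetD)
  qed
  then show thesis using that[OF l] lB by simp
qed

text \<open>Scott's formula. If there is neither an invariant vector nor an invariant functional then
  \<open>L = (1 - X) L + X (1 - Y) L\<close>, and \<open>1 - X\<close> embeds the kernel of \<open>1 - X Y\<close> into the
  intersection of the two summands.\<close>

lemma scott_dichotomy:
  fixes X Y :: "'a::field^'m \<Rightarrow> 'a^'m" and L :: "('a^'m) set"
  assumes X: "Vector_Spaces.linear (*s) (*s) X" and Y: "Vector_Spaces.linear (*s) (*s) Y"
    and L: "vec.subspace L" and XL: "\<And>v. v \<in> L \<Longrightarrow> X v \<in> L" and YL: "\<And>v. v \<in> L \<Longrightarrow> Y v \<in> L"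
    and inj: "\<And>v. v \<in> L \<Longrightarrow> X v = 0 \<Longrightarrow> v = 0"
    and ranks: "vec.dim ((\<lambda>v. v - X v) ` L) + vec.dim ((\<lambda>v. v - Y v) ` L)
        + vec.dim ((\<lambda>v. v - X (Y v)) ` L) < 2 * vec.dim L"
  shows "(\<exists>v\<in>L. v \<noteq> 0 \<and> X v = v \<and> Y v = v) \<or>
    (\<exists>l. Vector_Spaces.linear (*s) (*) l \<and> (\<exists>v\<in>L. l v \<noteq> 0) \<and> (\<forall>v\<in>L. l (X v) = l v \<and> l (Y v) = l v))"
proof (rule ccontr)
  assume neg: "\<not> ?thesis"
  interpret X: Vector_Spaces.linear "(*s)" "(*s)" X by (fact X)
  interpret Y: Vector_Spaces.linear "(*s)" "(*s)" Y by (fact Y)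
  let ?U = "(\<lambda>v. v - X v) ` L" and ?W = "(\<lambda>v. X (v - Y v)) ` L" and ?K = "{v \<in> L. v - X (Y v) = 0}"
  have lin: "Vector_Spaces.linear (*s) (*s) (\<lambda>v. v - X v)" "Vector_Spaces.linear (*s) (*s) (\<lambda>v. v - Y v)"
    "Vector_Spaces.linear (*s) (*s) (\<lambda>v. v - X (Y v))" "Vector_Spaces.linear (*s) (*s) (\<lambda>v. X (v - Y v))"
    by unfold_locales (simp_all add: X.add Y.add X.scale Y.scale X.diff vec.scale_right_diff_distrib)
  have UL: "?U \<subseteq> L" and WL: "?W \<subseteq> L" using L XL YL by (auto intro!: vec.subspace_diff)
  have sU: "vec.subspace ?U" and sW: "vec.subspace ?W"
    using lin(1,4) L by (auto intro: module_hom.subspace_image simp: linear_iff_module_hom)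
  let ?S = "{u + w |u w. u \<in> ?U \<and> w \<in> ?W}"
  have sS: "vec.subspace ?S" by (rule vec.subspace_sums[OF sU sW])
  \<comment> \<open>A functional that kills both summands but not all of \<open>L\<close> would be
    invariant, which \<open>neg\<close> forbids.\<close>
  have S: "?S = L"
  proof (rule ccontr)
    assume "?S \<noteq> L"
    moreover have "?S \<subseteq> L" using UL WL vec.subspace_add[OF L] by blast
    ultimately obtain v where v: "v \<in> L" "v \<notin> ?S" by blast
    obtain l where l: "Vector_Spaces.linear (*s) (*) l" "l v = 1" "\<And>u. u \<in> ?S \<Longrightarrow> l u = 0"
      using exists_functional_vanishing_on[OF sS v(2)] by blast
    interpret l: Vector_Spaces.linear "(*s)" "(*)" l by (fact l(1))
    have lU: "l (v - X v) = 0" if "v \<in> L" for v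
    proof -
      have "(v - X v) + 0 \<in> ?S" using that vec.subspace_0[OF sW] by blast
      then show ?thesis using l(3) by simp
    qed
    have lW: "l (X (v - Y v)) = 0" if "v \<in> L" for v
    proof -
      have "0 + X (v - Y v) \<in> ?S" using that vec.subspace_0[OF sU] by blast
      then show ?thesis using l(3)[of "X (v - Y v)"] by simp
    qed
    have "l (X v) = l v \<and> l (Y v) = l v" if "v \<in> L" for v
    proof -
      \<comment> \<open>Since \<open>l\<close> kills \<open>(1 - X) L\<close>, it takes the same
        value at \<open>v - Y v\<close> and at \<open>X (v - Y v)\<close>, and the latter is
        zero.\<close>
      have "v - Y v \<in> L" using that L YL by (auto intro: vec.subspace_diff)
      then show ?thesis using lU[OF that] lU[of "v - Y v"] lW[OF that] by (simp add: l.diff)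
    qed
    then have inv: "\<forall>v\<in>L. l (X v) = l v \<and> l (Y v) = l v" by blast
    have "\<exists>v\<in>L. l v \<noteq> 0" using l(2) v(1) by (intro bexI[of _ v]) auto
    then show False using neg l(1) inv by blast
  qed
  have "vec.dim ?K = vec.dim ((\<lambda>v. v - X v) ` ?K)"
  proof (rule vec.dim_image_eq[OF lin(1), symmetric])
    have "vec.subspace ?K"
      using vec.subspace_inter[OF L module_hom.subspace_kernel[OF lin(3)[unfolded linear_iff_module_hom]]]
      by (simp add: Collect_conj_eq)
    then have sp: "vec.span ?K = ?K" by simp
    show "inj_on (\<lambda>v. v - X v) (vec.span ?K)"
    proof (subst sp, rule inj_onI)
      fix u v assume uv: "u \<in> ?K" "v \<in> ?K" "u - X u = v - X v"
      \<comment> \<open>A vector fixed by \<open>X\<close> and by \<open>X Y\<close> satisfies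
        \<open>X (Y d) = X d\<close>; cancelling \<open>X\<close> makes it fixed by \<open>Y\<close>
        too, hence zero by \<open>neg\<close>.\<close>
      define d where "d = u - v"
      have d: "d \<in> L" "X d = d" "X (Y d) = d"
        using uv L by (auto simp: d_def X.diff Y.diff algebra_simps intro: vec.subspace_diff)
      have "X (Y d - d) = 0" using d by (simp add: X.diff)
      then have "Y d = d" using inj[of "Y d - d"] d(1) YL L by (auto intro: vec.subspace_diff)
      then have "d = 0" using neg d(1,2) by metis
      then show "u = v" by (simp add: d_def)
    qed
  qed
  also have "\<dots> \<le> vec.dim (?U \<inter> ?W)"
  proof (rule vec.dim_subset)
    have "v - X v \<in> ?W" if "v \<in> ?K" for v
    proof -
      \<comment> \<open>On the kernel \<open>v = X (Y v)\<close>, so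
        \<open>v - X v = X (Y v - v)\<close>.\<close>
      have "v - X v = X ((-v) - Y (-v))" using that by (simp add: X.diff X.neg Y.neg)
      moreover have "- v \<in> L" using that L by (auto intro: vec.subspace_neg)
      ultimately show ?thesis by blast
    qed
    then show "(\<lambda>v. v - X v) ` ?K \<subseteq> ?U \<inter> ?W" by blast
  qed
  finally have 1: "vec.dim ?K \<le> vec.dim (?U \<inter> ?W)" .
  have 2: "vec.dim L + vec.dim (?U \<inter> ?W) = vec.dim ?U + vec.dim ?W"
    using vec.dim_sums_Int[OF sU sW] S by simp
  have 3: "vec.dim ?W \<le> vec.dim ((\<lambda>v. v - Y v) ` L)"
    using vec.dim_image_le[OF X, of "(\<lambda>v. v - Y v) ` L"] by (simp add: image_image)
  have 4: "vec.dim L \<le> vec.dim ?K + vec.dim ((\<lambda>v. v - X (Y v)) ` L)"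
    by (rule dim_le_kernel_plus_image[OF lin(3) L])
  \<comment> \<open>Chained together: dim L is at most dim K + rank(1 - X Y), and dim K is at most
    dim U + dim W - dim L. Hence twice dim L is bounded by the sum of the three ranks.\<close>
  show False using 1 2 3 4 ranks by linarith
qed

text \<open>On a free orbit the differences \<open>Z\<^sup>k t - Z\<^sup>k\<^sup>+\<^sup>1 t\<close> sum to zero, so the last one is redundant.\<close>

lemma dim_image_diff_le:
  fixes Z :: "'a::field^'m \<Rightarrow> 'a^'m"
  assumes Z: "Vector_Spaces.linear (*s) (*s) Z"
    and span: "L \<subseteq> vec.span (F \<union> (\<Union>t\<in>set ts. (\<lambda>k. (Z ^^ k) t) ` {..n}))"
    and F: "\<And>v. v \<in> F \<Longrightarrow> Z v = v" and ts: "\<And>t. t \<in> set ts \<Longrightarrow> (Z ^^ Suc n) t = t"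
  shows "vec.dim ((\<lambda>v. v - Z v) ` L) \<le> n * length ts"
proof -
  interpret Z: Vector_Spaces.linear "(*s)" "(*s)" Z by (fact Z)
  let ?g = "\<lambda>v. v - Z v"
  have "Vector_Spaces.linear (*s) (*s) ?g"
    by unfold_locales (simp_all add: Z.add Z.scale vec.scale_right_diff_distrib)
  then interpret g: Vector_Spaces.linear "(*s)" "(*s)" ?g .
  let ?D = "(\<lambda>(t, k). ?g ((Z ^^ k) t)) ` (set ts \<times> {..<n})"
  let ?G = "F \<union> (\<Union>t\<in>set ts. (\<lambda>k. (Z ^^ k) t) ` {..n})"
  have "?g v \<in> vec.span ?D" if vG: "v \<in> ?G" for v
  proof -
    have low: "?g ((Z ^^ k) t) \<in> vec.span ?D" if "t \<in> set ts" "k < n" for t k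
      using that by (intro vec.span_base image_eqI[of _ _ "(t, k)"]) auto
    have "?g ((Z ^^ n) t) \<in> vec.span ?D" if t: "t \<in> set ts" for t
    proof -
      have "(\<Sum>k<n. ?g ((Z ^^ k) t)) = t - (Z ^^ n) t"
        using sum_lessThan_telescope'[of "\<lambda>k. (Z ^^ k) t" n] by simp
      then have "?g ((Z ^^ n) t) = - (\<Sum>k<n. ?g ((Z ^^ k) t))" using ts[OF t] by simp
      then show ?thesis using low[OF t] by (auto intro!: vec.span_neg vec.span_sum)
    qed
    note last = this
    show ?thesis
    proof (cases "v \<in> F")
      case True
      then show ?thesis using F by (simp add: vec.span_zero)
    next
      case False
      then obtain t k where "t \<in> set ts" "k \<le> n" "v = (Z ^^ k) t" using vG by blast
      then show ?thesis using low last by (cases "k = n") auto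
    qed
  qed
  then have "?g ` ?G \<subseteq> vec.span ?D" by blast
  then have "vec.span (?g ` ?G) \<subseteq> vec.span ?D" by (simp add: vec.span_minimal)
  then have "?g ` L \<subseteq> vec.span ?D" using g.spans_image[OF span] by blast
  then have "vec.dim (?g ` L) \<le> card ?D" by (rule vec.dim_le_card) auto
  also have "\<dots> \<le> card (set ts \<times> {..<n})" by (rule card_image_le) auto
  also have "\<dots> \<le> n * length ts" by (simp add: card_cartesian_product card_length)
  finally show ?thesis .
qed

subsection \<open>Symmetric and alternating tensors\<close>

text \<open>Tensors are coordinate vectors indexed by triples, so they have the type for which
  Scott's formula is proved; the alternating ones form a subspace of it, which is the role of
  \<open>L\<close> there.\<close>

definition tensor3 :: "'a::field^'n \<Rightarrow> 'a^'n \<Rightarrow> 'a^'n \<Rightarrow> 'a^('n::finite \<times> 'n \<times> 'n)" where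
  "tensor3 u v w = (\<chi> p. case p of (i, j, k) \<Rightarrow> u $ i * v $ j * w $ k)"

text \<open>Antisymmetrization without the factor 1/6. On three distinct standard basis vectors the
  entries are 0, 1 and -1, so nothing degenerates in characteristic 2 or 3.\<close>

definition wedge_tensor :: "'a::field^'n \<Rightarrow> 'a^'n \<Rightarrow> 'a^'n \<Rightarrow> 'a^('n::finite \<times> 'n \<times> 'n)" where
  "wedge_tensor u v w = tensor3 u v w + tensor3 v w u + tensor3 w u v
     - tensor3 v u w - tensor3 u w v - tensor3 w v u"

definition tensor3_map :: "'a::field^'n^'n \<Rightarrow> 'a^('n \<times> 'n \<times> 'n) \<Rightarrow> 'a^('n::finite \<times> 'n \<times> 'n)" where
  "tensor3_map A t = (\<chi> p. case p of (i, j, k) \<Rightarrow> \<Sum>a\<in>UNIV. \<Sum>b\<in>UNIV. \<Sum>c\<in>UNIV. A $ i $ a * A $ j $ b * A $ k $ c * t $ (a, b, c))"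

definition alt_tensors :: "('a::field^('n::finite \<times> 'n \<times> 'n)) set" where
  "alt_tensors = vec.span {wedge_tensor u v w |u v w. True}"

definition square_tensor :: "'a::field^'n \<Rightarrow> 'a^('n::finite \<times> 'n)" where
  "square_tensor u = (\<chi> p. case p of (i, j) \<Rightarrow> u $ i * u $ j)"

definition polar_tensor :: "'a::field^'n \<Rightarrow> 'a^'n \<Rightarrow> 'a^('n::finite \<times> 'n)" where
  "polar_tensor u v = (\<chi> p. case p of (i, j) \<Rightarrow> u $ i * v $ j + v $ i * u $ j)"

definition tensor2_map :: "'a::field^'n^'n \<Rightarrow> 'a^('n \<times> 'n) \<Rightarrow> 'a^('n::finite \<times> 'n)" where
  "tensor2_map A t = (\<chi> p. case p of (i, j) \<Rightarrow> \<Sum>a\<in>UNIV. \<Sum>b\<in>UNIV. A $ i $ a * A $ j $ b * t $ (a, b))"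

text \<open>The span of the squares contains all polar tensors but, in characteristic 2, is larger
  than their span. A functional on it is a quadratic form
  \<open>u \<mapsto> l (square_tensor u)\<close>, which its polar form need not determine.\<close>

definition sym_tensors :: "('a::field^('n::finite \<times> 'n)) set" where
  "sym_tensors = vec.span (range square_tensor)"

lemma tensor3_map_linear: "Vector_Spaces.linear (*s) (*s) (tensor3_map A)"
  by unfold_locales (simp_all add: tensor3_map_def vec_eq_iff distrib_left sum.distrib sum_distrib_left mult_ac)

lemma tensor2_map_linear: "Vector_Spaces.linear (*s) (*s) (tensor2_map A)"
  by unfold_locales (simp_all add: tensor2_map_def vec_eq_iff distrib_left sum.distrib sum_distrib_left mult_ac)

lemma tensor3_map_tensor3: "tensor3_map A (tensor3 u v w) = tensor3 (A *v u) (A *v v) (A *v w)"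
proof -
  have "(\<Sum>a\<in>UNIV. \<Sum>b\<in>UNIV. \<Sum>c\<in>UNIV. A $ i $ a * A $ j $ b * A $ k $ c * (u $ a * v $ b * w $ c))
    = (\<Sum>a\<in>UNIV. A $ i $ a * u $ a) * (\<Sum>b\<in>UNIV. A $ j $ b * v $ b) * (\<Sum>c\<in>UNIV. A $ k $ c * w $ c)" for i j k
    by (subst sum_product, subst sum_distrib_right, subst sum_distrib_right, simp add: sum_distrib_left mult_ac)
  then show ?thesis
    by (simp add: tensor3_map_def tensor3_def vec_eq_iff matrix_vector_mult_def)
qed

lemma tensor3_map_wedge: "tensor3_map A (wedge_tensor u v w) = wedge_tensor (A *v u) (A *v v) (A *v w)"
proof -
  interpret Vector_Spaces.linear "(*s)" "(*s)" "tensor3_map A" by (rule tensor3_map_linear)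
  show ?thesis by (simp add: wedge_tensor_def add diff tensor3_map_tensor3)
qed

lemma tensor2_map_square: "tensor2_map A (square_tensor u) = square_tensor (A *v u)"
proof -
  have "(\<Sum>a\<in>UNIV. \<Sum>b\<in>UNIV. A $ i $ a * A $ j $ b * (u $ a * u $ b))
    = (\<Sum>a\<in>UNIV. A $ i $ a * u $ a) * (\<Sum>b\<in>UNIV. A $ j $ b * u $ b)" for i j
    by (subst sum_product) (simp add: mult_ac)
  then show ?thesis
    by (simp add: tensor2_map_def square_tensor_def vec_eq_iff matrix_vector_mult_def)
qed

lemma polar_tensor_eq: "polar_tensor u v = square_tensor (u + v) - square_tensor u - square_tensor v"
  by (simp add: polar_tensor_def square_tensor_def vec_eq_iff algebra_simps)

lemma tensor2_map_polar: "tensor2_map A (polar_tensor u v) = polar_tensor (A *v u) (A *v v)"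
proof -
  interpret Vector_Spaces.linear "(*s)" "(*s)" "tensor2_map A" by (rule tensor2_map_linear)
  show ?thesis by (simp add: polar_tensor_eq diff tensor2_map_square vec.add)
qed

lemma wedge_tensor_add1: "wedge_tensor (u + u') v w = wedge_tensor u v w + wedge_tensor u' v w"
  and wedge_tensor_scale1: "wedge_tensor (c *s u) v w = c *s wedge_tensor u v w"
  and wedge_tensor_self: "wedge_tensor u u v = 0"
  by (simp_all add: wedge_tensor_def tensor3_def vec_eq_iff algebra_simps)

lemma wedge_tensor_add2: "wedge_tensor u (v + v') w = wedge_tensor u v w + wedge_tensor u v' w"
  and wedge_tensor_scale2: "wedge_tensor u (c *s v) w = c *s wedge_tensor u v w"
  and wedge_tensor_add3: "wedge_tensor u v (w + w') = wedge_tensor u v w + wedge_tensor u v w'"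
  and wedge_tensor_scale3: "wedge_tensor u v (c *s w) = c *s wedge_tensor u v w"
  by (simp_all add: wedge_tensor_def tensor3_def vec_eq_iff algebra_simps)

lemma wedge_tensor_zero [simp]:
  "wedge_tensor 0 v w = 0" "wedge_tensor u 0 w = 0" "wedge_tensor u v 0 = 0"
  by (simp_all add: wedge_tensor_def tensor3_def vec_eq_iff)

lemma polar_tensor_add1: "polar_tensor (u + u') v = polar_tensor u v + polar_tensor u' v"
  and polar_tensor_scale1: "polar_tensor (c *s u) v = c *s polar_tensor u v"
  and polar_tensor_add2: "polar_tensor u (v + v') = polar_tensor u v + polar_tensor u v'"
  and polar_tensor_scale2: "polar_tensor u (c *s v) = c *s polar_tensor u v"
  and polar_tensor_commute: "polar_tensor v u = polar_tensor u v"
  and square_tensor_scale: "square_tensor (c *s u) = (c * c) *s square_tensor u"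
  and square_tensor_add: "square_tensor (u + v) = square_tensor u + square_tensor v + polar_tensor u v"
  by (simp_all add: polar_tensor_def square_tensor_def vec_eq_iff algebra_simps)

lemma polar_tensor_zero [simp]: "polar_tensor 0 v = 0" "polar_tensor u 0 = 0" "square_tensor 0 = 0"
  by (simp_all add: polar_tensor_def square_tensor_def vec_eq_iff)

lemma subspace_alt_tensors: "vec.subspace alt_tensors"
  by (simp add: alt_tensors_def)

lemma subspace_sym_tensors: "vec.subspace sym_tensors"
  by (simp add: sym_tensors_def)

lemma wedge_in_alt_tensors: "wedge_tensor u v w \<in> alt_tensors"
  unfolding alt_tensors_def by (rule vec.span_base) blast

lemma square_in_sym_tensors: "square_tensor u \<in> sym_tensors"
  unfolding sym_tensors_def by (rule vec.span_base) blast

lemma polar_in_sym_tensors: "polar_tensor u v \<in> sym_tensors"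
  unfolding polar_tensor_eq by (intro vec.subspace_diff subspace_sym_tensors square_in_sym_tensors)

section \<open>Reduction to spanning vectors, and functoriality of the tensor maps\<close>

lemma span_UNIV_induct:
  assumes B: "vec.span B = UNIV" and base: "\<And>x. x \<in> B \<Longrightarrow> P x" and zero: "P 0"
    and add: "\<And>x y. P x \<Longrightarrow> P y \<Longrightarrow> P (x + y)" and scale: "\<And>c x. P x \<Longrightarrow> P (c *s x)"
  shows "P x"
proof -
  have "vec.span B \<subseteq> Collect P"
    using base zero add scale by (intro vec.span_minimal vec.subspaceI) auto
  then show ?thesis using B by auto
qed

lemma alt_tensors_subset:
  assumes M: "vec.subspace M" and B: "vec.span B = UNIV"
    and gen: "\<And>u v w. u \<in> B \<Longrightarrow> v \<in> B \<Longrightarrow> w \<in> B \<Longrightarrow> wedge_tensor u v w \<in> M"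
  shows "alt_tensors \<subseteq> M"
proof -
  have 1: "wedge_tensor u v w \<in> M" if "v \<in> B" "w \<in> B" for u v w
    by (rule span_UNIV_induct[OF B, of _ u])
      (use that M in \<open>auto simp: wedge_tensor_add1 wedge_tensor_scale1 vec.subspace_0 intro: vec.subspace_add vec.subspace_scale gen\<close>)
  have 2: "wedge_tensor u v w \<in> M" if "w \<in> B" for u v w
    by (rule span_UNIV_induct[OF B, of _ v])
      (use that M in \<open>auto simp: wedge_tensor_add2 wedge_tensor_scale2 vec.subspace_0 intro: vec.subspace_add vec.subspace_scale 1\<close>)
  have 3: "wedge_tensor u v w \<in> M" for u v w
    by (rule span_UNIV_induct[OF B, of _ w])
      (use M in \<open>auto simp: wedge_tensor_add3 wedge_tensor_scale3 vec.subspace_0 intro: vec.subspace_add vec.subspace_scale 2\<close>)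
  show ?thesis unfolding alt_tensors_def by (rule vec.span_minimal[OF _ M]) (use 3 in blast)
qed

lemma sym_tensors_subset:
  assumes M: "vec.subspace M" and B: "vec.span B = UNIV"
    and sq: "\<And>u. u \<in> B \<Longrightarrow> square_tensor u \<in> M"
    and po: "\<And>u v. u \<in> B \<Longrightarrow> v \<in> B \<Longrightarrow> polar_tensor u v \<in> M"
  shows "sym_tensors \<subseteq> M"
proof -
  have 1: "polar_tensor u v \<in> M" if "v \<in> B" for u v
    by (rule span_UNIV_induct[OF B, of _ u])
      (use that M in \<open>auto simp: polar_tensor_add1 polar_tensor_scale1 vec.subspace_0 intro: vec.subspace_add vec.subspace_scale po\<close>)
  have 2: "polar_tensor u v \<in> M" for u v
    by (rule span_UNIV_induct[OF B, of _ v])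
      (use M in \<open>auto simp: polar_tensor_add2 polar_tensor_scale2 vec.subspace_0 intro: vec.subspace_add vec.subspace_scale 1\<close>)
  have 3: "square_tensor u \<in> M" for u
    by (rule span_UNIV_induct[OF B, of _ u])
      (use M in \<open>auto simp: square_tensor_add square_tensor_scale vec.subspace_0 intro: vec.subspace_add vec.subspace_scale sq 2\<close>)
  show ?thesis unfolding sym_tensors_def by (rule vec.span_minimal[OF _ M]) (use 3 in blast)
qed

lemma tensor3_map_closed: assumes "t \<in> alt_tensors" shows "tensor3_map A t \<in> alt_tensors"
proof -
  have "alt_tensors \<subseteq> {t. tensor3_map A t \<in> alt_tensors}"
    by (rule alt_tensors_subset[of _ UNIV])
      (auto simp: tensor3_map_wedge wedge_in_alt_tensors
        intro: module_hom.subspace_linear_preimage[OF tensor3_map_linear[unfolded linear_iff_module_hom] subspace_alt_tensors])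
  then show ?thesis using assms by blast
qed

lemma tensor2_map_closed: assumes "t \<in> sym_tensors" shows "tensor2_map A t \<in> sym_tensors"
proof -
  have "sym_tensors \<subseteq> {t. tensor2_map A t \<in> sym_tensors}"
    by (rule sym_tensors_subset[of _ UNIV])
      (auto simp: tensor2_map_square tensor2_map_polar square_in_sym_tensors polar_in_sym_tensors
        intro: module_hom.subspace_linear_preimage[OF tensor2_map_linear[unfolded linear_iff_module_hom] subspace_sym_tensors])
  then show ?thesis using assms by blast
qed

lemma tensor3_map_comp:
  assumes "t \<in> alt_tensors"
  shows "tensor3_map A (tensor3_map B t) = tensor3_map (A ** B) t"
proof -
  interpret a: Vector_Spaces.linear "(*s)" "(*s)" "tensor3_map A" by (rule tensor3_map_linear)
  interpret b: Vector_Spaces.linear "(*s)" "(*s)" "tensor3_map B" by (rule tensor3_map_linear)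
  interpret c: Vector_Spaces.linear "(*s)" "(*s)" "tensor3_map (A ** B)" by (rule tensor3_map_linear)
  have "alt_tensors \<subseteq> {t. tensor3_map A (tensor3_map B t) = tensor3_map (A ** B) t}"
    by (rule alt_tensors_subset[of _ UNIV])
      (auto simp: tensor3_map_wedge matrix_vector_mul_assoc a.add b.add c.add a.scale b.scale c.scale intro!: vec.subspaceI)
  then show ?thesis using assms by auto
qed

lemma tensor3_map_inj:
  assumes A: "B ** A = mat 1" and t: "t \<in> alt_tensors" "tensor3_map A t = 0"
  shows "t = 0"
proof -
  interpret b: Vector_Spaces.linear "(*s)" "(*s)" "tensor3_map B" by (rule tensor3_map_linear)
  interpret c: Vector_Spaces.linear "(*s)" "(*s)" "tensor3_map (mat 1)" by (rule tensor3_map_linear)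
  have "alt_tensors \<subseteq> {t. tensor3_map (mat 1) t = t}"
    by (rule alt_tensors_subset[of _ UNIV])
      (auto simp: tensor3_map_wedge c.add c.scale intro!: vec.subspaceI)
  then have "t = tensor3_map (B ** A) t" using A t(1) by auto
  also have "\<dots> = tensor3_map B (tensor3_map A t)" using tensor3_map_comp[OF t(1)] by simp
  finally show ?thesis using t(2) by simp
qed

lemma tensor2_map_comp:
  assumes "t \<in> sym_tensors"
  shows "tensor2_map A (tensor2_map B t) = tensor2_map (A ** B) t"
proof -
  interpret a: Vector_Spaces.linear "(*s)" "(*s)" "tensor2_map A" by (rule tensor2_map_linear)
  interpret b: Vector_Spaces.linear "(*s)" "(*s)" "tensor2_map B" by (rule tensor2_map_linear)
  interpret c: Vector_Spaces.linear "(*s)" "(*s)" "tensor2_map (A ** B)" by (rule tensor2_map_linear)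
  have "sym_tensors \<subseteq> {t. tensor2_map A (tensor2_map B t) = tensor2_map (A ** B) t}"
    by (rule sym_tensors_subset[of _ UNIV])
      (auto simp: tensor2_map_square tensor2_map_polar matrix_vector_mul_assoc a.add b.add c.add a.scale b.scale c.scale intro!: vec.subspaceI)
  then show ?thesis using assms by auto
qed

lemma tensor2_map_inj:
  assumes A: "B ** A = mat 1" and t: "t \<in> sym_tensors" "tensor2_map A t = 0"
  shows "t = 0"
proof -
  interpret b: Vector_Spaces.linear "(*s)" "(*s)" "tensor2_map B" by (rule tensor2_map_linear)
  interpret c: Vector_Spaces.linear "(*s)" "(*s)" "tensor2_map (mat 1)" by (rule tensor2_map_linear)
  have "sym_tensors \<subseteq> {t. tensor2_map (mat 1) t = t}"
    by (rule sym_tensors_subset[of _ UNIV])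
      (auto simp: tensor2_map_square tensor2_map_polar c.add c.scale intro!: vec.subspaceI)
  then have "t = tensor2_map (B ** A) t" using A t(1) by auto
  also have "\<dots> = tensor2_map B (tensor2_map A t)" using tensor2_map_comp[OF t(1)] by simp
  finally show ?thesis using t(2) by simp
qed

lemma alt_tensors_antisym:
  assumes "t \<in> alt_tensors"
  shows "t $ (j, i, k) = - t $ (i, j, k)" "t $ (i, k, j) = - t $ (i, j, k)"
proof -
  have "alt_tensors \<subseteq> {t. t $ (j, i, k) = - t $ (i, j, k) \<and> t $ (i, k, j) = - t $ (i, j, k)}"
    by (rule alt_tensors_subset[of _ UNIV])
      (auto simp: wedge_tensor_def tensor3_def algebra_simps intro!: vec.subspaceI)
  then show "t $ (j, i, k) = - t $ (i, j, k)" "t $ (i, k, j) = - t $ (i, j, k)" using assms by auto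
qed

lemma sym_tensors_sym:
  assumes "t \<in> sym_tensors"
  shows "t $ (j, i) = t $ (i, j)"
proof -
  have "sym_tensors \<subseteq> {t. t $ (j, i) = t $ (i, j)}"
    by (rule sym_tensors_subset[of _ UNIV])
      (auto simp: square_tensor_def polar_tensor_def algebra_simps intro!: vec.subspaceI)
  then show ?thesis using assms by auto
qed

text \<open>An orbit swept out by \<open>n + 1\<close> powers of \<open>Z\<close> contributes at
  most \<open>n\<close> to the rank of \<open>1 - Z\<close>, and a fixed tensor contributes nothing.
  Signs do not affect spans, so \<open>cover\<close> may do its bookkeeping on sorted index lists,
  where it can be decided by evaluation. Signs matter only in \<open>fixed\<close>, where a tensor
  mapped to its negative would not qualify.\<close>

lemma monomial_rank_le:
  fixes E :: "nat list \<Rightarrow> 'a::field^'m" and \<sigma> :: "nat \<Rightarrow> nat"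
  assumes Z: "Vector_Spaces.linear (*s) (*s) Z"
    and span: "L \<subseteq> vec.span (E ` set idx)"
    and perm: "\<And>l. length l = k \<Longrightarrow> set l \<subseteq> {..<N} \<Longrightarrow> Z (E l) = E (map \<sigma> l) \<or> Z (E l) = - E (map \<sigma> l)"
    and swap: "\<And>l l'. length l = k \<Longrightarrow> mset l = mset l' \<Longrightarrow> E l = E l' \<or> E l = - E l'"
    and \<sigma>: "\<forall>i<N. \<sigma> i < N"
    and fixed: "\<And>l. l \<in> set fs \<Longrightarrow> Z (E l) = E l"
    and rs: "\<forall>r\<in>set rs. length r = k \<and> set r \<subseteq> {..<N}"
    and cyc: "\<And>l. (Z ^^ Suc n) (E l) = E l"
    and cover: "list_all (\<lambda>l. l \<in> set fs \<or>
      list_ex (\<lambda>r. list_ex (\<lambda>m. sort (map (\<sigma> ^^ m) r) = l) [0..<Suc n]) rs) idx"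
  shows "vec.dim ((\<lambda>v. v - Z v) ` L) \<le> n * length rs"
proof -
  interpret Z: Vector_Spaces.linear "(*s)" "(*s)" Z by (fact Z)
  have iter: "set (map (\<sigma> ^^ m) r) \<subseteq> {..<N} \<and>
      ((Z ^^ m) (E r) = E (map (\<sigma> ^^ m) r) \<or> (Z ^^ m) (E r) = - E (map (\<sigma> ^^ m) r))"
    if r: "length r = k" "set r \<subseteq> {..<N}" for r m
  proof (induction m)
    case 0
    then show ?case using r by simp
  next
    case (Suc m)
    have "map (\<sigma> ^^ Suc m) r = map \<sigma> (map (\<sigma> ^^ m) r)" by simp
    moreover have "set (map \<sigma> (map (\<sigma> ^^ m) r)) \<subseteq> {..<N}" using Suc \<sigma> by auto
    moreover have "(Z ^^ Suc m) (E r) = Z ((Z ^^ m) (E r))" by simp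
    ultimately show ?case
      using Suc perm[of "map (\<sigma> ^^ m) r"] r(1) by (auto simp: Z.neg simp del: map_map funpow.simps)
  qed
  let ?F = "E ` set fs"
  let ?G = "\<Union>t\<in>set (map E rs). (\<lambda>j. (Z ^^ j) t) ` {..n}"
  have "E l \<in> vec.span (?F \<union> ?G)" if l: "l \<in> set idx" for l
  proof (cases "l \<in> set fs")
    case True
    then show ?thesis by (auto intro: vec.span_base)
  next
    case False
    then obtain r m where r: "r \<in> set rs" "m < Suc n" "sort (map (\<sigma> ^^ m) r) = l"
      using cover l by (fastforce simp: list_all_iff list_ex_iff simp del: upt_Suc)
    have len: "length r = k" "set r \<subseteq> {..<N}" using rs r(1) by auto
    have "mset (map (\<sigma> ^^ m) r) = mset l" using r(3) by (metis mset_sort)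
    then have "E l = E (map (\<sigma> ^^ m) r) \<or> E l = - E (map (\<sigma> ^^ m) r)"
      using swap[of "map (\<sigma> ^^ m) r" l] len(1) by (auto simp: minus_equation_iff)
    then have "E l = (Z ^^ m) (E r) \<or> E l = - (Z ^^ m) (E r)"
      using iter[OF len, of m] by auto
    moreover have "(Z ^^ m) (E r) \<in> vec.span (?F \<union> ?G)"
      using r(1,2) by (intro vec.span_base) (auto simp: less_Suc_eq_le)
    ultimately show ?thesis by (auto intro: vec.span_neg)
  qed
  then have "vec.span (E ` set idx) \<subseteq> vec.span (?F \<union> ?G)"
    by (intro vec.span_minimal) auto
  then have "L \<subseteq> vec.span (?F \<union> ?G)" using span by blast
  then have "vec.dim ((\<lambda>v. v - Z v) ` L) \<le> n * length (map E rs)"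
    by (rule dim_image_diff_le[OF Z]) (use fixed cyc in auto)
  then show ?thesis by simp
qed

text \<open>One coordinate per member of the family detects its coefficient in a linear relation;
  the signed copies at permuted positions never have to be inspected.\<close>

lemma card_le_dim_dual_coordinates:
  fixes E :: "'i \<Rightarrow> 'a::field^'m"
  assumes "finite I" and L: "E ` I \<subseteq> L"
    and dual: "\<And>s s'. s \<in> I \<Longrightarrow> s' \<in> I \<Longrightarrow> E s $ c s' = (if s = s' then 1 else 0)"
  shows "card I \<le> vec.dim L"
proof -
  have inj: "inj_on E I" by (rule inj_onI) (metis dual one_neq_zero)
  have "vec.independent (E ` I)"
  proof (rule vec.independent_if_scalars_zero)
    show "finite (E ` I)" using assms(1) by simp
    fix f x assume sum0: "(\<Sum>x\<in>E ` I. f x *s x) = 0" and "x \<in> E ` I"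
    then obtain s where s: "s \<in> I" "x = E s" by auto
    have "0 = (\<Sum>t\<in>I. f (E t) *s E t) $ c s" using sum0 by (simp add: sum.reindex[OF inj])
    also have "\<dots> = (\<Sum>t\<in>I. if t = s then f (E t) else 0)"
      unfolding sum_component by (rule sum.cong) (use s dual in auto)
    also have "\<dots> = f x" using s assms(1) by simp
    finally show "f x = 0" by simp
  qed
  then have "card (E ` I) \<le> vec.dim L" using L by (intro vec.independent_card_le_dim)
  then show ?thesis by (simp add: card_image[OF inj])
qed

section \<open>Index lists for the bases of the tensor spaces, and the dimensions 35 and 28\<close>

definition triples :: "nat list list" where
  "triples = [[i, j, k]. i \<leftarrow> [0..<7], j \<leftarrow> [Suc i..<7], k \<leftarrow> [Suc j..<7]]"

definition pairs :: "nat list list" where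
  "pairs = [[i, j]. i \<leftarrow> [0..<7], j \<leftarrow> [i..<7]]"

definition wedge_at :: "(nat \<Rightarrow> 'a::field^'n) \<Rightarrow> nat list \<Rightarrow> 'a^('n::finite \<times> 'n \<times> 'n)" where
  "wedge_at b l = wedge_tensor (b (l ! 0)) (b (l ! 1)) (b (l ! 2))"

text \<open>On the diagonal the square is taken because \<open>polar_tensor u u\<close> is twice the
  square and vanishes in characteristic 2.\<close>

definition sym_at :: "(nat \<Rightarrow> 'a::field^'n) \<Rightarrow> nat list \<Rightarrow> 'a^('n::finite \<times> 'n)" where
  "sym_at b l = (if l ! 0 = l ! 1 then square_tensor (b (l ! 0)) else polar_tensor (b (l ! 0)) (b (l ! 1)))"

lemma length_triples: "length triples = 35" "distinct triples"
  and length_pairs: "length pairs = 28" "distinct pairs"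
  unfolding triples_def pairs_def by code_simp+

lemma in_triples: "[i, j, k] \<in> set triples \<longleftrightarrow> i < j \<and> j < k \<and> k < 7"
  by (auto simp: triples_def) (rule bexI[of _ i], rule bexI[of _ j], auto)

lemma in_pairs: "[i, j] \<in> set pairs \<longleftrightarrow> i \<le> j \<and> j < 7"
  by (auto simp: pairs_def) (rule bexI[of _ i], auto)

lemma triplesE:
  assumes "l \<in> set triples"
  obtains i j k where "l = [i, j, k]" "i < j" "j < k" "k < 7"
  using assms by (auto simp: triples_def)

lemma pairsE:
  assumes "l \<in> set pairs"
  obtains i j where "l = [i, j]" "i \<le> j" "j < 7"
  using assms by (auto simp: pairs_def)

lemma wedge_tensor_self': "wedge_tensor u v u = 0" "wedge_tensor v u u = 0"
  by (simp_all add: wedge_tensor_def)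

lemma wedge_at_swap:
  assumes "length l = 3" "mset l = mset l'"
  shows "wedge_at b l = wedge_at b l' \<or> wedge_at b l = - wedge_at b l'"
proof -
  obtain i j k where l: "l = [i, j, k]"
    using assms(1) by (auto simp: length_Suc_conv numeral_3_eq_3)
  have "length l' = 3" using assms by (metis mset_eq_length)
  then obtain i' j' k' where l': "l' = [i', j', k']"
    by (auto simp: length_Suc_conv numeral_3_eq_3)
  have "i' = i \<and> j' = j \<and> k' = k \<or> i' = i \<and> j' = k \<and> k' = j \<or> i' = j \<and> j' = i \<and> k' = k \<or>
    i' = j \<and> j' = k \<and> k' = i \<or> i' = k \<and> j' = i \<and> k' = j \<or> i' = k \<and> j' = j \<and> k' = i"
    using assms(2) unfolding l l' by (auto simp: add_eq_conv_ex)
  then show ?thesis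
    unfolding l l' wedge_at_def
    by (auto simp: wedge_tensor_def)
qed

lemma sym_at_swap:
  assumes "length l = 2" "mset l = mset l'"
  shows "sym_at b l = sym_at b l' \<or> sym_at b l = - sym_at b l'"
proof -
  obtain i j where l: "l = [i, j]"
    using assms(1) by (auto simp: length_Suc_conv numeral_2_eq_2)
  have "length l' = 2" using assms by (metis mset_eq_length)
  then obtain i' j' where l': "l' = [i', j']"
    by (auto simp: length_Suc_conv numeral_2_eq_2)
  have "i' = i \<and> j' = j \<or> i' = j \<and> j' = i"
    using assms(2) unfolding l l' by (auto simp: add_eq_conv_ex)
  then show ?thesis
    unfolding l l' sym_at_def by (auto simp: polar_tensor_commute)
qed

lemma alt_tensors_span:
  assumes "vec.span (b ` {..<7}) = UNIV"
  shows "alt_tensors \<subseteq> vec.span (wedge_at b ` set triples)"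
proof (rule alt_tensors_subset[OF vec.subspace_span assms])
  let ?M = "vec.span (wedge_at b ` set triples)"
  have sorted: "wedge_tensor (b i) (b j) (b k) \<in> ?M" if "i < j" "j < k" "k < 7" for i j k
    using that by (intro vec.span_base image_eqI[of _ _ "[i, j, k]"]) (auto simp: wedge_at_def in_triples)
  have first: "wedge_tensor (b i) (b j) (b k) \<in> ?M" if "i < j" "i < k" "j < 7" "k < 7" for i j k
  proof -
    have eq: "wedge_tensor (b i) (b j) (b k) = - wedge_tensor (b i) (b k) (b j)"
      by (simp add: wedge_tensor_def)
    consider "j < k" | "j = k" | "k < j" by linarith
    then show ?thesis
      by cases (use that sorted[of i j k] sorted[of i k j] eq in
        \<open>auto simp: wedge_tensor_self' vec.span_zero intro: vec.span_neg\<close>)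
  qed
  have "wedge_tensor (b i) (b j) (b k) \<in> ?M" if "i < 7" "j < 7" "k < 7" for i j k
  proof -
    \<comment> \<open>Cyclic shifts are even, so the least index can be moved to the front without a
      sign.\<close>
    have eq: "wedge_tensor (b i) (b j) (b k) = wedge_tensor (b j) (b k) (b i)"
      "wedge_tensor (b i) (b j) (b k) = wedge_tensor (b k) (b i) (b j)"
      by (simp_all add: wedge_tensor_def)
    consider "i = j" | "i = k" | "j = k" | "i < j" "i < k" | "j < i" "j < k" | "k < i" "k < j" by linarith
    then show ?thesis
    proof cases
      case 5
      then show ?thesis unfolding eq(1) using first that by blast
    next
      case 6
      then show ?thesis unfolding eq(2) using first that by blast
    qed (use that first in \<open>auto simp: wedge_tensor_self' wedge_tensor_self vec.span_zero\<close>)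
  qed
  then show "wedge_tensor u v w \<in> ?M"
    if "u \<in> b ` {..<7}" "v \<in> b ` {..<7}" "w \<in> b ` {..<7}" for u v w using that by auto
qed

lemma sym_tensors_span:
  assumes "vec.span (b ` {..<7}) = UNIV"
  shows "sym_tensors \<subseteq> vec.span (sym_at b ` set pairs)"
proof (rule sym_tensors_subset[OF vec.subspace_span assms])
  let ?M = "vec.span (sym_at b ` set pairs)"
  have sq: "square_tensor (b i) \<in> ?M" if "i < 7" for i
    using that by (intro vec.span_base image_eqI[of _ _ "[i, i]"]) (auto simp: sym_at_def in_pairs)
  have po: "polar_tensor (b i) (b j) \<in> ?M" if "i < j" "j < 7" for i j
    using that by (intro vec.span_base image_eqI[of _ _ "[i, j]"]) (auto simp: sym_at_def in_pairs)
  have dbl: "polar_tensor u u = 2 *s square_tensor u" for u :: "'a^'b"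
    by (simp add: polar_tensor_def square_tensor_def vec_eq_iff)
  have "polar_tensor (b i) (b j) \<in> ?M" if "i < 7" "j < 7" for i j
    using sq[of i] po[of i j] po[of j i] that
    by (cases i j rule: linorder_cases) (auto simp: dbl polar_tensor_commute intro: vec.span_scale)
  then show "polar_tensor u v \<in> ?M" if "u \<in> b ` {..<7}" "v \<in> b ` {..<7}" for u v using that by auto
  show "square_tensor u \<in> ?M" if "u \<in> b ` {..<7}" for u using that sq by auto
qed

lemma dim_alt_tensors:
  assumes "CARD('n::finite) = 7"
  shows "35 \<le> vec.dim (alt_tensors :: ('a::field^('n \<times> 'n \<times> 'n)) set)"
proof -
  obtain h :: "nat \<Rightarrow> 'n" where h: "bij_betw h {0..<7} UNIV"
    using ex_bij_betw_nat_finite[of "UNIV :: 'n set"] assms by auto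
  have h_eq: "h i = h j \<longleftrightarrow> i = j" if "i < 7" "j < 7" for i j
    using h that by (auto simp: bij_betw_def inj_on_def)
  define E where "E = wedge_at (\<lambda>i. axis (h i) (1::'a))"
  have "card (set triples) \<le> vec.dim (alt_tensors :: ('a^('n \<times> 'n \<times> 'n)) set)"
  proof (rule card_le_dim_dual_coordinates[where E = E and c = "\<lambda>l. (h (l ! 0), h (l ! 1), h (l ! 2))"])
    show "E ` set triples \<subseteq> alt_tensors" by (auto simp: E_def wedge_at_def wedge_in_alt_tensors)
    fix s s' assume "s \<in> set triples" "s' \<in> set triples"
    then obtain i j k i' j' k' where s: "s = [i, j, k]" "i < j" "j < k" "k < 7"
        and s': "s' = [i', j', k']" "i' < j'" "j' < k'" "k' < 7" by (metis triplesE)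
    then show "E s $ (h (s' ! 0), h (s' ! 1), h (s' ! 2)) = (if s = s' then 1 else 0)"
      by (auto simp: E_def wedge_at_def wedge_tensor_def tensor3_def axis_def h_eq)
  qed simp
  then show ?thesis using length_triples by (simp add: distinct_card)
qed

lemma dim_sym_tensors:
  assumes "CARD('n::finite) = 7"
  shows "28 \<le> vec.dim (sym_tensors :: ('a::field^('n \<times> 'n)) set)"
proof -
  obtain h :: "nat \<Rightarrow> 'n" where h: "bij_betw h {0..<7} UNIV"
    using ex_bij_betw_nat_finite[of "UNIV :: 'n set"] assms by auto
  have h_eq: "h i = h j \<longleftrightarrow> i = j" if "i < 7" "j < 7" for i j
    using h that by (auto simp: bij_betw_def inj_on_def)
  define E where "E = sym_at (\<lambda>i. axis (h i) (1::'a))"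
  have "card (set pairs) \<le> vec.dim (sym_tensors :: ('a^('n \<times> 'n)) set)"
  proof (rule card_le_dim_dual_coordinates[where E = E and c = "\<lambda>l. (h (l ! 0), h (l ! 1))"])
    show "E ` set pairs \<subseteq> sym_tensors"
      by (auto simp: E_def sym_at_def square_in_sym_tensors polar_in_sym_tensors)
    fix s s' assume "s \<in> set pairs" "s' \<in> set pairs"
    then obtain i j i' j' where s: "s = [i, j]" "i \<le> j" "j < 7"
        and s': "s' = [i', j']" "i' \<le> j'" "j' < 7" by (metis pairsE)
    then show "E s $ (h (s' ! 0), h (s' ! 1)) = (if s = s' then 1 else 0)"
      by (auto simp: E_def sym_at_def square_tensor_def polar_tensor_def axis_def h_eq)
  qed simp
  then show ?thesis using length_pairs by (simp add: distinct_card)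
qed

subsection \<open>The three matrices as signed permutations\<close>

text \<open>A signed permutation action on a spanning family. The permutation is a list so that
  orbit coverings can be evaluated. The order of the action divides \<open>n + 1\<close>; thus
  \<open>n\<close> itself is the rank contribution of a full orbit.\<close>

definition spanning_action :: "'a::field^'n^'n \<Rightarrow> nat list \<Rightarrow> (nat \<Rightarrow> 'a) \<Rightarrow> nat \<Rightarrow> (nat \<Rightarrow> 'a^'n::finite) \<Rightarrow> bool" where
  "spanning_action A s \<epsilon> n b \<longleftrightarrow> vec.span (b ` {..<7}) = UNIV \<and>
     (\<forall>i<7. A *v b i = \<epsilon> i *s b (s ! i) \<and> s ! i < 7 \<and> (\<epsilon> i = 1 \<or> \<epsilon> i = -1)) \<and>
     (\<forall>v. (((*v) A) ^^ Suc n) v = v)"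

lemma wedge_tensor_neg: "wedge_tensor (- u) v w = - wedge_tensor u v w"
  "wedge_tensor u (- v) w = - wedge_tensor u v w" "wedge_tensor u v (- w) = - wedge_tensor u v w"
  by (simp_all add: wedge_tensor_def tensor3_def vec_eq_iff)

lemma sym_tensor_neg: "square_tensor (- u) = square_tensor u"
  "polar_tensor (- u) v = - polar_tensor u v" "polar_tensor u (- v) = - polar_tensor u v"
  by (simp_all add: polar_tensor_def square_tensor_def vec_eq_iff)

lemma alt_rank_le:
  assumes A: "spanning_action A s \<epsilon> n b"
    and rs: "list_all (\<lambda>l. length l = 3 \<and> list_all (\<lambda>i. i < 7) l) rs"
    and fixed: "\<And>l. l \<in> set fs \<Longrightarrow> tensor3_map A (wedge_at b l) = wedge_at b l"
    and cover: "list_all (\<lambda>l. l \<in> set fs \<or>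
      list_ex (\<lambda>r. list_ex (\<lambda>m. sort (map ((\<lambda>i. s ! i) ^^ m) r) = l) [0..<Suc n]) rs) triples"
  shows "vec.dim ((\<lambda>t. t - tensor3_map A t) ` alt_tensors) \<le> n * length rs"
proof (rule monomial_rank_le[OF tensor3_map_linear _ _ wedge_at_swap _ fixed _ _ cover, where N = 7])
  show "alt_tensors \<subseteq> vec.span (wedge_at b ` set triples)"
    using A by (intro alt_tensors_span) (simp add: spanning_action_def)
  show "\<forall>i<7. s ! i < 7" using A by (simp add: spanning_action_def)
  show "\<forall>r\<in>set rs. length r = 3 \<and> set r \<subseteq> {..<7}" using rs by (auto simp: list_all_iff)
  have "(tensor3_map A ^^ m) (wedge_tensor u v w)
      = wedge_tensor ((((*v) A) ^^ m) u) ((((*v) A) ^^ m) v) ((((*v) A) ^^ m) w)" for m u v w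
    by (induction m) (simp_all add: tensor3_map_wedge)
  then show "(tensor3_map A ^^ Suc n) (wedge_at b l) = wedge_at b l" for l
    using A unfolding spanning_action_def wedge_at_def by (simp add: tensor3_map_wedge)
  show "tensor3_map A (wedge_at b l) = wedge_at b (map ((!) s) l) \<or>
      tensor3_map A (wedge_at b l) = - wedge_at b (map ((!) s) l)"
    if len: "length l = 3" and sub: "set l \<subseteq> {..<7}" for l
  proof -
    obtain i j k where l: "l = [i, j, k]"
      using len by (auto simp: length_Suc_conv numeral_3_eq_3)
    have *: "A *v b m = b (s ! m) \<or> A *v b m = - b (s ! m)" if "m < 7" for m
      using A that unfolding spanning_action_def by (metis vec.scale_minus_left vec.scale_one)
    show ?thesis
      using sub *[of i] *[of j] *[of k] unfolding l wedge_at_def tensor3_map_wedge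
      by (auto simp: wedge_tensor_neg)
  qed
qed auto

lemma sym_rank_le:
  assumes A: "spanning_action A s \<epsilon> n b"
    and rs: "list_all (\<lambda>l. length l = 2 \<and> list_all (\<lambda>i. i < 7) l) rs"
    and inj: "distinct s" "length s = 7"
    and fixed: "\<And>l. l \<in> set fs \<Longrightarrow> tensor2_map A (sym_at b l) = sym_at b l"
    and cover: "list_all (\<lambda>l. l \<in> set fs \<or>
      list_ex (\<lambda>r. list_ex (\<lambda>m. sort (map ((\<lambda>i. s ! i) ^^ m) r) = l) [0..<Suc n]) rs) pairs"
  shows "vec.dim ((\<lambda>t. t - tensor2_map A t) ` sym_tensors) \<le> n * length rs"
proof (rule monomial_rank_le[OF tensor2_map_linear _ _ sym_at_swap _ fixed _ _ cover, where N = 7])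
  show "sym_tensors \<subseteq> vec.span (sym_at b ` set pairs)"
    using A by (intro sym_tensors_span) (simp add: spanning_action_def)
  show "\<forall>i<7. s ! i < 7" using A by (simp add: spanning_action_def)
  show "\<forall>r\<in>set rs. length r = 2 \<and> set r \<subseteq> {..<7}" using rs by (auto simp: list_all_iff)
  have "(tensor2_map A ^^ m) (polar_tensor u v)
      = polar_tensor ((((*v) A) ^^ m) u) ((((*v) A) ^^ m) v)"
    "(tensor2_map A ^^ m) (square_tensor u) = square_tensor ((((*v) A) ^^ m) u)" for m u v
    by (induction m) (simp_all add: tensor2_map_polar tensor2_map_square)
  then show "(tensor2_map A ^^ Suc n) (sym_at b l) = sym_at b l" for l
    using A unfolding spanning_action_def sym_at_def
    by (simp add: tensor2_map_polar tensor2_map_square)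
  show "tensor2_map A (sym_at b l) = sym_at b (map ((!) s) l) \<or>
      tensor2_map A (sym_at b l) = - sym_at b (map ((!) s) l)"
    if len: "length l = 2" and sub: "set l \<subseteq> {..<7}" for l
  proof -
    obtain i j where l: "l = [i, j]"
      using len by (auto simp: length_Suc_conv numeral_2_eq_2)
    have *: "A *v b m = b (s ! m) \<or> A *v b m = - b (s ! m)" if "m < 7" for m
      using A that unfolding spanning_action_def by (metis vec.scale_minus_left vec.scale_one)
    \<comment> \<open>Injectivity keeps off-diagonal index pairs off the diagonal; otherwise a polar
      tensor would be sent to twice a square, which is not a value of \<open>sym_at\<close>.\<close>
    have "s ! i = s ! j \<longleftrightarrow> i = j" using sub inj by (simp add: l nth_eq_iff_index_eq)
    then show ?thesis
      using sub *[of i] *[of j] unfolding l sym_at_def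
      by (auto simp: tensor2_map_square tensor2_map_polar sym_tensor_neg)
  qed
qed auto

lemma all_less_7: "(\<forall>i<7. P i) \<longleftrightarrow> P 0 \<and> P 1 \<and> P 2 \<and> P 3 \<and> P 4 \<and> P 5 \<and> P (6::nat)"
proof -
  have "i < 7 \<longleftrightarrow> i = 0 \<or> i = 1 \<or> i = 2 \<or> i = 3 \<or> i = 4 \<or> i = 5 \<or> i = (6::nat)" for i
    by presburger
  then show ?thesis by simp blast
qed

text \<open>The span of \<open>b\<close> is stable under \<open>A\<close> and contains the
  generators \<open>ws\<close>, hence is everything; the periodicity then extends from
  \<open>b\<close> by linearity.\<close>

lemma spanning_actionI:
  assumes b: "\<forall>i<7. A *v b i = \<epsilon> i *s b (s ! i) \<and> s ! i < 7 \<and> (\<epsilon> i = 1 \<or> \<epsilon> i = -1)"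
    and cyc: "\<forall>i<7. (((*v) A) ^^ Suc n) (b i) = b i"
    and ws: "set ws \<subseteq> b ` {..<7}"
    and gen: "\<And>M. vec.subspace M \<Longrightarrow> (\<And>w. w \<in> M \<Longrightarrow> A *v w \<in> M) \<Longrightarrow> set ws \<subseteq> M \<Longrightarrow> M = UNIV"
  shows "spanning_action A s \<epsilon> n b"
proof -
  let ?M = "vec.span (b ` {..<7})"
  have M: "?M = UNIV"
  proof (rule gen)
    show "set ws \<subseteq> ?M" using ws vec.span_superset[of "b ` {..<7}"] by (rule subset_trans)
    show "A *v w \<in> ?M" if "w \<in> ?M" for w
    proof -
      have "A *v w \<in> (*v) A ` ?M" using that by (rule imageI)
      also have "\<dots> = vec.span ((*v) A ` b ` {..<7})" by (simp add: vec.span_image)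
      also have "\<dots> \<subseteq> ?M"
      proof (rule vec.span_minimal)
        have "A *v b i \<in> ?M" if "i < 7" for i
          using b that by (simp add: vec.span_scale vec.span_base)
        then show "(*v) A ` b ` {..<7} \<subseteq> ?M" by blast
      qed simp
      finally show ?thesis .
    qed
  qed simp
  have zero: "(((*v) A) ^^ k) 0 = 0" for k by (induction k) simp_all
  have "(((*v) A) ^^ Suc n) v = v" for v
  proof (rule span_UNIV_induct[OF M])
    show "(((*v) A) ^^ Suc n) v = v" if "v \<in> b ` {..<7}" for v
      using that cyc by (elim imageE) (simp del: funpow.simps)
  qed (simp_all only: zero funpow_mult_vec_add funpow_mult_vec_scale)
  then show ?thesis using M b unfolding spanning_action_def by blast
qed

lemma nth_image_7: "length xs = 7 \<Longrightarrow> (\<lambda>i. xs ! i) ` {..<7} = set xs"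
  by (auto simp: set_conv_nth)

lemma list_all2_explicit:
  "list_all2 P [a, b, c, d] ws \<longleftrightarrow> (\<exists>w1 w2 w3 w4. ws = [w1, w2, w3, w4] \<and> P a w1 \<and> P b w2 \<and> P c w3 \<and> P d w4)"
  "list_all2 P [a, b, c] ws \<longleftrightarrow> (\<exists>w1 w2 w3. ws = [w1, w2, w3] \<and> P a w1 \<and> P b w2 \<and> P c w3)"
  "list_all2 P [a] ws \<longleftrightarrow> (\<exists>w. ws = [w] \<and> P a w)"
  by (auto simp: list_all2_Cons1)

text \<open>One cycle for each similarity invariant, of length equal to its degree: a fixed point
  and three transpositions, a fixed point and two 3-cycles, one 7-cycle. The invariant
  \<open>t + 1\<close> of \<open>x\<close> puts a sign on the fixed point.\<close>

abbreviation "perm_x \<equiv> [0, 2, 1, 4, 3, 6, 5::nat]"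
abbreviation "perm_y \<equiv> [0, 2, 3, 1, 5, 6, 4::nat]"
abbreviation "perm_z \<equiv> [1, 2, 3, 4, 5, 6, 0::nat]"

lemma poly_act_X_power_minus_1: "poly_act A ([:0, 1:] ^ n - 1) w = (((*v) A) ^^ n) w - w"
  by (simp add: poly_act_diff poly_act_X_power)

lemma spanning_action_x:
  fixes x :: "'a::field^'n::{finite,linorder}^'n::{finite,linorder}"
  assumes "similarity_invariants x
    [[:0, 1:] + 1, [:0, 1:]^2 - 1, [:0, 1:]^2 - 1, [:0, 1:]^2 - 1]"
  obtains b where "spanning_action x perm_x (\<lambda>i. if i = 0 then -1 else 1) 1 b"
proof -
  obtain ws where ws: "list_all2 (\<lambda>p w. poly_act x p w = 0)
        [[:0, 1:] + 1, [:0, 1:]^2 - 1, [:0, 1:]^2 - 1, [:0, 1:]^2 - 1] ws"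
    and gen: "\<And>M. vec.subspace M \<Longrightarrow> (\<And>w. w \<in> M \<Longrightarrow> x *v w \<in> M) \<Longrightarrow> set ws \<subseteq> M \<Longrightarrow> M = UNIV"
    using similarity_invariants_cyclic_vectors[OF assms] by blast
  obtain w1 w2 w3 w4 where w: "ws = [w1, w2, w3, w4]" "poly_act x ([:0, 1:] + 1) w1 = 0"
      and w': "(((*v) x) ^^ 2) w2 - w2 = 0" "(((*v) x) ^^ 2) w3 - w3 = 0" "(((*v) x) ^^ 2) w4 - w4 = 0"
    using ws unfolding list_all2_explicit poly_act_X_power_minus_1 by (elim exE conjE)
  have x2: "x *v (x *v w2) = w2" "x *v (x *v w3) = w3" "x *v (x *v w4) = w4"
    using w' by (simp_all add: numeral_2_eq_2)
  have w1: "x *v w1 = - w1"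
    using w(2) unfolding poly_act_add by (simp add: poly_act_pCons eq_neg_iff_add_eq_0)
  let ?b = "\<lambda>i. [w1, w2, x *v w2, w3, x *v w3, w4, x *v w4] ! i"
  have "spanning_action x perm_x (\<lambda>i. if i = 0 then -1 else 1) 1 ?b"
  proof (rule spanning_actionI[OF _ _ _ gen])
    show "set ws \<subseteq> ?b ` {..<7}"
      by (simp add: w(1) nth_image_7)
  qed (use x2 w1 in \<open>simp_all add: all_less_7 vec.neg\<close>)
  then show thesis by (rule that)
qed

lemma spanning_action_y:
  fixes y :: "'a::field^'n::{finite,linorder}^'n::{finite,linorder}"
  assumes "similarity_invariants y [[:0, 1:] - 1, [:0, 1:]^3 - 1, [:0, 1:]^3 - 1]"
  obtains b where "spanning_action y perm_y (\<lambda>_. 1) 2 b"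
proof -
  obtain ws where ws: "list_all2 (\<lambda>p w. poly_act y p w = 0)
        [[:0, 1:] - 1, [:0, 1:]^3 - 1, [:0, 1:]^3 - 1] ws"
    and gen: "\<And>M. vec.subspace M \<Longrightarrow> (\<And>w. w \<in> M \<Longrightarrow> y *v w \<in> M) \<Longrightarrow> set ws \<subseteq> M \<Longrightarrow> M = UNIV"
    using similarity_invariants_cyclic_vectors[OF assms] by blast
  obtain w1 w2 w3 where w: "ws = [w1, w2, w3]" "poly_act y ([:0, 1:] - 1) w1 = 0"
      and w': "(((*v) y) ^^ 3) w2 - w2 = 0" "(((*v) y) ^^ 3) w3 - w3 = 0"
    using ws unfolding list_all2_explicit poly_act_X_power_minus_1 by (elim exE conjE)
  have y3: "y *v (y *v (y *v w2)) = w2" "y *v (y *v (y *v w3)) = w3"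
    using w' by (simp_all add: numeral_3_eq_3)
  have w1: "y *v w1 = w1"
    using w(2) unfolding poly_act_diff by (simp add: poly_act_pCons)
  let ?b = "\<lambda>i. [w1, w2, y *v w2, y *v (y *v w2), w3, y *v w3, y *v (y *v w3)] ! i"
  have "spanning_action y perm_y (\<lambda>_. 1) 2 ?b"
  proof (rule spanning_actionI[OF _ _ _ gen])
    show "set ws \<subseteq> ?b ` {..<7}"
      by (simp add: w(1) nth_image_7)
  qed (use y3 w1 in \<open>simp_all add: all_less_7 numeral_2_eq_2\<close>)
  then show thesis by (rule that)
qed

lemma spanning_action_z:
  fixes z :: "'a::field^'n::{finite,linorder}^'n::{finite,linorder}"
  assumes "similarity_invariants z [[:0, 1:]^7 - 1]"
  obtains b where "spanning_action z perm_z (\<lambda>_. 1) 6 b"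
proof -
  obtain ws where ws: "list_all2 (\<lambda>p w. poly_act z p w = 0) [[:0, 1:]^7 - 1] ws"
    and gen: "\<And>M. vec.subspace M \<Longrightarrow> (\<And>w. w \<in> M \<Longrightarrow> z *v w \<in> M) \<Longrightarrow> set ws \<subseteq> M \<Longrightarrow> M = UNIV"
    using similarity_invariants_cyclic_vectors[OF assms] by blast
  obtain w where w: "ws = [w]" "(((*v) z) ^^ 7) w - w = 0"
    using ws unfolding list_all2_explicit poly_act_X_power_minus_1 by (elim exE conjE)
  let ?z = "(*v) z"
  have w7: "?z (?z (?z (?z (?z (?z (?z w)))))) = w" using w(2) by (simp add: numeral_eq_Suc)
  let ?b = "\<lambda>i. [w, ?z w, ?z (?z w), ?z (?z (?z w)), ?z (?z (?z (?z w))), ?z (?z (?z (?z (?z w)))),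
    ?z (?z (?z (?z (?z (?z w)))))] ! i"
  have pow: "(?z ^^ Suc 6) v = ?z (?z (?z (?z (?z (?z (?z v))))))" for v by (simp add: numeral_eq_Suc)
  have "spanning_action z perm_z (\<lambda>_. 1) 6 ?b"
  proof (rule spanning_actionI[OF _ _ _ gen])
    show "set ws \<subseteq> ?b ` {..<7}"
      by (simp add: w(1) nth_image_7)
  qed (use w7 in \<open>simp_all only: pow all_less_7, simp_all\<close>)
  then show thesis by (rule that)
qed

lemma funpow_eq_imp_left_inverse:
  fixes A :: "'a::field^'n^'n"
  assumes "\<And>v. (((*v) A) ^^ Suc n) v = v"
  obtains B where "B ** A = mat 1"
proof -
  have "surj ((*v) A)"
  proof (rule surjI)
    show "A *v ((((*v) A) ^^ n) v) = v" for v using assms[of v] by simp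
  qed
  then have "\<exists>B. A ** B = mat 1" unfolding matrix_right_invertible_surjective .
  then obtain B where "A ** B = mat 1" ..
  then have "B ** A = mat 1" by (simp only: matrix_left_right_inverse)
  then show thesis by (rule that)
qed

text \<open>Orbit counts on the 35 increasing triples: 35 = 3 + 2 * 16 for \<open>x\<close>, 35 = 2
  + 3 * 11 for \<open>y\<close>, 35 = 7 * 5 for the product. The ranks are therefore at most 16, 22
  and 30, with sum 68 < 70.\<close>

lemma alt_dichotomy:
  fixes x y :: "'a::field^'n^'n"
  assumes card: "CARD('n) = 7"
    and x: "spanning_action x perm_x (\<lambda>i. if i = 0 then -1 else 1) 1 bx"
    and y: "spanning_action y perm_y (\<lambda>_. 1) 2 by"
    and z: "spanning_action (x ** y) perm_z (\<lambda>_. 1) 6 bz"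
  shows "(\<exists>t\<in>alt_tensors. t \<noteq> 0 \<and> tensor3_map x t = t \<and> tensor3_map y t = t) \<or>
    (\<exists>l. Vector_Spaces.linear (*s) (*) l \<and> (\<exists>t\<in>alt_tensors. l t \<noteq> 0) \<and>
      (\<forall>t\<in>alt_tensors. l (tensor3_map x t) = l t \<and> l (tensor3_map y t) = l t))"
proof (rule scott_dichotomy[OF tensor3_map_linear tensor3_map_linear subspace_alt_tensors
      tensor3_map_closed tensor3_map_closed])
  obtain B where B: "B ** x = mat 1"
    using funpow_eq_imp_left_inverse x unfolding spanning_action_def by blast
  show "t = 0" if "t \<in> alt_tensors" "tensor3_map x t = 0" for t
    using tensor3_map_inj[OF B] that by blast
  have xb: "x *v bx 0 = - bx 0" "x *v bx 1 = bx 2" "x *v bx 2 = bx 1" "x *v bx 3 = bx 4"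
    "x *v bx 4 = bx 3" "x *v bx 5 = bx 6" "x *v bx 6 = bx 5"
    using x unfolding spanning_action_def all_less_7 by simp_all
  have yb: "y *v by 0 = by 0" "y *v by 1 = by 2" "y *v by 2 = by 3" "y *v by 3 = by 1"
    "y *v by 4 = by 5" "y *v by 5 = by 6" "y *v by 6 = by 4"
    using y unfolding spanning_action_def all_less_7 by simp_all
  \<comment> \<open>Interchanging two factors gives a sign, which cancels against the sign of
    \<open>x\<close> on \<open>bx 0\<close>.\<close>
  have fixX: "tensor3_map x (wedge_at bx l) = wedge_at bx l" if "l \<in> set [[0, 1, 2], [0, 3, 4], [0, 5, 6]]" for l
    using that by (auto simp: wedge_at_def tensor3_map_wedge xb[simplified] wedge_tensor_neg)
      (simp_all add: wedge_tensor_def)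
  have X: "vec.dim ((\<lambda>t. t - tensor3_map x t) ` alt_tensors) \<le> 1 * length
      [[0, 1, 3], [0, 1, 4], [0, 1, 5], [0, 1, 6], [0, 3, 5], [0, 3, 6], [1, 2, 3], [1, 2, 5],
       [1, 3, 4], [1, 3, 5], [1, 3, 6], [1, 4, 5], [1, 4, 6], [1, 5, 6], [3, 4, 5], [3, 5, 6::nat]]"
    by (rule alt_rank_le[OF x _ fixX]) (assumption | code_simp)+
  \<comment> \<open>A 3-cycle is an even permutation of the three factors.\<close>
  have fixY: "tensor3_map y (wedge_at by l) = wedge_at by l" if "l \<in> set [[1, 2, 3], [4, 5, 6]]" for l
    using that by (auto simp: wedge_at_def tensor3_map_wedge yb[simplified]) (simp_all add: wedge_tensor_def)
  have Y: "vec.dim ((\<lambda>t. t - tensor3_map y t) ` alt_tensors) \<le> 2 * length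
      [[0, 1, 2], [0, 1, 4], [0, 1, 5], [0, 1, 6], [0, 4, 5], [1, 2, 4], [1, 2, 5], [1, 2, 6],
       [1, 4, 5], [1, 4, 6], [1, 5, 6::nat]]"
    by (rule alt_rank_le[OF y _ fixY]) (assumption | code_simp)+
  \<comment> \<open>No 3-subset of seven points is stable under a 7-cycle, so all orbits are full
    and \<open>fs\<close> is empty.\<close>
  have Z: "vec.dim ((\<lambda>t. t - tensor3_map (x ** y) t) ` alt_tensors) \<le> 6 * length
      [[0, 1, 2], [0, 1, 3], [0, 1, 4], [0, 1, 5], [0, 2, 4::nat]]"
    by (rule alt_rank_le[OF z, where fs = "[]"]) (code_simp, simp, code_simp)
  have comp: "tensor3_map x (tensor3_map y t) = tensor3_map (x ** y) t" if "t \<in> alt_tensors" for t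
    using tensor3_map_comp[OF that, of x y] .
  show "vec.dim ((\<lambda>v. v - tensor3_map x v) ` alt_tensors) + vec.dim ((\<lambda>v. v - tensor3_map y v) ` alt_tensors)
      + vec.dim ((\<lambda>v. v - tensor3_map x (tensor3_map y v)) ` alt_tensors)
    < 2 * vec.dim (alt_tensors :: ('a^('n \<times> 'n \<times> 'n)) set)"
    using X Y Z dim_alt_tensors[OF card, where 'a = 'a] comp by (simp cong: image_cong)
qed auto

text \<open>Orbit counts on the 28 weakly increasing pairs: 28 = 4 + 2 * 12 for \<open>x\<close>, 28
  = 1 + 3 * 9 for \<open>y\<close>, 28 = 7 * 4 for the product. The ranks are therefore at most 12,
  18 and 24, with sum 54 < 56.\<close>

lemma sym_dichotomy:
  fixes x y :: "'a::field^'n^'n"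
  assumes card: "CARD('n) = 7"
    and x: "spanning_action x perm_x (\<lambda>i. if i = 0 then -1 else 1) 1 bx"
    and y: "spanning_action y perm_y (\<lambda>_. 1) 2 by"
    and z: "spanning_action (x ** y) perm_z (\<lambda>_. 1) 6 bz"
  shows "(\<exists>t\<in>sym_tensors. t \<noteq> 0 \<and> tensor2_map x t = t \<and> tensor2_map y t = t) \<or>
    (\<exists>l. Vector_Spaces.linear (*s) (*) l \<and> (\<exists>t\<in>sym_tensors. l t \<noteq> 0) \<and>
      (\<forall>t\<in>sym_tensors. l (tensor2_map x t) = l t \<and> l (tensor2_map y t) = l t))"
proof (rule scott_dichotomy[OF tensor2_map_linear tensor2_map_linear subspace_sym_tensors
      tensor2_map_closed tensor2_map_closed])
  obtain B where B: "B ** x = mat 1"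
    using funpow_eq_imp_left_inverse x unfolding spanning_action_def by blast
  show "t = 0" if "t \<in> sym_tensors" "tensor2_map x t = 0" for t
    using tensor2_map_inj[OF B] that by blast
  have xb: "x *v bx 0 = - bx 0" "x *v bx 1 = bx 2" "x *v bx 2 = bx 1" "x *v bx 3 = bx 4"
    "x *v bx 4 = bx 3" "x *v bx 5 = bx 6" "x *v bx 6 = bx 5"
    using x unfolding spanning_action_def all_less_7 by simp_all
  have yb: "y *v by 0 = by 0"
    using y unfolding spanning_action_def all_less_7 by simp
  have fixX: "tensor2_map x (sym_at bx l) = sym_at bx l" if "l \<in> set [[0, 0], [1, 2], [3, 4], [5, 6]]" for l
    using that by (auto simp: sym_at_def tensor2_map_square tensor2_map_polar xb[simplified] sym_tensor_neg polar_tensor_commute)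
  have X: "vec.dim ((\<lambda>t. t - tensor2_map x t) ` sym_tensors) \<le> 1 * length
      [[0, 1], [0, 3], [0, 5], [1, 1], [1, 3], [1, 4], [1, 5], [1, 6], [3, 3], [3, 5], [3, 6], [5, 5::nat]]"
    by (rule sym_rank_le[OF x _ _ _ fixX]) (assumption | code_simp)+
  have fixY: "tensor2_map y (sym_at by l) = sym_at by l" if "l \<in> set [[0, 0]]" for l
    using that by (auto simp: sym_at_def tensor2_map_square yb)
  have Y: "vec.dim ((\<lambda>t. t - tensor2_map y t) ` sym_tensors) \<le> 2 * length
      [[0, 1], [0, 4], [1, 1], [1, 2], [1, 4], [1, 5], [1, 6], [4, 4], [4, 5::nat]]"
    by (rule sym_rank_le[OF y _ _ _ fixY]) (assumption | code_simp)+
  have Z: "vec.dim ((\<lambda>t. t - tensor2_map (x ** y) t) ` sym_tensors) \<le> 6 * length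
      [[0, 0], [0, 1], [0, 2], [0, 3::nat]]"
    by (rule sym_rank_le[OF z, where fs = "[]"]) (code_simp, simp, simp, simp, code_simp)
  have comp: "tensor2_map x (tensor2_map y t) = tensor2_map (x ** y) t" if "t \<in> sym_tensors" for t
    using tensor2_map_comp[OF that, of x y] .
  show "vec.dim ((\<lambda>v. v - tensor2_map x v) ` sym_tensors) + vec.dim ((\<lambda>v. v - tensor2_map y v) ` sym_tensors)
      + vec.dim ((\<lambda>v. v - tensor2_map x (tensor2_map y v)) ` sym_tensors)
    < 2 * vec.dim (sym_tensors :: ('a^('n \<times> 'n)) set)"
    using X Y Z dim_sym_tensors[OF card, where 'a = 'a] comp by (simp cong: image_cong)
qed auto

subsection \<open>Trilinear forms weighted modulo 7\<close>

locale alternating_form =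
  fixes f :: "'a::field^'n::finite \<Rightarrow> 'a^'n \<Rightarrow> 'a^'n \<Rightarrow> 'a"
  assumes alternating: "alternating_trilinear f"
begin

lemma linear1: "Vector_Spaces.linear (*s) (*) (\<lambda>u. f u v w)"
  and linear2: "Vector_Spaces.linear (*s) (*) (\<lambda>v. f u v w)"
  and linear3: "Vector_Spaces.linear (*s) (*) (\<lambda>w. f u v w)"
  and self [simp]: "f u u v = 0" "f u v u = 0" "f v u u = 0"
  using alternating unfolding alternating_trilinear_def by auto

lemmas hom1 = linear1[unfolded linear_iff_module_hom]
lemmas hom2 = linear2[unfolded linear_iff_module_hom]
lemmas hom3 = linear3[unfolded linear_iff_module_hom]

lemma add: "f (u + u') v w = f u v w + f u' v w" "f u (v + v') w = f u v w + f u v' w"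
  "f u v (w + w') = f u v w + f u v w'"
  by (rule module_hom.add[OF hom1] module_hom.add[OF hom2] module_hom.add[OF hom3])+

lemma scale: "f (c *s u) v w = c * f u v w" "f u (c *s v) w = c * f u v w" "f u v (c *s w) = c * f u v w"
  by (rule module_hom.scale[OF hom1] module_hom.scale[OF hom2] module_hom.scale[OF hom3])+

lemma zero [simp]: "f 0 v w = 0" "f u 0 w = 0" "f u v 0 = 0"
  by (rule module_hom.zero[OF hom1] module_hom.zero[OF hom2] module_hom.zero[OF hom3])+

lemma sum: "f (sum g I) v w = (\<Sum>i\<in>I. f (g i) v w)" "f u (sum g I) w = (\<Sum>i\<in>I. f u (g i) w)"
  "f u v (sum g I) = (\<Sum>i\<in>I. f u v (g i))"
  by (rule module_hom.sum[OF hom1] module_hom.sum[OF hom2] module_hom.sum[OF hom3])+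

lemma swap: "f v u w = - f u v w" "f u w v = - f u v w" "f w v u = - f u v w"
proof -
  have "f u v w + f v u w = 0" using self(1)[of "u + v" w] unfolding add by (simp add: add.commute)
  moreover have "f u v w + f u w v = 0" using self(3)[of u "v + w"] unfolding add by (simp add: add.commute)
  moreover have "f u v w + f w v u = 0" using self(2)[of "u + w" v] unfolding add by (simp add: add.commute)
  ultimately show "f v u w = - f u v w" "f u w v = - f u v w" "f w v u = - f u v w"
    by (simp_all add: eq_neg_iff_add_eq_0 add.commute)
qed

lemma rotate: "f v w u = f u v w" "f w u v = f u v w"
  using swap(1)[of w v u] swap(2)[of v u w] swap(1)[of v u w] swap(1)[of u w v] swap(2)[of u v w] swap(2)[of w v u]
    swap(3)[of w v u] by simp_all

lemmas permute = swap rotate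

end

section \<open>Dual bases and the five-term normal form\<close>

lemma indexed_basis_expansion:
  fixes b :: "'i \<Rightarrow> 'a::field^'n::finite"
  assumes b: "indexed_basis I b" and fin: "finite I"
  shows "(\<Sum>i\<in>I. dual_basis I b i v *s b i) = v"
    and "i \<in> I \<Longrightarrow> j \<in> I \<Longrightarrow> dual_basis I b i (b j) = (if i = j then 1 else 0)"
proof -
  have inj: "inj_on b I" and ind: "vec.independent (b ` I)" and sp: "vec.span (b ` I) = UNIV"
    using b unfolding indexed_basis_def by auto
  have "(\<Sum>x\<in>b ` I. vec.representation (b ` I) v x *s x) = v"
    by (rule vec.sum_representation_eq) (use ind sp fin in auto)
  then show "(\<Sum>i\<in>I. dual_basis I b i v *s b i) = v"
    unfolding dual_basis_def by (simp add: sum.reindex[OF inj])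
  show "dual_basis I b i (b j) = (if i = j then 1 else 0)" if "i \<in> I" "j \<in> I"
    using vec.representation_basis[OF ind, of "b j"] that inj
    unfolding dual_basis_def by (auto simp: inj_on_def)
qed

lemma dual_basis_add_scale:
  fixes b :: "'i \<Rightarrow> 'a::field^'n::finite"
  assumes b: "indexed_basis I b"
  shows "dual_basis I b i (u + v) = dual_basis I b i u + dual_basis I b i v"
    and "dual_basis I b i (c *s v) = c * dual_basis I b i v"
proof -
  have ind: "vec.independent (b ` I)" and sp: "vec.span (b ` I) = UNIV"
    using b unfolding indexed_basis_def by auto
  show "dual_basis I b i (u + v) = dual_basis I b i u + dual_basis I b i v"
    unfolding dual_basis_def by (subst vec.representation_add[OF ind]) (auto simp: sp)
  show "dual_basis I b i (c *s v) = c * dual_basis I b i v"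
    unfolding dual_basis_def by (subst vec.representation_scale[OF ind]) (auto simp: sp)
qed

lemma dual_basis_kernel:
  assumes "indexed_basis I b"
  shows "vec.subspace {v. dual_basis I b i v = 0}"
proof (rule vec.subspaceI)
  have "dual_basis I b i (0 *s 0) = 0 * dual_basis I b i 0" by (rule dual_basis_add_scale[OF assms])
  then show "0 \<in> {v. dual_basis I b i v = 0}" by simp
qed (simp_all add: dual_basis_add_scale[OF assms])

lemma wedge3_expand:
  "wedge3 \<alpha> \<beta> \<gamma> u v w = \<alpha> u * \<beta> v * \<gamma> w + \<alpha> v * \<beta> w * \<gamma> u + \<alpha> w * \<beta> u * \<gamma> v
     - \<alpha> w * \<beta> v * \<gamma> u - \<alpha> v * \<beta> u * \<gamma> w - \<alpha> u * \<beta> w * \<gamma> v"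
  unfolding wedge3_def det_3 by (simp add: algebra_simps)

text \<open>The index sum of a nonzero coefficient vanishes modulo 7 exactly for the five triples
  in the normal form of a Dickson form.\<close>

definition weighted_basis :: "('a::field^7 \<Rightarrow> 'a^7 \<Rightarrow> 'a^7 \<Rightarrow> 'a) \<Rightarrow> (int \<Rightarrow> 'a^7) \<Rightarrow> bool" where
  "weighted_basis f b \<longleftrightarrow> indexed_basis {-3..3} b \<and>
     (\<forall>i\<in>{-3..3}. \<forall>j\<in>{-3..3}. \<forall>k\<in>{-3..3}. f (b i) (b j) (b k) \<noteq> 0 \<longrightarrow> 7 dvd i + j + k)"

lemma interval_7: "{-3..3::int} = {-3, -2, -1, 0, 1, 2, 3}"
  by auto

text \<open>Three distinct indices have a sum between -6 and 6, so divisibility by 7 means that the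
  sum is 0. This happens for three index sets containing 0 and for {1, 2, -3} and {-1, -2,
  3}.\<close>

lemma five_term_expansion:
  fixes f :: "'a::field^7 \<Rightarrow> 'a^7 \<Rightarrow> 'a^7 \<Rightarrow> 'a"
  assumes alt: "alternating_trilinear f" and wb: "weighted_basis f b"
  defines "e \<equiv> dual_basis {-3..3} b"
  shows "f u v w = f (b 0) (b 1) (b (-1)) * wedge3 (e 0) (e 1) (e (-1)) u v w
    + f (b 0) (b 2) (b (-2)) * wedge3 (e 0) (e 2) (e (-2)) u v w
    + f (b 0) (b 3) (b (-3)) * wedge3 (e 0) (e 3) (e (-3)) u v w
    + f (b 1) (b 2) (b (-3)) * wedge3 (e 1) (e 2) (e (-3)) u v w
    + f (b (-1)) (b (-2)) (b 3) * wedge3 (e (-1)) (e (-2)) (e 3) u v w"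
    (is "_ = ?g u v w")
proof -
  interpret alternating_form f using alt by unfold_locales
  have b: "indexed_basis {-3..3} b"
    and wt: "\<And>i j k. i \<in> {-3..3} \<Longrightarrow> j \<in> {-3..3} \<Longrightarrow> k \<in> {-3..3} \<Longrightarrow> \<not> 7 dvd i + j + k \<Longrightarrow> f (b i) (b j) (b k) = 0"
    using wb unfolding weighted_basis_def by blast+
  have exp: "v = (\<Sum>i\<in>{-3..3}. e i v *s b i)" for v
    unfolding e_def using indexed_basis_expansion(1)[OF b] by simp
  note perms = permute[where u = "b 0" and v = "b 1" and w = "b (-1)"]
    permute[where u = "b 0" and v = "b 2" and w = "b (-2)"]
    permute[where u = "b 0" and v = "b 3" and w = "b (-3)"]
    permute[where u = "b 1" and v = "b 2" and w = "b (-3)"]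
    permute[where u = "b (-1)" and v = "b (-2)" and w = "b 3"]
  have row: "f (b i) v w = (\<Sum>j\<in>{-3..3}. e j v * (\<Sum>k\<in>{-3..3}. e k w * f (b i) (b j) (b k)))" for i v w
  proof -
    have "f (b i) v w = (\<Sum>j\<in>{-3..3}. e j v * f (b i) (b j) w)"
      by (subst exp[of v]) (simp add: sum scale)
    also have "\<dots> = (\<Sum>j\<in>{-3..3}. e j v * (\<Sum>k\<in>{-3..3}. e k w * f (b i) (b j) (b k)))"
    proof (rule sum.cong[OF refl])
      fix j
      show "e j v * f (b i) (b j) w = e j v * (\<Sum>k\<in>{-3..3}. e k w * f (b i) (b j) (b k))"
        by (subst exp[of w]) (simp add: sum scale)
    qed
    finally show ?thesis .
  qed
  have "f u v w = (\<Sum>i\<in>{-3..3}. e i u * f (b i) v w)"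
    by (subst exp[of u]) (simp add: sum scale)
  also have "\<dots> = ?g u v w"
    by (subst row, unfold interval_7) (simp add: wt perms wedge3_expand algebra_simps)
  finally show ?thesis .
qed

text \<open>The quadratic relation is Pluecker's: it holds iff \<open>f u\<close> is zero or decomposable as a 2-form.\<close>

definition rank_le_2 :: "('a::field^'n \<Rightarrow> 'a^'n \<Rightarrow> 'a^'n \<Rightarrow> 'a) \<Rightarrow> 'a^'n::finite \<Rightarrow> bool" where
  "rank_le_2 f u \<longleftrightarrow> (\<forall>p q r s. f u p q * f u r s - f u p r * f u q s + f u p s * f u q r = 0)"

locale irreducible_form = alternating_form f
  for f :: "'a::field^7 \<Rightarrow> 'a^7 \<Rightarrow> 'a^7 \<Rightarrow> 'a" +
  fixes G :: "('a^7^7) set"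
  assumes irreducible: "acts_irreducibly G" and preserved: "G \<subseteq> G2 f"
    and nonzero: "\<exists>u v w. f u v w \<noteq> 0"
begin

lemma preimage:
  assumes "A \<in> G"
  obtains v' where "A *v v' = v"
proof -
  have "invertible A" using assms preserved unfolding G2_def by auto
  then show thesis using that
    by (metis invertible_def matrix_vector_mul_assoc matrix_vector_mul_lid)
qed

lemma preserves: "A \<in> G \<Longrightarrow> f (A *v u) (A *v v) (A *v w) = f u v w"
  using preserved unfolding G2_def by auto

lemma invariant_subspace:
  assumes "vec.subspace W" "\<And>A w. A \<in> G \<Longrightarrow> w \<in> W \<Longrightarrow> A *v w \<in> W"
  shows "W = {0} \<or> W = UNIV"
  using irreducible assms unfolding acts_irreducibly_def by blast

text \<open>The radical of \<open>f\<close> is stable under \<open>G\<close>, and it is proper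
  because \<open>f\<close> is nonzero.\<close>

lemma radical_trivial:
  assumes "\<And>v w. f u v w = 0"
  shows "u = 0"
proof -
  let ?W = "{u. \<forall>v w. f u v w = 0}"
  have "?W = {0} \<or> ?W = UNIV"
  proof (rule invariant_subspace)
    show "vec.subspace ?W" by (rule vec.subspaceI) (auto simp: add scale)
    fix A w assume A: "A \<in> G" and w: "w \<in> ?W"
    have "f (A *v w) p q = 0" for p q
    proof -
      obtain p' q' where "A *v p' = p" "A *v q' = q" using preimage[OF A] by metis
      then show ?thesis using preserves[OF A, of w p' q'] w by auto
    qed
    then show "A *v w \<in> ?W" by blast
  qed
  moreover have "?W \<noteq> UNIV" using nonzero by blast
  ultimately have W: "?W = {0}" by blast
  have "u \<in> ?W" using assms by simp
  then show ?thesis unfolding W by simp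
qed

text \<open>The rank condition is transported by invertible maps preserving \<open>f\<close>, so the
  vectors satisfying it span a stable subspace. It is nonzero because of \<open>u\<close> and proper
  because of \<open>W\<close>.\<close>

lemma rank_le_2_contradiction:
  assumes u: "rank_le_2 f u" "u \<noteq> 0" and W: "vec.subspace W" "W \<noteq> UNIV"
    and sub: "\<And>v. rank_le_2 f v \<Longrightarrow> v \<in> W"
  shows False
proof -
  let ?N = "vec.span (Collect (rank_le_2 f))"
  have closed: "rank_le_2 f (A *v v)" if A: "A \<in> G" and v: "rank_le_2 f v" for A v
    unfolding rank_le_2_def
  proof (intro allI)
    fix p q r s
    obtain p' q' r' s' where "A *v p' = p" "A *v q' = q" "A *v r' = r" "A *v s' = s"
      using preimage[OF A] by metis
    then show "f (A *v v) p q * f (A *v v) r s - f (A *v v) p r * f (A *v v) q s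
        + f (A *v v) p s * f (A *v v) q r = 0"
      using v[unfolded rank_le_2_def, rule_format, of p' q' r' s'] preserves[OF A, of v] by metis
  qed
  have "?N = {0} \<or> ?N = UNIV"
  proof (rule invariant_subspace)
    fix A w assume A: "A \<in> G" and w: "w \<in> ?N"
    have "A *v w \<in> (*v) A ` ?N" using w by (rule imageI)
    also have "\<dots> = vec.span ((*v) A ` Collect (rank_le_2 f))" by (simp add: vec.span_image)
    also have "\<dots> \<subseteq> ?N" by (rule vec.span_mono) (use closed[OF A] in blast)
    finally show "A *v w \<in> ?N" .
  qed simp
  moreover have "u \<in> ?N" using u(1) by (intro vec.span_base) simp
  moreover have "?N \<subseteq> W" by (rule vec.span_minimal) (use sub W(1) in auto)
  ultimately show False using u(2) W(2) by blast
qed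

text \<open>A vanishing coefficient lowers the rank of the contraction with some \<open>b i\<close>
  to at most 2, while Pluecker's relation confines all vectors of rank at most 2 to a coordinate
  hyperplane. If the ranks drop further, \<open>b i\<close> falls into the radical.\<close>

lemma five_coefficients_nonzero:
  assumes wb: "weighted_basis f b"
  shows "f (b 0) (b 1) (b (-1)) \<noteq> 0" "f (b 0) (b 2) (b (-2)) \<noteq> 0" "f (b 0) (b 3) (b (-3)) \<noteq> 0"
    "f (b 1) (b 2) (b (-3)) \<noteq> 0" "f (b (-1)) (b (-2)) (b 3) \<noteq> 0"
proof -
  define A where "A = f (b 0) (b 1) (b (-1))"
  define B where "B = f (b 0) (b 2) (b (-2))"
  define C where "C = f (b 0) (b 3) (b (-3))"
  define D where "D = f (b 1) (b 2) (b (-3))"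
  define E where "E = f (b (-1)) (b (-2)) (b 3)"
  define e where "e = dual_basis {-3..3} b"
  have b: "indexed_basis {-3..3} b" using wb unfolding weighted_basis_def by blast
  have dual: "e i (b j) = (if i = j then 1 else 0)" if "i \<in> {-3..3}" "j \<in> {-3..3}" for i j
    unfolding e_def by (rule indexed_basis_expansion(2)[OF b _ that]) simp
  have form: "f u v w = A * wedge3 (e 0) (e 1) (e (-1)) u v w + B * wedge3 (e 0) (e 2) (e (-2)) u v w
      + C * wedge3 (e 0) (e 3) (e (-3)) u v w + D * wedge3 (e 1) (e 2) (e (-3)) u v w
      + E * wedge3 (e (-1)) (e (-2)) (e 3) u v w" for u v w
    unfolding A_def B_def C_def D_def E_def e_def by (rule five_term_expansion[OF alternating wb])
  have b_nz: "b i \<noteq> 0" if "i \<in> {-3..3}" for i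
    using dual[OF that that] dual_basis_kernel[OF b, of i] vec.subspace_0 unfolding e_def by force
  have rad: False if "i \<in> {-3..3}" "\<And>v w. f (b i) v w = 0" for i
    using radical_trivial[of "b i"] b_nz that by blast
  \<comment> \<open>For each index, the coefficients of the terms containing it cannot all vanish,
    since \<open>b i\<close> would then lie in the radical.\<close>
  have r0: "\<not> (A = 0 \<and> B = 0 \<and> C = 0)" using rad[of 0] by (auto simp: form wedge3_expand dual)
  have r1: "\<not> (A = 0 \<and> D = 0)" using rad[of 1] by (auto simp: form wedge3_expand dual)
  have r2: "\<not> (B = 0 \<and> D = 0)" using rad[of 2] by (auto simp: form wedge3_expand dual)
  have r3: "\<not> (C = 0 \<and> D = 0)" using rad[of "-3"] by (auto simp: form wedge3_expand dual)
  have s1: "\<not> (A = 0 \<and> E = 0)" using rad[of "-1"] by (auto simp: form wedge3_expand dual)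
  have s2: "\<not> (B = 0 \<and> E = 0)" using rad[of "-2"] by (auto simp: form wedge3_expand dual)
  have s3: "\<not> (C = 0 \<and> E = 0)" using rad[of 3] by (auto simp: form wedge3_expand dual)
  have n2: False if "i \<in> {-3..3}" "j \<in> {-3..3}" "rank_le_2 f (b i)" "\<And>v. rank_le_2 f v \<Longrightarrow> e j v = 0" for i j
  proof (rule rank_le_2_contradiction[OF that(3) b_nz[OF that(1)]])
    show "vec.subspace {v. e j v = 0}" unfolding e_def by (rule dual_basis_kernel[OF b])
    show "{v. e j v = 0} \<noteq> UNIV" using dual[OF that(2,2)] by (auto simp: set_eq_iff intro: exI[of _ "b j"])
  qed (use that(4) in blast)
  have rel: "f v (b i) (b j) * f v (b k) (b l) - f v (b i) (b k) * f v (b j) (b l)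
      + f v (b i) (b l) * f v (b j) (b k) = 0" if "rank_le_2 f v" for v i j k l
    using that unfolding rank_le_2_def by blast
  \<comment> \<open>For the indices 1, -1, 2, -2 Pluecker's relation reads
    \<open>A * B * (e 0 v)^2 = D * E * e 3 v * e (-3) v\<close>, so \<open>e 0 v\<close> vanishes as
    soon as \<open>D\<close> or \<open>E\<close> does.\<close>
  have EAB: False if "E = 0" "A \<noteq> 0" "B \<noteq> 0"
  proof (rule n2[of "-1" 0])
    show "rank_le_2 f (b (-1))"
      using \<open>E = 0\<close> by (simp add: rank_le_2_def form wedge3_expand dual algebra_simps)
    show "e 0 v = 0" if "rank_le_2 f v" for v
      using rel[OF that, of 1 "-1" 2 "-2"] \<open>E = 0\<close> \<open>A \<noteq> 0\<close> \<open>B \<noteq> 0\<close> by (simp add: form wedge3_expand dual)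
  qed auto
  have DAB: False if "D = 0" "A \<noteq> 0" "B \<noteq> 0"
  proof (rule n2[of 1 0])
    show "rank_le_2 f (b 1)"
      using \<open>D = 0\<close> by (simp add: rank_le_2_def form wedge3_expand dual algebra_simps)
    show "e 0 v = 0" if "rank_le_2 f v" for v
      using rel[OF that, of 1 "-1" 2 "-2"] \<open>D = 0\<close> \<open>A \<noteq> 0\<close> \<open>B \<noteq> 0\<close> by (simp add: form wedge3_expand dual)
  qed auto
  \<comment> \<open>When one of \<open>A\<close>, \<open>B\<close>, \<open>C\<close> is zero,
    contraction with an index of its term that also occurs in the \<open>D\<close> term leaves only
    the latter. The chosen relation then collapses, up to sign, to two nonzero coefficients times
    the square of a coordinate.\<close>
  have AB: False if "A = 0" "B \<noteq> 0" "D \<noteq> 0"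
  proof (rule n2[of 1 2])
    show "rank_le_2 f (b 1)"
      using \<open>A = 0\<close> by (simp add: rank_le_2_def form wedge3_expand dual algebra_simps)
    show "e 2 v = 0" if "rank_le_2 f v" for v
      using rel[OF that, of 0 "-2" 1 "-3"] \<open>A = 0\<close> \<open>B \<noteq> 0\<close> \<open>D \<noteq> 0\<close> by (simp add: form wedge3_expand dual)
  qed auto
  have AC: False if "A = 0" "C \<noteq> 0" "D \<noteq> 0"
  proof (rule n2[of 1 "-3"])
    show "rank_le_2 f (b 1)"
      using \<open>A = 0\<close> by (simp add: rank_le_2_def form wedge3_expand dual algebra_simps)
    show "e (-3) v = 0" if "rank_le_2 f v" for v
      using rel[OF that, of 0 3 1 2] \<open>A = 0\<close> \<open>C \<noteq> 0\<close> \<open>D \<noteq> 0\<close> by (simp add: form wedge3_expand dual)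
  qed auto
  have BA: False if "B = 0" "A \<noteq> 0" "D \<noteq> 0"
  proof (rule n2[of 2 1])
    show "rank_le_2 f (b 2)"
      using \<open>B = 0\<close> by (simp add: rank_le_2_def form wedge3_expand dual algebra_simps)
    show "e 1 v = 0" if "rank_le_2 f v" for v
      using rel[OF that, of 0 "-1" 2 "-3"] \<open>B = 0\<close> \<open>A \<noteq> 0\<close> \<open>D \<noteq> 0\<close> by (simp add: form wedge3_expand dual)
  qed auto
  have BC: False if "B = 0" "C \<noteq> 0" "D \<noteq> 0"
  proof (rule n2[of 2 "-3"])
    show "rank_le_2 f (b 2)"
      using \<open>B = 0\<close> by (simp add: rank_le_2_def form wedge3_expand dual algebra_simps)
    show "e (-3) v = 0" if "rank_le_2 f v" for v
      using rel[OF that, of 0 3 1 2] \<open>B = 0\<close> \<open>C \<noteq> 0\<close> \<open>D \<noteq> 0\<close> by (simp add: form wedge3_expand dual)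
  qed auto
  have CA: False if "C = 0" "A \<noteq> 0" "D \<noteq> 0"
  proof (rule n2[of "-3" 1])
    show "rank_le_2 f (b (-3))"
      using \<open>C = 0\<close> by (simp add: rank_le_2_def form wedge3_expand dual algebra_simps)
    show "e 1 v = 0" if "rank_le_2 f v" for v
      using rel[OF that, of 0 "-1" 2 "-3"] \<open>C = 0\<close> \<open>A \<noteq> 0\<close> \<open>D \<noteq> 0\<close> by (simp add: form wedge3_expand dual)
  qed auto
  have CB: False if "C = 0" "B \<noteq> 0" "D \<noteq> 0"
  proof (rule n2[of "-3" 2])
    show "rank_le_2 f (b (-3))"
      using \<open>C = 0\<close> by (simp add: rank_le_2_def form wedge3_expand dual algebra_simps)
    show "e 2 v = 0" if "rank_le_2 f v" for v
      using rel[OF that, of 0 "-2" 1 "-3"] \<open>C = 0\<close> \<open>B \<noteq> 0\<close> \<open>D \<noteq> 0\<close> by (simp add: form wedge3_expand dual)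
  qed auto
  \<comment> \<open>If \<open>D\<close> or \<open>E\<close> vanished, the radical conditions would
    make \<open>A\<close> and \<open>B\<close> nonzero, against \<open>DAB\<close> and
    \<open>EAB\<close>. With \<open>D\<close> nonzero, a zero among \<open>A\<close>,
    \<open>B\<close>, \<open>C\<close> leaves another one nonzero by \<open>r0\<close>, against the
    remaining six facts.\<close>
  have "A \<noteq> 0 \<and> B \<noteq> 0 \<and> C \<noteq> 0 \<and> D \<noteq> 0 \<and> E \<noteq> 0"
    using r0 r1 r2 r3 s1 s2 s3 EAB DAB AB AC BA BC CA CB by argo
  then show "f (b 0) (b 1) (b (-1)) \<noteq> 0" "f (b 0) (b 2) (b (-2)) \<noteq> 0" "f (b 0) (b 3) (b (-3)) \<noteq> 0"
    "f (b 1) (b 2) (b (-3)) \<noteq> 0" "f (b (-1)) (b (-2)) (b 3) \<noteq> 0"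
    unfolding A_def B_def C_def D_def E_def by blast+
qed

end

section \<open>Rescaling to the normal form of a Dickson form\<close>

lemma indexed_basis_if_spanning:
  fixes b :: "'i \<Rightarrow> 'a::field^'n::finite"
  assumes fin: "finite I" and card: "card I = CARD('n)" and span: "vec.span (b ` I) = UNIV"
  shows "indexed_basis I b"
proof -
  have "CARD('n) \<le> card (b ` I)"
    using vec.dim_le_card[of UNIV "b ` I"] fin span by (simp add: vec_dim_card del: vec.dim_UNIV)
  then have eq: "card (b ` I) = CARD('n)" using card_image_le[OF fin, of b] card by simp
  then have "inj_on b I" using card fin by (simp add: eq_card_imp_inj_on)
  moreover have "vec.independent (b ` I)"
    using vec.card_eq_dim[of "b ` I" UNIV] eq fin span by (simp add: vec_dim_card del: vec.dim_UNIV)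
  ultimately show ?thesis using span unfolding indexed_basis_def by blast
qed

lemma nth_root_exists:
  fixes a :: "'a::alg_closed_field"
  assumes "n > 0"
  shows "\<exists>s. s ^ n = a"
proof -
  have "degree ([:0, 1:] ^ n + [:-a:]) = n"
    using assms by (subst degree_add_eq_left) (simp_all add: degree_power_eq)
  then obtain s where "poly ([:0, 1:] ^ n + [:-a:]) s = 0"
    using alg_closed_imp_poly_has_root[of "[:0, 1:] ^ n + [:-a:]"] assms by auto
  then show ?thesis by (intro exI[of _ s]) (simp add: poly_power)
qed

lemma Dickson_form_if_five_nonzero:
  fixes f :: "'a::alg_closed_field^7 \<Rightarrow> 'a^7 \<Rightarrow> 'a^7 \<Rightarrow> 'a"
  assumes alt: "alternating_trilinear f" and wb: "weighted_basis f b"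
    and nz: "f (b 0) (b 1) (b (-1)) \<noteq> 0" "f (b 0) (b 2) (b (-2)) \<noteq> 0" "f (b 0) (b 3) (b (-3)) \<noteq> 0"
    "f (b 1) (b 2) (b (-3)) \<noteq> 0" "f (b (-1)) (b (-2)) (b 3) \<noteq> 0"
  shows "Dickson_form f"
proof -
  interpret alternating_form f using alt by unfold_locales
  define A where "A = f (b 0) (b 1) (b (-1))"
  define B where "B = f (b 0) (b 2) (b (-2))"
  define C where "C = f (b 0) (b 3) (b (-3))"
  define D where "D = f (b 1) (b 2) (b (-3))"
  define E where "E = f (b (-1)) (b (-2)) (b 3)"
  have nz': "A \<noteq> 0" "B \<noteq> 0" "C \<noteq> 0" "D \<noteq> 0" "E \<noteq> 0"
    using nz unfolding A_def B_def C_def D_def E_def by auto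
  \<comment> \<open>Put \<open>c 1 = c 2 = 1\<close> and \<open>c (-1) = s\<close>. Normalizing the
    first four coefficients determines the other scalars, and the fifth coefficient becomes
    \<open>s ^ 3 * A ^ 2 * D * E / (B * C)\<close>; \<open>s\<close> is chosen to make this
    1.\<close>
  obtain s where s: "s ^ 3 = B * C / (A ^ 2 * D * E)" using nth_root_exists[of 3] by auto
  then have s_nz: "s \<noteq> 0" using nz' by auto
  define c where "c i = (if i = 0 then 1 / (A * s) else if i = -1 then s else if i = -2 then A * s / B
    else if i = 3 then A * s * D / C else if i = -3 then 1 / D else 1)" for i :: int
  have b: "indexed_basis {-3..3} b" using wb unfolding weighted_basis_def by blast
  define b' where "b' = (\<lambda>i. c i *s b i)"
  have b': "indexed_basis {-3..3} b'"
  proof (rule indexed_basis_if_spanning)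
    have c_nz: "c i \<noteq> 0" for i using nz' s_nz by (simp add: c_def)
    have "b i \<in> vec.span (b' ` {-3..3})" if "i \<in> {-3..3}" for i
    proof -
      have "inverse (c i) *s b' i \<in> vec.span (b' ` {-3..3})"
        using that by (intro vec.span_scale vec.span_base imageI)
      then show ?thesis using c_nz[of i] by (simp add: b'_def)
    qed
    then have "vec.span (b ` {-3..3}) \<subseteq> vec.span (b' ` {-3..3})" by (intro vec.span_minimal) auto
    then show "vec.span (b' ` {-3..3}) = UNIV" using b unfolding indexed_basis_def by auto
  qed simp_all
  have wb': "weighted_basis f b'"
    using b' wb unfolding weighted_basis_def b'_def scale by simp
  have "f (b' 0) (b' 1) (b' (-1)) = 1" "f (b' 0) (b' 2) (b' (-2)) = 1" "f (b' 0) (b' 3) (b' (-3)) = 1"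
      "f (b' 1) (b' 2) (b' (-3)) = 1"
    unfolding b'_def scale A_def[symmetric] B_def[symmetric] C_def[symmetric] D_def[symmetric]
    using nz' s_nz by (simp_all add: c_def)
  moreover have "f (b' (-1)) (b' (-2)) (b' 3) = 1"
  proof -
    have "f (b' (-1)) (b' (-2)) (b' 3) = s ^ 3 * (A ^ 2 * D * E / (B * C))"
      unfolding b'_def scale E_def[symmetric] by (simp add: c_def power2_eq_square power3_eq_cube mult_ac)
    then show ?thesis unfolding s using nz' by simp
  qed
  ultimately have "f u v w = (let e = dual_basis {-3..3} b' in
      wedge3 (e 0) (e 1) (e (-1)) u v w + wedge3 (e 0) (e 2) (e (-2)) u v w
      + wedge3 (e 0) (e 3) (e (-3)) u v w + wedge3 (e 1) (e 2) (e (-3)) u v w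
      + wedge3 (e (-1)) (e (-2)) (e 3) u v w)" for u v w
    unfolding Let_def by (subst five_term_expansion[OF alt wb']) (simp only: mult_1)
  then show ?thesis
    unfolding Dickson_form_def Let_def using alt b' by blast
qed

lemma Dickson_form_if_weighted_basis:
  fixes f :: "'a::alg_closed_field^7 \<Rightarrow> 'a^7 \<Rightarrow> 'a^7 \<Rightarrow> 'a"
  assumes "irreducible_form f G" and wb: "weighted_basis f b"
  shows "Dickson_form f"
proof -
  interpret irreducible_form f G by fact
  show ?thesis by (rule Dickson_form_if_five_nonzero[OF alternating wb five_coefficients_nonzero[OF wb]])
qed

subsection \<open>Eigenbases of a 7-cycle\<close>

text \<open>A root of \<open>1 + t + ... + t^6\<close> is a seventh root of unity, and it differs
  from 1 because the value at 1 is 7.\<close>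

lemma primitive_7th_root_exists:
  assumes "(7 :: 'a::alg_closed_field) \<noteq> 0"
  obtains \<zeta> :: "'a::alg_closed_field" where "\<zeta> ^ 7 = 1" "\<zeta> \<noteq> 1"
proof -
  obtain \<zeta> :: 'a where \<zeta>: "(\<Sum>k\<le>6. 1 * \<zeta> ^ k) = 0"
    using alg_closed[of 6 "\<lambda>_. 1 :: 'a"] by auto
  have sum7: "(\<Sum>k\<le>6. \<xi> ^ k) = 1 + \<xi> + \<xi>^2 + \<xi>^3 + \<xi>^4 + \<xi>^5 + \<xi>^6" for \<xi> :: 'a
    by (simp add: numeral_eq_Suc add.assoc)
  have "\<zeta> ^ 7 - 1 = (\<zeta> - 1) * (1 + \<zeta> + \<zeta>^2 + \<zeta>^3 + \<zeta>^4 + \<zeta>^5 + \<zeta>^6)"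
    by (simp add: algebra_simps numeral_eq_Suc)
  then have "\<zeta> ^ 7 = 1" using \<zeta> unfolding sum7 by (simp add: sum7)
  moreover have "\<zeta> \<noteq> 1" using \<zeta> assms by auto
  ultimately show thesis by (rule that)
qed

lemma power_eq_1_iff_7_dvd:
  fixes \<zeta> :: "'a::field"
  assumes "\<zeta> ^ 7 = 1" "\<zeta> \<noteq> 1"
  shows "\<zeta> ^ n = 1 \<longleftrightarrow> 7 dvd n"
proof -
  have red: "\<zeta> ^ m = \<zeta> ^ (m mod 7)" for m
  proof -
    have "\<zeta> ^ m = \<zeta> ^ (7 * (m div 7) + m mod 7)" by simp
    then show ?thesis by (simp only: power_add power_mult assms(1) power_one mult_1)
  qed
  have "7 dvd n" if "\<zeta> ^ n = 1"
  proof (rule ccontr)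
    assume "\<not> 7 dvd n"
    then have "n mod 7 = 1 \<or> n mod 7 = 2 \<or> n mod 7 = 3 \<or> n mod 7 = 4 \<or> n mod 7 = 5 \<or> n mod 7 = 6"
      by presburger
    \<comment> \<open>An inverse \<open>m\<close> of \<open>n\<close> modulo 7 recovers
      \<open>\<zeta>\<close> as \<open>\<zeta> ^ (n * m)\<close>.\<close>
    then have "\<exists>m. ((n mod 7) * m) mod 7 = 1"
      by (elim disjE) (auto intro: exI[of _ 1] exI[of _ 4] exI[of _ 5] exI[of _ 2] exI[of _ 3] exI[of _ 6])
    then obtain m where "(n * m) mod 7 = 1" by (auto simp: mod_mult_left_eq)
    then have "\<zeta> ^ (n * m) = \<zeta>" using red[of "n * m"] by simp
    moreover have "\<zeta> ^ (n * m) = 1" using that by (simp add: power_mult)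
    ultimately show False using assms(2) by simp
  qed
  then show ?thesis using red[of n] by auto
qed

text \<open>The discrete Fourier transform along the 7-cycle; inverting it requires 7 to be
  invertible.\<close>

lemma eigenbasis_of_7_cycle:
  fixes \<zeta> :: "'a::field" and z :: "'a^7^7"
  assumes z: "spanning_action z perm_z (\<lambda>_. 1) 6 w"
    and \<zeta>: "\<zeta> ^ 7 = 1" "\<zeta> \<noteq> 1" and char: "(7 :: 'a) \<noteq> 0"
  obtains b where "indexed_basis {-3..3} b"
    and "\<And>i. i \<in> {-3..3} \<Longrightarrow> z *v b i = \<zeta> ^ nat (i mod 7) *s b i"
proof -
  define v where "v c = (\<Sum>k<7. c ^ k *s w k)" for c
  have zw: "z *v w 0 = w 1" "z *v w 1 = w 2" "z *v w 2 = w 3" "z *v w 3 = w 4"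
    "z *v w 4 = w 5" "z *v w 5 = w 6" "z *v w 6 = w 0"
    using z unfolding spanning_action_def all_less_7 by simp_all
  have sum7: "(\<Sum>k<7. F k) = F 0 + F 1 + F 2 + F 3 + F 4 + F 5 + F 6" for F :: "nat \<Rightarrow> 'b::comm_monoid_add"
    by (simp add: eval_nat_numeral add.assoc)
  have v_eig: "c *s (z *v v c) = v c" if "c ^ 7 = 1" for c
  proof -
    have "z *v v c = w 1 + c *s w 2 + c^2 *s w 3 + c^3 *s w 4 + c^4 *s w 5 + c^5 *s w 6 + c^6 *s w 0"
      unfolding v_def sum7 by (simp add: vec.add vec.scale zw[simplified])
    moreover have "c * c = c^2" "c * c^2 = c^3" "c * c^3 = c^4" "c * c^4 = c^5" "c * c^5 = c^6" "c * c^6 = 1"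
      using that by (simp_all add: eval_nat_numeral)
    ultimately show ?thesis unfolding v_def sum7
      by (simp add: vec.scale_right_distrib add_ac)
  qed
  \<comment> \<open>The cycle multiplies \<open>v c\<close> by the inverse of \<open>c\<close>, so
    eigenvalue exponent \<open>i\<close> calls for the parameter with exponent
    \<open>- i\<close>.\<close>
  define b where "b i = v (\<zeta> ^ nat ((- i) mod 7))" for i :: int
  have eig: "z *v b i = \<zeta> ^ nat (i mod 7) *s b i" for i
  proof -
    let ?c = "\<zeta> ^ nat ((- i) mod 7)"
    have "i mod 7 + (- i) mod 7 = 0 \<or> i mod 7 + (- i) mod 7 = 7"
      by (simp add: zmod_zminus1_eq_if)
    moreover have "nat (i mod 7) + nat ((- i) mod 7) = nat (i mod 7 + (- i) mod 7)"
      by (simp add: nat_add_distrib)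
    ultimately have "7 dvd nat (i mod 7) + nat ((- i) mod 7)" by auto
    then have inv: "\<zeta> ^ nat (i mod 7) * ?c = 1"
      using power_eq_1_iff_7_dvd[OF \<zeta>] by (simp flip: power_add)
    have "?c ^ 7 = 1" using \<zeta>(1) by (metis power_mult mult.commute power_one)
    then have "\<zeta> ^ nat (i mod 7) *s b i = \<zeta> ^ nat (i mod 7) *s (?c *s (z *v b i))"
      unfolding b_def by (simp only: v_eig)
    also have "\<dots> = z *v b i" by (simp only: vec.scale_scale inv vec.scale_one)
    finally show ?thesis by simp
  qed
  have in_span: "v (\<zeta> ^ j) \<in> vec.span (b ` {-3..3})" if "j < 7" for j
  proof -
    obtain i :: int where i: "i \<in> {-3..3}" "(- i) mod 7 = int j"
    proof (cases "j \<le> 3")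
      case True
      then show thesis using that(1)[of "- int j"] by simp
    next
      case False
      have "(int j - 7) mod 7 = int j" using \<open>j < 7\<close> by (simp add: mod_diff_right_eq)
      then show thesis using False \<open>j < 7\<close> that(1)[of "7 - int j"] by simp
    qed
    then have "v (\<zeta> ^ j) = b i" unfolding b_def by simp
    then show ?thesis using i(1) by (simp add: vec.span_base)
  qed
  have "w m \<in> vec.span (b ` {-3..3})" if m: "m < 7" for m
  proof -
    \<comment> \<open>Inverse Fourier transform: \<open>7 - m\<close> stands for \<open>- m\<close>
      among natural exponents, and the powers of a seventh root of unity other than 1 sum to
      zero.\<close>
    have geom: "(\<Sum>j<7. (\<zeta> ^ (7 - m + k)) ^ j) = (if k = m then 7 else 0)" if k: "k < 7" for k
    proof (cases "k = m")
      case True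
      then show ?thesis using m \<zeta>(1) by simp
    next
      case False
      have "\<not> 7 dvd 7 - m + k"
      proof
        assume "7 dvd 7 - m + k"
        then obtain q where "7 - m + k = 7 * q" by (elim dvdE)
        moreover from this have "q = 1" using k m by linarith
        ultimately show False using False m by linarith
      qed
      then have ne: "\<zeta> ^ (7 - m + k) \<noteq> 1" using power_eq_1_iff_7_dvd[OF \<zeta>] by simp
      have "(\<zeta> ^ (7 - m + k)) ^ 7 = 1" using \<zeta>(1) by (metis power_mult mult.commute power_one)
      then show ?thesis using False ne by (simp add: sum_gp_strict)
    qed
    have "(\<Sum>j<7. \<zeta> ^ (j * (7 - m)) *s v (\<zeta> ^ j))
        = (\<Sum>j<7. \<Sum>k<7. ((\<zeta> ^ (7 - m + k)) ^ j) *s w k)"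
      unfolding v_def
      by (simp add: vec.scale_sum_right flip: power_mult power_add)
        (simp add: algebra_simps)
    also have "\<dots> = (\<Sum>k<7. (\<Sum>j<7. (\<zeta> ^ (7 - m + k)) ^ j) *s w k)"
      by (subst sum.swap) (simp add: vec.scale_sum_left)
    also have "\<dots> = (\<Sum>k<7. if k = m then 7 *s w k else 0)"
      by (rule sum.cong) (simp_all add: geom)
    also have "\<dots> = 7 *s w m" using m by simp
    finally have eq: "(\<Sum>j<7. \<zeta> ^ (j * (7 - m)) *s v (\<zeta> ^ j)) = 7 *s w m" .
    have "(\<Sum>j<7. \<zeta> ^ (j * (7 - m)) *s v (\<zeta> ^ j)) \<in> vec.span (b ` {-3..3})"
      by (intro vec.span_sum vec.span_scale in_span) simp
    then have "7 *s w m \<in> vec.span (b ` {-3..3})" unfolding eq .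
    then have "inverse 7 *s (7 *s w m) \<in> vec.span (b ` {-3..3})" by (rule vec.span_scale)
    then show ?thesis using char by simp
  qed
  then have "vec.span (w ` {..<7}) \<subseteq> vec.span (b ` {-3..3})" by (intro vec.span_minimal) auto
  then have "vec.span (b ` {-3..3}) = UNIV" using z unfolding spanning_action_def by auto
  then have "indexed_basis {-3..3} b" by (intro indexed_basis_if_spanning) simp_all
  then show thesis using that eig by blast
qed

text \<open>Invariance multiplies the coefficient at \<open>i, j, k\<close> by the root of unity
  with exponent \<open>i + j + k\<close>, so a nonzero coefficient forces that root to be 1.\<close>

lemma weighted_basis_if_7_cycle_invariant:
  fixes f :: "'a::field^7 \<Rightarrow> 'a^7 \<Rightarrow> 'a^7 \<Rightarrow> 'a"
  assumes alt: "alternating_trilinear f" and inv: "\<And>u v w. f (z *v u) (z *v v) (z *v w) = f u v w"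
    and \<zeta>: "\<zeta> ^ 7 = 1" "\<zeta> \<noteq> 1" and b: "indexed_basis {-3..3} b"
    and eig: "\<And>i. i \<in> {-3..3} \<Longrightarrow> z *v b i = \<zeta> ^ nat (i mod 7) *s b i"
  shows "weighted_basis f b"
  unfolding weighted_basis_def
proof (intro conjI ballI impI b)
  interpret alternating_form f using alt by unfold_locales
  fix i j k :: int
  assume ijk: "i \<in> {-3..3}" "j \<in> {-3..3}" "k \<in> {-3..3}" and nz: "f (b i) (b j) (b k) \<noteq> 0"
  have "f (b i) (b j) (b k) = \<zeta> ^ (nat (i mod 7) + nat (j mod 7) + nat (k mod 7)) * f (b i) (b j) (b k)"
    using inv[of "b i" "b j" "b k"] eig ijk by (simp add: scale power_add mult_ac)
  then have "\<zeta> ^ (nat (i mod 7) + nat (j mod 7) + nat (k mod 7)) = 1" using nz by simp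
  then have "7 dvd nat (i mod 7) + nat (j mod 7) + nat (k mod 7)" using power_eq_1_iff_7_dvd[OF \<zeta>] by simp
  then have "(7::int) dvd int (nat (i mod 7) + nat (j mod 7) + nat (k mod 7))"
    by (metis int_dvd_int_iff of_nat_numeral)
  also have "int (nat (i mod 7) + nat (j mod 7) + nat (k mod 7)) = i mod 7 + j mod 7 + k mod 7" by simp
  finally show "7 dvd i + j + k" by presburger
qed

lemma indexed_basis_nonzero:
  assumes b: "indexed_basis I b" and i: "i \<in> I"
  shows "b i \<noteq> 0"
proof
  assume "b i = 0"
  then have "0 \<in> b ` I" using i by (metis imageI)
  then show False using b vec.dependent_zero unfolding indexed_basis_def by blast
qed

subsection \<open>Invariant bilinear and trilinear forms\<close>

definition invariant_sym_form :: "'a::field^'n^'n \<Rightarrow> 'a^'n^'n \<Rightarrow> ('a^'n \<Rightarrow> 'a^'n::finite \<Rightarrow> 'a) \<Rightarrow> bool" where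
  "invariant_sym_form x y \<beta> \<longleftrightarrow>
    (\<forall>u u' v. \<beta> (u + u') v = \<beta> u v + \<beta> u' v) \<and> (\<forall>c u v. \<beta> (c *s u) v = c * \<beta> u v) \<and>
    (\<forall>u v. \<beta> u v = \<beta> v u) \<and>
    (\<forall>u v. \<beta> (x *v u) (x *v v) = \<beta> u v) \<and> (\<forall>u v. \<beta> (y *v u) (y *v v) = \<beta> u v)"

lemma invariant_sym_formD:
  assumes "invariant_sym_form x y \<beta>"
  shows "\<beta> (u + u') v = \<beta> u v + \<beta> u' v" "\<beta> (c *s u) v = c * \<beta> u v" "\<beta> u v = \<beta> v u"
    "\<beta> (x *v u) (x *v v) = \<beta> u v" "\<beta> (y *v u) (y *v v) = \<beta> u v"
    "\<beta> u (v + u') = \<beta> u v + \<beta> u u'" "\<beta> u (c *s v) = c * \<beta> u v"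
proof -
  note D = assms[unfolded invariant_sym_form_def]
  have *: "\<beta> (u + u') v = \<beta> u v + \<beta> u' v" "\<beta> (c *s u) v = c * \<beta> u v" "\<beta> u v = \<beta> v u" for u u' v c
    by (rule D[THEN conjunct1, rule_format] D[THEN conjunct2, THEN conjunct1, rule_format] D[THEN conjunct2, THEN conjunct2, THEN conjunct1, rule_format])+
  show "\<beta> (u + u') v = \<beta> u v + \<beta> u' v" "\<beta> (c *s u) v = c * \<beta> u v" "\<beta> u v = \<beta> v u"
    by (rule *)+
  show "\<beta> (x *v u) (x *v v) = \<beta> u v" "\<beta> (y *v u) (y *v v) = \<beta> u v"
    by (rule D[THEN conjunct2, THEN conjunct2, THEN conjunct2, THEN conjunct1, rule_format], rule D[THEN conjunct2, THEN conjunct2, THEN conjunct2, THEN conjunct2, rule_format])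
  show "\<beta> u (v + u') = \<beta> u v + \<beta> u u'" "\<beta> u (c *s v) = c * \<beta> u v"
    using *(1)[of v u' u] *(2)[of c v u] *(3)[of u] by simp_all
qed

text \<open>Irreducibility through the two generators alone. It will follow from irreducibility of
  the generated group because the inverses of \<open>x\<close> and \<open>y\<close> are powers of
  them. Surjectivity provides the preimages by which radicals are seen to be stable.\<close>

definition irreducible_pair :: "'a::field^'n^'n \<Rightarrow> 'a^'n::finite^'n \<Rightarrow> bool" where
  "irreducible_pair x y \<longleftrightarrow> surj ((*v) x) \<and> surj ((*v) y) \<and>
    (\<forall>W. vec.subspace W \<and> (\<forall>w\<in>W. x *v w \<in> W) \<and> (\<forall>w\<in>W. y *v w \<in> W) \<longrightarrow> W = {0} \<or> W = UNIV)"

lemma irreducible_pairD: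
  assumes "irreducible_pair x y" "vec.subspace W" "\<And>w. w \<in> W \<Longrightarrow> x *v w \<in> W" "\<And>w. w \<in> W \<Longrightarrow> y *v w \<in> W"
    and "v \<in> W" "v \<noteq> 0"
  shows "w \<in> W"
  using assms unfolding irreducible_pair_def by blast

text \<open>The radical is stable under both generators, so one nonzero vector in it makes it the
  whole space.\<close>

lemma invariant_sym_form_radical:
  assumes irr: "irreducible_pair x y" and \<beta>: "invariant_sym_form x y \<beta>"
    and u: "u \<noteq> 0" "\<And>v. \<beta> u v = 0"
  shows "\<beta> w v = 0"
proof -
  note add = invariant_sym_formD(1)[OF \<beta>] and scale = invariant_sym_formD(2)[OF \<beta>]
    and inv = invariant_sym_formD(4,5)[OF \<beta>]
  have "\<beta> 0 v = 0" for v using scale[of 0 0 v] by simp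
  then have W: "vec.subspace {u. \<forall>v. \<beta> u v = 0}" by (intro vec.subspaceI) (auto simp: add scale)
  have "w \<in> {u. \<forall>v. \<beta> u v = 0}"
  proof (rule irreducible_pairD[OF irr W])
    show "x *v w \<in> {u. \<forall>v. \<beta> u v = 0}" if w: "w \<in> {u. \<forall>v. \<beta> u v = 0}" for w
    proof -
      have "\<beta> (x *v w) v = 0" for v
      proof -
        obtain v' where "v = x *v v'" using irr unfolding irreducible_pair_def by (metis surjD)
        then show ?thesis using w inv(1)[of w v'] by simp
      qed
      then show ?thesis by simp
    qed
    show "y *v w \<in> {u. \<forall>v. \<beta> u v = 0}" if w: "w \<in> {u. \<forall>v. \<beta> u v = 0}" for w
    proof -
      have "\<beta> (y *v w) v = 0" for v
      proof -
        obtain v' where "v = y *v v'" using irr unfolding irreducible_pair_def by (metis surjD)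
        then show ?thesis using w inv(2)[of w v'] by simp
      qed
      then show ?thesis by simp
    qed
  qed (use u in auto)
  then show ?thesis by simp
qed

text \<open>In characteristic 2 the map \<open>u \<mapsto> \<beta> u u\<close> is additive, so it vanishes by irreducibility; then
  the eigenvector for the eigenvalue 1 of the 7-cycle is orthogonal to everything.\<close>

lemma invariant_sym_form_char_2:
  fixes x y :: "'a::field^7^7"
  assumes irr: "irreducible_pair x y" and \<beta>: "invariant_sym_form x y \<beta>" and two: "(2 :: 'a) = 0"
    and \<zeta>: "\<zeta> ^ 7 = 1" "\<zeta> \<noteq> 1" and b: "indexed_basis {-3..3} b"
    and eig: "\<And>i. i \<in> {-3..3} \<Longrightarrow> (x ** y) *v b i = \<zeta> ^ nat (i mod 7) *s b i"
  shows "\<beta> u v = 0"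
proof -
  note add = invariant_sym_formD(1)[OF \<beta>] and scale = invariant_sym_formD(2)[OF \<beta>]
    and comm = invariant_sym_formD(3)[OF \<beta>] and inv = invariant_sym_formD(4,5)[OF \<beta>]
    and add2 = invariant_sym_formD(6)[OF \<beta>] and scale2 = invariant_sym_formD(7)[OF \<beta>]
  have zinv: "\<beta> ((x ** y) *v u) ((x ** y) *v v) = \<beta> u v" for u v
    using inv by (simp flip: matrix_vector_mul_assoc)
  \<comment> \<open>Invariance multiplies the value by the root of unity with exponent
    \<open>i + j\<close>. As \<open>i + j\<close> lies between -6 and 6, this root is 1 only if
    \<open>i + j = 0\<close>.\<close>
  have orth: "\<beta> (b i) (b j) = 0" if "i \<in> {-3..3}" "j \<in> {-3..3}" "i + j \<noteq> 0" for i j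
  proof -
    have "\<beta> (b i) (b j) = \<zeta> ^ (nat (i mod 7) + nat (j mod 7)) * \<beta> (b i) (b j)"
      using zinv[of "b i" "b j"] eig that by (simp add: scale scale2 power_add mult_ac)
    moreover have "\<zeta> ^ (nat (i mod 7) + nat (j mod 7)) \<noteq> 1"
    proof -
      have "7 dvd i mod 7 + j mod 7 \<longleftrightarrow> 7 dvd i + j"
        by (simp add: dvd_eq_mod_eq_0 mod_add_eq)
      moreover have "\<not> 7 dvd i + j"
      proof
        assume "7 dvd i + j"
        then obtain q where q: "i + j = 7 * q" by (elim dvdE)
        have "- 6 \<le> i + j" "i + j \<le> 6" using that(1,2) by simp_all
        then have "q = 0" unfolding q by linarith
        then show False using q that(3) by simp
      qed
      moreover have "int (nat (i mod 7) + nat (j mod 7)) = i mod 7 + j mod 7" by simp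
      ultimately have "\<not> (7::int) dvd int (nat (i mod 7) + nat (j mod 7))" by simp
      then have "\<not> 7 dvd nat (i mod 7) + nat (j mod 7)" by (metis int_dvd_int_iff of_nat_numeral)
      then show ?thesis using power_eq_1_iff_7_dvd[OF \<zeta>] by simp
    qed
    ultimately show ?thesis by (metis mult_cancel_right2)
  qed
  have b_nz: "b i \<noteq> 0" if "i \<in> {-3..3}" for i
    by (rule indexed_basis_nonzero[OF b that])
  have z00: "\<beta> 0 0 = 0" using scale[of 0 0 0] by simp
  have dbl: "a + a = 0" for a :: 'a using two mult_2[of a] by simp
  have W: "vec.subspace {u. \<beta> u u = 0}"
  proof (rule vec.subspaceI)
    fix u v assume "u \<in> {u. \<beta> u u = 0}" "v \<in> {u. \<beta> u u = 0}"
    then show "u + v \<in> {u. \<beta> u u = 0}" using comm[of v u] dbl[of "\<beta> u v"] by (simp add: add add2)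
  next
    show "0 \<in> {u. \<beta> u u = 0}" using z00 by simp
    show "c *s u \<in> {u. \<beta> u u = 0}" if "u \<in> {u. \<beta> u u = 0}" for c u
      using that scale[of c u "c *s u"] scale2[of u c u] by simp
  qed
  have alt: "\<beta> w w = 0" for w
  proof -
    \<comment> \<open>The vector \<open>b 1\<close> is isotropic by \<open>orth\<close>, so the
      invariant subspace of isotropic vectors is not zero.\<close>
    have "w \<in> {u. \<beta> u u = 0}"
    proof (rule irreducible_pairD[OF irr W])
      show "b 1 \<in> {u. \<beta> u u = 0}" using orth[of 1 1] by simp
      show "b 1 \<noteq> 0" by (rule b_nz) simp
      show "x *v w \<in> {u. \<beta> u u = 0}" if "w \<in> {u. \<beta> u u = 0}" for w
        using that inv(1)[of w w] by simp
      show "y *v w \<in> {u. \<beta> u u = 0}" if "w \<in> {u. \<beta> u u = 0}" for w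
        using that inv(2)[of w w] by simp
    qed
    then show ?thesis by simp
  qed
  have b0: "\<beta> (b 0) v = 0" for v
  proof -
    have "vec.span (b ` {-3..3}) \<subseteq> {v. \<beta> (b 0) v = 0}"
    proof (rule vec.span_minimal)
      show "b ` {-3..3} \<subseteq> {v. \<beta> (b 0) v = 0}" 
      proof
        fix v assume "v \<in> b ` {-3..3}"
        then obtain j where j: "j \<in> {-3..3}" "v = b j" by blast
        then show "v \<in> {v. \<beta> (b 0) v = 0}"
          using orth[of 0 j] alt[of "b 0"] by (cases "j = 0") simp_all
      qed
      have "\<beta> (b 0) 0 = 0" using scale2[of "b 0" 0 0] by simp
      then show "vec.subspace {v. \<beta> (b 0) v = 0}" by (intro vec.subspaceI) (auto simp: add2 scale2)
    qed
    then show ?thesis using b unfolding indexed_basis_def by auto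
  qed
  have "b 0 \<noteq> 0" by (rule b_nz) simp
  then show ?thesis using b0 by (rule invariant_sym_form_radical[OF irr \<beta>])
qed

text \<open>An invariant symmetric tensor is a form on the dual space; its range is an invariant
  subspace, so it is invertible, and its inverse is a form on the space itself.\<close>

lemma invariant_sym_form_of_tensor:
  fixes x y :: "'a::field^'n^'n"
  assumes irr: "irreducible_pair x y"
    and t: "t \<in> sym_tensors" "t \<noteq> 0" "tensor2_map x t = t" "tensor2_map y t = t"
  obtains \<beta> where "invariant_sym_form x y \<beta>" "\<exists>u v. \<beta> u v \<noteq> 0"
proof -
  define T where "T = (\<chi> i j. t $ (i, j))"
  have T_sym: "transpose T = T"
    unfolding T_def transpose_def vec_eq_iff using sym_tensors_sym[OF t(1)] by simp
  \<comment> \<open>Read as a matrix, a tensor fixed by \<open>tensor2_map A\<close> is a form on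
    the dual space, preserved by the transpose of \<open>A\<close>.\<close>
  have T_inv: "A ** T ** transpose A = T" if "tensor2_map A t = t" for A
  proof -
    have "(A ** T ** transpose A) $ i $ j = tensor2_map A t $ (i, j)" for i j
    proof -
      have "(A ** T ** transpose A) $ i $ j
          = (\<Sum>b\<in>UNIV. \<Sum>a\<in>UNIV. A $ i $ a * t $ (a, b) * A $ j $ b)"
        by (simp add: matrix_matrix_mult_def transpose_def T_def sum_distrib_right)
      also have "\<dots> = (\<Sum>a\<in>UNIV. \<Sum>b\<in>UNIV. A $ i $ a * t $ (a, b) * A $ j $ b)" by (rule sum.swap)
      also have "\<dots> = tensor2_map A t $ (i, j)" by (simp add: tensor2_map_def mult_ac)
      finally show ?thesis .
    qed
    then show ?thesis using that by (simp add: vec_eq_iff T_def)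
  qed
  have tr_surj: "\<exists>\<psi>. \<phi> = transpose A *v \<psi>" if A: "surj ((*v) A)" for A :: "'a^'n^'n" and \<phi>
  proof -
    obtain B where "A ** B = mat 1" using A matrix_right_invertible_surjective by metis
    then have "B ** A = mat 1" by (simp add: matrix_left_right_inverse)
    then have "transpose (B ** A) = mat 1" by simp
    then have "transpose A ** transpose B = mat 1" by (simp add: matrix_transpose_mul)
    then have "\<phi> = transpose A *v (transpose B *v \<phi>)"
      by (simp add: matrix_vector_mul_assoc del: transpose_matrix_vector)
    then show ?thesis ..
  qed
  have range_closed: "A *v w \<in> range ((*v) T)" if A: "surj ((*v) A)" "A ** T ** transpose A = T"
      and w: "w \<in> range ((*v) T)" for A w
  proof -
    obtain \<phi> where \<phi>: "w = T *v \<phi>" using w by blast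
    obtain \<psi> where \<psi>: "\<phi> = transpose A *v \<psi>" using tr_surj[OF A(1)] by blast
    have "A *v w = (A ** T ** transpose A) *v \<psi>"
      by (simp only: \<phi> \<psi> matrix_vector_mul_assoc matrix_mul_assoc)
    then show ?thesis using A(2) by simp
  qed
  have surj: "surj ((*v) x)" "surj ((*v) y)" using irr unfolding irreducible_pair_def by auto
  have "\<exists>\<phi>. T *v \<phi> \<noteq> 0"
  proof (rule ccontr)
    assume "\<not> (\<exists>\<phi>. T *v \<phi> \<noteq> 0)"
    then have "T *v \<phi> = 0 *v \<phi>" for \<phi> by simp
    then have "T = 0" by (simp add: matrix_eq)
    then have "t = 0" by (auto simp: T_def vec_eq_iff)
    then show False using t(2) by simp
  qed
  then obtain \<phi> where "T *v \<phi> \<noteq> 0" by blast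
  moreover have "vec.subspace (range ((*v) T))"
    by (rule module_hom.subspace_image[OF matrix_vector_mul_linear_gen[unfolded linear_iff_module_hom]]) simp
  ultimately have "w \<in> range ((*v) T)" for w
    using irreducible_pairD[OF irr _ range_closed[OF surj(1) T_inv[OF t(3)]]
        range_closed[OF surj(2) T_inv[OF t(4)]] rangeI] by simp
  then have "surj ((*v) T)" by blast
  then obtain S where TS: "T ** S = mat 1" using matrix_right_invertible_surjective by metis
  then have ST: "S ** T = mat 1" by (simp add: matrix_left_right_inverse)
  have S_sym: "transpose S = S"
  proof -
    have "transpose S ** T = transpose (T ** S)" by (simp add: matrix_transpose_mul T_sym)
    then have ST': "transpose S ** T = mat 1" by (simp add: TS)
    have "transpose S = transpose S ** (T ** S)" by (simp add: TS)
    then show ?thesis by (simp add: matrix_mul_assoc ST')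
  qed
  have S_inv: "transpose A ** S ** A = S" if "A ** T ** transpose A = T" for A
  proof -
    \<comment> \<open>Cyclically moving the factor \<open>transpose A\<close> in a product equal to
      1 turns invariance of \<open>T\<close> into invariance of its inverse.\<close>
    have "(S ** A ** T) ** transpose A = S ** (A ** T ** transpose A)" by (simp add: matrix_mul_assoc)
    then have "(S ** A ** T) ** transpose A = mat 1" by (simp add: that ST)
    then have "transpose A ** (S ** A ** T) = mat 1" by (simp add: matrix_left_right_inverse)
    then have eq: "(transpose A ** S ** A) ** T = mat 1" by (simp add: matrix_mul_assoc)
    have "transpose A ** S ** A = (transpose A ** S ** A) ** (T ** S)" by (simp add: TS)
    also have "\<dots> = ((transpose A ** S ** A) ** T) ** S" by (simp only: matrix_mul_assoc)
    finally show ?thesis by (simp add: eq)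
  qed
  define \<beta> where "\<beta> u v = (\<Sum>i\<in>UNIV. \<Sum>j\<in>UNIV. u $ i * S $ i $ j * v $ j)" for u v
  have \<beta>_inv: "\<beta> (A *v u) (A *v v) = \<beta> u v" if "A ** T ** transpose A = T" for A u v
  proof -
    have dot: "\<beta> u v = (\<Sum>i\<in>UNIV. u $ i * (S *v v) $ i)" for u v
      by (simp add: \<beta>_def matrix_vector_mult_def sum_distrib_left mult_ac)
    have "\<beta> (A *v u) (A *v v) = (\<Sum>i\<in>UNIV. (A *v u) $ i * ((S ** A) *v v) $ i)"
      by (simp add: dot matrix_vector_mul_assoc)
    also have "\<dots> = (\<Sum>i\<in>UNIV. \<Sum>j\<in>UNIV. u $ j * (A $ i $ j * ((S ** A) *v v) $ i))"
      by (simp add: matrix_vector_mult_def[of A] sum_distrib_left mult_ac)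
    also have "\<dots> = (\<Sum>j\<in>UNIV. u $ j * (transpose A *v ((S ** A) *v v)) $ j)"
    proof -
      have "(transpose A *v w) $ j = (\<Sum>i\<in>UNIV. A $ i $ j * w $ i)" for w j
        unfolding matrix_vector_mult_def transpose_def by simp
      then show ?thesis by (subst sum.swap) (simp add: sum_distrib_left del: transpose_matrix_vector)
    qed
    also have "\<dots> = \<beta> u v"
      using S_inv[OF that] by (simp add: dot matrix_vector_mul_assoc matrix_mul_assoc del: transpose_matrix_vector)
    finally show ?thesis .
  qed
  have "invariant_sym_form x y \<beta>"
    unfolding invariant_sym_form_def
  proof (intro conjI allI)
    show "\<beta> (u + u') v = \<beta> u v + \<beta> u' v" for u u' v by (simp add: \<beta>_def algebra_simps sum.distrib)
    show "\<beta> (c *s u) v = c * \<beta> u v" for c u v by (simp add: \<beta>_def sum_distrib_left mult_ac)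
    have "S $ i $ j = S $ j $ i" for i j using S_sym by (metis transpose_def vec_lambda_beta)
    then show "\<beta> u v = \<beta> v u" for u v
      unfolding \<beta>_def by (subst sum.swap) (simp add: mult_ac)
  qed (use \<beta>_inv T_inv t in auto)
  moreover have "\<exists>u v. \<beta> u v \<noteq> 0"
  proof -
    have "S \<noteq> 0" 
    proof
      assume "S = 0"
      then have "(T ** S) $ i $ j = 0" for i j by (simp add: matrix_matrix_mult_def)
      from this[of undefined undefined] show False unfolding TS by (simp add: mat_def)
    qed
    then obtain i j where "S $ i $ j \<noteq> 0" by (auto simp: vec_eq_iff)
    moreover have "\<beta> (axis i 1) (axis j 1) = S $ i $ j"
      by (simp add: \<beta>_def axis_def if_distrib[of "\<lambda>c. c * _"] if_distrib[of "\<lambda>c. _ * c"] cong: if_cong)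
    ultimately show ?thesis by metis
  qed
  ultimately show thesis by (rule that)
qed

section \<open>From Scott's dichotomy to forms on the space itself\<close>

lemma sum_product3:
  fixes g :: "'i \<Rightarrow> 'a::comm_ring"
  shows "(\<Sum>i\<in>I. g i) * (\<Sum>j\<in>J. h j) * (\<Sum>k\<in>K. m k) = (\<Sum>i\<in>I. \<Sum>j\<in>J. \<Sum>k\<in>K. g i * h j * m k)"
proof -
  have "(\<Sum>i\<in>I. \<Sum>j\<in>J. \<Sum>k\<in>K. g i * h j * m k) = (\<Sum>i\<in>I. \<Sum>j\<in>J. g i * h j * (\<Sum>k\<in>K. m k))"
    by (simp only: sum_distrib_left)
  also have "\<dots> = (\<Sum>i\<in>I. \<Sum>j\<in>J. g i * h j) * (\<Sum>k\<in>K. m k)"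
    by (simp only: sum_distrib_right)
  finally show ?thesis by (simp only: sum_product)
qed

lemma sum_swap3:
  "(\<Sum>i\<in>I. \<Sum>j\<in>J. \<Sum>k\<in>K. \<Sum>a\<in>A. H i j k a) = (\<Sum>a\<in>A. \<Sum>i\<in>I. \<Sum>j\<in>J. \<Sum>k\<in>K. H i j k a)"
proof -
  have "(\<Sum>i\<in>I. \<Sum>j\<in>J. \<Sum>k\<in>K. \<Sum>a\<in>A. H i j k a) = (\<Sum>i\<in>I. \<Sum>j\<in>J. \<Sum>a\<in>A. \<Sum>k\<in>K. H i j k a)"
    by (intro sum.cong refl sum.swap)
  also have "\<dots> = (\<Sum>i\<in>I. \<Sum>a\<in>A. \<Sum>j\<in>J. \<Sum>k\<in>K. H i j k a)"
    by (intro sum.cong refl sum.swap)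
  also have "\<dots> = (\<Sum>a\<in>A. \<Sum>i\<in>I. \<Sum>j\<in>J. \<Sum>k\<in>K. H i j k a)" by (rule sum.swap)
  finally show ?thesis .
qed

text \<open>A tensor is turned into a form by inversion. A functional gives a quadratic form
  \<open>q\<close> with polar form \<open>\<beta>\<close>. In characteristic 2 the polar form
  vanishes, which makes \<open>q\<close> additive, so that irreducibility forces \<open>q\<close> to
  vanish as well.\<close>

lemma invariant_sym_form_exists:
  fixes x y :: "'a::alg_closed_field^7^7"
  assumes irr: "irreducible_pair x y"
    and x: "spanning_action x perm_x (\<lambda>i. if i = 0 then -1 else 1) 1 bx"
    and y: "spanning_action y perm_y (\<lambda>_. 1) 2 by"
    and z: "spanning_action (x ** y) perm_z (\<lambda>_. 1) 6 bz"
  shows "(2 :: 'a) \<noteq> 0 \<and> (\<exists>\<beta>. invariant_sym_form x y \<beta> \<and> (\<exists>u v. \<beta> u v \<noteq> 0))"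
proof -
  have no_form: "\<beta> u v = 0" if two: "(2 :: 'a) = 0" and \<beta>: "invariant_sym_form x y \<beta>" for \<beta> u v
  proof -
    have "(7 :: 'a) = 2 * 3 + 1" by simp
    then have seven: "(7 :: 'a) \<noteq> 0" using two by simp
    obtain \<zeta> :: 'a where \<zeta>: "\<zeta> ^ 7 = 1" "\<zeta> \<noteq> 1" using primitive_7th_root_exists[OF seven] by blast
    obtain b where b: "indexed_basis {-3..3} b"
      "\<And>i. i \<in> {-3..3} \<Longrightarrow> (x ** y) *v b i = \<zeta> ^ nat (i mod 7) *s b i"
      using eigenbasis_of_7_cycle[OF z \<zeta> seven] by blast
    show ?thesis by (rule invariant_sym_form_char_2[OF irr \<beta> two \<zeta> b])
  qed
  consider t where "t \<in> sym_tensors" "t \<noteq> 0" "tensor2_map x t = t" "tensor2_map y t = t"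
    | l where "Vector_Spaces.linear (*s) (*) l" "\<exists>t\<in>sym_tensors. l t \<noteq> 0"
      "\<forall>t\<in>sym_tensors. l (tensor2_map x t) = l t \<and> l (tensor2_map y t) = l t"
    using sym_dichotomy[OF _ x y z] by auto
  then show ?thesis
  proof cases
    case 1
    then obtain \<beta> where "invariant_sym_form x y \<beta>" "\<exists>u v. \<beta> u v \<noteq> 0"
      using invariant_sym_form_of_tensor[OF irr 1] by blast
    then show ?thesis using no_form by blast
  next
    case 2
    interpret l: Vector_Spaces.linear "(*s)" "(*)" l by (fact 2(1))
    define \<beta> where "\<beta> u v = l (polar_tensor u v)" for u v
    define q where "q u = l (square_tensor u)" for u
    have l_inv: "l (tensor2_map x t) = l t" "l (tensor2_map y t) = l t" if "t \<in> sym_tensors" for t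
      using 2(3) that by simp_all
    have \<beta>: "invariant_sym_form x y \<beta>"
      unfolding invariant_sym_form_def
    proof (intro conjI allI)
      show "\<beta> (u + u') v = \<beta> u v + \<beta> u' v" for u u' v by (simp add: \<beta>_def polar_tensor_add1 l.add)
      show "\<beta> (c *s u) v = c * \<beta> u v" for c u v by (simp add: \<beta>_def polar_tensor_scale1 l.scale)
      show "\<beta> u v = \<beta> v u" for u v unfolding \<beta>_def polar_tensor_commute[of u v] ..
      show "\<beta> (x *v u) (x *v v) = \<beta> u v" "\<beta> (y *v u) (y *v v) = \<beta> u v" for u v
        unfolding \<beta>_def tensor2_map_polar[symmetric] by (simp_all add: l_inv polar_in_sym_tensors)
    qed
    have q_inv: "q (x *v u) = q u" "q (y *v u) = q u" for u
      unfolding q_def tensor2_map_square[symmetric] by (simp_all add: l_inv square_in_sym_tensors)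
    have ker: "vec.subspace {t. l t = 0}" by (rule l.subspace_kernel)
    have q_nz: "\<exists>u. q u \<noteq> 0" if "\<And>u v. \<beta> u v = 0"
    proof (rule ccontr)
      assume "\<nexists>u. q u \<noteq> 0"
      then have "sym_tensors \<subseteq> {t. l t = 0}"
        using that by (intro sym_tensors_subset[OF ker, of UNIV]) (auto simp: \<beta>_def q_def)
      then show False using 2(2) by blast
    qed
    have dbl: "\<beta> u u = 2 * q u" for u
    proof -
      have "polar_tensor u u = 2 *s square_tensor u"
        by (simp add: polar_tensor_def square_tensor_def vec_eq_iff)
      then show ?thesis by (simp add: \<beta>_def q_def l.scale)
    qed
    have two: "(2 :: 'a) \<noteq> 0"
    proof
      assume two: "(2 :: 'a) = 0"
      have \<beta>0: "\<beta> u v = 0" for u v by (rule no_form[OF two \<beta>])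
      have "(7 :: 'a) = 2 * 3 + 1" by simp
      then have seven: "(7 :: 'a) \<noteq> 0" using two by simp
      obtain \<zeta> :: 'a where \<zeta>: "\<zeta> ^ 7 = 1" "\<zeta> \<noteq> 1" using primitive_7th_root_exists[OF seven] by blast
      obtain b where b: "indexed_basis {-3..3} b"
        "\<And>i. i \<in> {-3..3} \<Longrightarrow> (x ** y) *v b i = \<zeta> ^ nat (i mod 7) *s b i"
        using eigenbasis_of_7_cycle[OF z \<zeta> seven] by blast
      have q_add: "q (u + v) = q u + q v" for u v
        using \<beta>0[of u v] by (simp add: q_def \<beta>_def square_tensor_add l.add)
      have q_scale: "q (c *s u) = c * c * q u" for c u
        by (simp add: q_def square_tensor_scale l.scale)
      \<comment> \<open>Although \<open>q\<close> scales by squares and is not linear, additivity is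
        enough for its zero set to be a subspace.\<close>
      have W: "vec.subspace {u. q u = 0}"
        using q_scale[of 0 0] by (intro vec.subspaceI) (auto simp: q_add q_scale)
      \<comment> \<open>Invariance multiplies \<open>q (b 1)\<close> by the square of
        \<open>\<zeta>\<close>, which is not 1; this gives a nonzero zero of
        \<open>q\<close>.\<close>
      have "q (b 1) = q ((x ** y) *v b 1)" by (simp add: q_inv flip: matrix_vector_mul_assoc)
      also have "\<dots> = \<zeta> ^ 2 * q (b 1)" by (simp add: b(2) q_scale power2_eq_square)
      finally have "q (b 1) = 0" using power_eq_1_iff_7_dvd[OF \<zeta>, of 2] by simp
      moreover have "b 1 \<noteq> 0"
        by (rule indexed_basis_nonzero[OF b(1)]) simp
      ultimately have "u \<in> {u. q u = 0}" for u
        using irreducible_pairD[OF irr W, of "b 1" u] by (simp add: q_inv)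
      then show False using q_nz \<beta>0 by blast
    qed
    \<comment> \<open>When 2 is invertible, \<open>q\<close> is half of \<open>\<beta>\<close> on
      the diagonal, so \<open>\<beta> = 0\<close> would annihilate the functional.\<close>
    moreover have "\<exists>u v. \<beta> u v \<noteq> 0"
    proof (rule ccontr)
      assume "\<nexists>u v. \<beta> u v \<noteq> 0"
      then have "\<beta> u v = 0" for u v by blast
      then show False using q_nz dbl two by (metis mult_eq_0_iff)
    qed
    ultimately show ?thesis using \<beta> by blast
  qed
qed

text \<open>An alternating tensor is a trilinear form on the dual space; it is pulled back along the
  identification of the space with its dual given by \<open>\<beta>\<close>.\<close>

lemma invariant_trilinear_form_of_tensor:
  fixes x y :: "'a::field^'n^'n"
  assumes irr: "irreducible_pair x y" and two: "(2 :: 'a) \<noteq> 0"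
    and \<beta>: "invariant_sym_form x y \<beta>" "\<exists>u v. \<beta> u v \<noteq> 0"
    and t: "t \<in> alt_tensors" "t \<noteq> 0" "tensor3_map x t = t" "tensor3_map y t = t"
  shows "\<exists>f. alternating_trilinear f \<and> (\<exists>u v w. f u v w \<noteq> 0) \<and>
    (\<forall>A\<in>{x, y}. \<forall>u v w. f (A *v u) (A *v v) (A *v w) = f u v w)"
proof -
  note add = invariant_sym_formD(1)[OF \<beta>(1)] and scale = invariant_sym_formD(2)[OF \<beta>(1)]
    and comm = invariant_sym_formD(3)[OF \<beta>(1)]
    and add2 = invariant_sym_formD(6)[OF \<beta>(1)] and scale2 = invariant_sym_formD(7)[OF \<beta>(1)]
  have inv: "\<beta> (A *v u) (A *v v) = \<beta> u v" if "A \<in> {x, y}" for A u v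
    using that invariant_sym_formD(4,5)[OF \<beta>(1)] by auto
  have \<beta>_sum: "\<beta> (\<Sum>i\<in>I. g i) v = (\<Sum>i\<in>I. \<beta> (g i) v)" for I and g :: "'i \<Rightarrow> 'a^'n" and v
  proof (induction I rule: infinite_finite_induct)
    case empty
    then show ?case using scale[of 0 0 v] by simp
  next
    case infinite
    then show ?case using scale[of 0 0 v] by simp
  qed (simp add: add)
  define c where "c i u = \<beta> (axis i 1) u" for i u
  have c_add: "c i (u + v) = c i u + c i v" and c_scale: "c i (a *s u) = a * c i u" for i u v a
    by (simp_all add: c_def add2 scale2)
  \<comment> \<open>The left side is \<open>\<beta> (A e_a) (A u)\<close> expanded in the standard
    basis, so invariance of \<open>\<beta>\<close> lets \<open>A\<close> cancel.\<close>
  have c_inv: "(\<Sum>i\<in>UNIV. A $ i $ a * c i (A *v u)) = c a u" if "A \<in> {x, y}" for A a u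
  proof -
    have "A *v axis a 1 = (\<Sum>i\<in>UNIV. A $ i $ a *s axis i 1)"
      by (simp add: vec_eq_iff matrix_vector_mult_def axis_def if_distrib cong: if_cong)
    then have "\<beta> (A *v axis a 1) (A *v u) = (\<Sum>i\<in>UNIV. A $ i $ a * c i (A *v u))"
      by (simp add: \<beta>_sum scale c_def)
    then show ?thesis using inv[OF that, of "axis a 1" u] by (simp add: c_def)
  qed
  define f where "f u v w = (\<Sum>i\<in>UNIV. \<Sum>j\<in>UNIV. \<Sum>k\<in>UNIV. t $ (i, j, k) * c i u * c j v * c k w)" for u v w
  have lin: "Vector_Spaces.linear (*s) (*) (\<lambda>u. f u v w)" "Vector_Spaces.linear (*s) (*) (\<lambda>u. f v u w)"
    "Vector_Spaces.linear (*s) (*) (\<lambda>u. f v w u)" for v w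
    by (unfold_locales; simp add: f_def c_add c_scale algebra_simps sum.distrib sum_distrib_left)+
  \<comment> \<open>Antisymmetry of the coordinates yields an alternating form only because 2 is
    invertible.\<close>
  have half: "a = 0" if "a = - a" for a :: 'a
  proof -
    have "2 * a = 0" using that by (metis add.right_inverse mult_2)
    then show ?thesis using two by simp
  qed
  have swap: "f v u w = - f u v w" "f u w v = - f u v w" for u v w
  proof -
    have "f v u w = (\<Sum>i\<in>UNIV. \<Sum>j\<in>UNIV. \<Sum>k\<in>UNIV. t $ (j, i, k) * c j v * c i u * c k w)"
      unfolding f_def by (rule sum.swap)
    also have "\<dots> = (\<Sum>i\<in>UNIV. \<Sum>j\<in>UNIV. \<Sum>k\<in>UNIV. - (t $ (i, j, k) * c i u * c j v * c k w))"
    proof (intro sum.cong refl)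
      fix i j k
      show "t $ (j, i, k) * c j v * c i u * c k w = - (t $ (i, j, k) * c i u * c j v * c k w)"
        using alt_tensors_antisym(1)[OF t(1), of j i k] by simp
    qed
    also have "\<dots> = - f u v w" by (simp add: f_def sum_negf)
    finally show "f v u w = - f u v w" .
    have "f u w v = (\<Sum>i\<in>UNIV. \<Sum>j\<in>UNIV. \<Sum>k\<in>UNIV. t $ (i, k, j) * c i u * c k w * c j v)"
      unfolding f_def by (intro sum.cong refl sum.swap)
    also have "\<dots> = (\<Sum>i\<in>UNIV. \<Sum>j\<in>UNIV. \<Sum>k\<in>UNIV. - (t $ (i, j, k) * c i u * c j v * c k w))"
    proof (intro sum.cong refl)
      fix i j k
      show "t $ (i, k, j) * c i u * c k w * c j v = - (t $ (i, j, k) * c i u * c j v * c k w)"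
        using alt_tensors_antisym(2)[OF t(1), of i k j] by simp
    qed
    also have "\<dots> = - f u v w" by (simp add: f_def sum_negf)
    finally show "f u w v = - f u v w" .
  qed
  have "f u u v = 0" "f v u u = 0" for u v using half swap by blast+
  moreover from this have "f u v u = 0" for u v using swap(1)[of u v u] by (metis neg_equal_0_iff_equal swap(2))
  ultimately have "alternating_trilinear f" unfolding alternating_trilinear_def using lin by blast
  moreover have "f (A *v u) (A *v v) (A *v w) = f u v w" if A: "A \<in> {x, y}" for A u v w
  proof -
    have tA: "t $ (i, j, k) = (\<Sum>a\<in>UNIV. \<Sum>b\<in>UNIV. \<Sum>d\<in>UNIV. A $ i $ a * A $ j $ b * A $ k $ d * t $ (a, b, d))" for i j k
    proof -
      have "tensor3_map A t $ (i, j, k) = t $ (i, j, k)" using A t(3,4) by auto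
      then show ?thesis by (simp add: tensor3_map_def)
    qed
    define F where "F i j k a b d = A $ i $ a * A $ j $ b * A $ k $ d * t $ (a, b, d) * c i (A *v u) * c j (A *v v) * c k (A *v w)"
      for i j k a b d
    have "f (A *v u) (A *v v) (A *v w) = (\<Sum>i\<in>UNIV. \<Sum>j\<in>UNIV. \<Sum>k\<in>UNIV. \<Sum>a\<in>UNIV. \<Sum>b\<in>UNIV. \<Sum>d\<in>UNIV. F i j k a b d)"
      unfolding f_def F_def by (subst tA) (simp only: sum_distrib_right)
    \<comment> \<open>With the sums over \<open>i, j, k\<close> innermost, each summand splits into
      three factors to which \<open>c_inv\<close> applies.\<close>
    also have "\<dots> = (\<Sum>a\<in>UNIV. \<Sum>b\<in>UNIV. \<Sum>d\<in>UNIV. \<Sum>i\<in>UNIV. \<Sum>j\<in>UNIV. \<Sum>k\<in>UNIV. F i j k a b d)"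
      by (simp only: sum_swap3[where A = UNIV and H = "\<lambda>i j k a. \<Sum>b\<in>UNIV. \<Sum>d\<in>UNIV. F i j k a b d"]
          sum_swap3[where A = UNIV and H = "\<lambda>i j k b. \<Sum>d\<in>UNIV. F i j k _ b d"]
          sum_swap3[where A = UNIV and H = "\<lambda>i j k d. F i j k _ _ d"])
    also have "\<dots> = (\<Sum>a\<in>UNIV. \<Sum>b\<in>UNIV. \<Sum>d\<in>UNIV. t $ (a, b, d) *
        (\<Sum>i\<in>UNIV. A $ i $ a * c i (A *v u)) * (\<Sum>j\<in>UNIV. A $ j $ b * c j (A *v v)) * (\<Sum>k\<in>UNIV. A $ k $ d * c k (A *v w)))"
    proof (intro sum.cong refl)
      fix a b d
      show "(\<Sum>i\<in>UNIV. \<Sum>j\<in>UNIV. \<Sum>k\<in>UNIV. F i j k a b d) = t $ (a, b, d) *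
        (\<Sum>i\<in>UNIV. A $ i $ a * c i (A *v u)) * (\<Sum>j\<in>UNIV. A $ j $ b * c j (A *v v)) * (\<Sum>k\<in>UNIV. A $ k $ d * c k (A *v w))"
        unfolding sum_distrib_left[of "t $ (a, b, d)"] sum_product3 F_def by (simp add: mult_ac)
    qed
    also have "\<dots> = f u v w" unfolding c_inv[OF A] f_def ..
    finally show ?thesis .
  qed
  moreover have "\<exists>u v w. f u v w \<noteq> 0"
  proof -
    \<comment> \<open>Nondegeneracy of \<open>\<beta>\<close> makes
      \<open>u \<mapsto> \<beta> (e_i) u\<close> a bijection onto coordinate vectors, so every entry
      of \<open>t\<close> occurs as a value of \<open>f\<close>.\<close>
    let ?c = "\<lambda>u. \<chi> i. c i u"
    have "Vector_Spaces.linear (*s) (*s) ?c" by unfold_locales (simp_all add: vec_eq_iff c_add c_scale)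
    moreover have "inj ?c"
    proof (rule injI)
      fix u v assume uv: "?c u = ?c v"
      have "\<beta> w (u - v) = 0" for w
      proof -
        have "\<beta> (\<Sum>i\<in>UNIV. w $ i *s axis i 1) u = \<beta> (\<Sum>i\<in>UNIV. w $ i *s axis i 1) v"
          using uv by (simp add: \<beta>_sum scale vec_eq_iff flip: c_def)
        moreover have "(\<Sum>i\<in>UNIV. w $ i *s axis i 1) = w"
          by (simp add: vec_eq_iff axis_def if_distrib cong: if_cong)
        ultimately have "\<beta> w u = \<beta> w v" by simp
        then show ?thesis using add2[of w "u - v" v] by simp
      qed
      then have "\<beta> (u - v) w = 0" for w using comm by simp
      then have "u - v = 0" using invariant_sym_form_radical[OF irr \<beta>(1)] \<beta>(2) by blast
      then show "u = v" by simp
    qed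
    ultimately have surj: "surj ?c" by (rule vec.linear_inj_imp_surj)
    obtain p where "t $ p \<noteq> 0" using t(2) by (auto simp: vec_eq_iff)
    then obtain i j k where ijk: "t $ (i, j, k) \<noteq> 0" by (cases p) auto
    obtain u where "axis i 1 = ?c u" using surj by (metis surjD)
    moreover obtain v where "axis j 1 = ?c v" using surj by (metis surjD)
    moreover obtain w where "axis k 1 = ?c w" using surj by (metis surjD)
    ultimately have cu: "c a u = (if a = i then 1 else 0)" and cv: "c a v = (if a = j then 1 else 0)"
      and cw: "c a w = (if a = k then 1 else 0)" for a
      by (auto simp: vec_eq_iff axis_def)
    have "f u v w = t $ (i, j, k)" unfolding f_def cu cv cw by (simp add: mult_delta_right)
    then show ?thesis using ijk by metis
  qed
  ultimately show ?thesis by blast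
qed

text \<open>An invariant functional is directly a trilinear form through
  \<open>wedge_tensor\<close>; only an invariant tensor has to pass through
  \<open>\<beta>\<close>.\<close>

lemma invariant_trilinear_form_exists:
  fixes x y :: "'a::alg_closed_field^7^7"
  assumes irr: "irreducible_pair x y"
    and x: "spanning_action x perm_x (\<lambda>i. if i = 0 then -1 else 1) 1 bx"
    and y: "spanning_action y perm_y (\<lambda>_. 1) 2 by"
    and z: "spanning_action (x ** y) perm_z (\<lambda>_. 1) 6 bz"
  shows "\<exists>f. alternating_trilinear f \<and> (\<exists>u v w. f u v w \<noteq> 0) \<and>
    (\<forall>A\<in>{x, y}. \<forall>u v w. f (A *v u) (A *v v) (A *v w) = f u v w)"
proof -
  obtain \<beta> where two: "(2 :: 'a) \<noteq> 0" and \<beta>: "invariant_sym_form x y \<beta>" "\<exists>u v. \<beta> u v \<noteq> 0"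
    using invariant_sym_form_exists[OF irr x y z] by blast
  consider t where "t \<in> alt_tensors" "t \<noteq> 0" "tensor3_map x t = t" "tensor3_map y t = t"
    | l where "Vector_Spaces.linear (*s) (*) l" "\<exists>t\<in>alt_tensors. l t \<noteq> 0"
      "\<forall>t\<in>alt_tensors. l (tensor3_map x t) = l t \<and> l (tensor3_map y t) = l t"
    using alt_dichotomy[OF _ x y z] by auto
  then show ?thesis
  proof cases
    case 1
    then show ?thesis by (rule invariant_trilinear_form_of_tensor[OF irr two \<beta>])
  next
    case 2
    interpret l: Vector_Spaces.linear "(*s)" "(*)" l by (fact 2(1))
    let ?f = "\<lambda>u v w. l (wedge_tensor u v w)"
    have "alternating_trilinear ?f"
      unfolding alternating_trilinear_def
    proof (intro conjI allI)
      show "Vector_Spaces.linear (*s) (*) (\<lambda>u. ?f u v w)" "Vector_Spaces.linear (*s) (*) (\<lambda>u. ?f v u w)"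
        "Vector_Spaces.linear (*s) (*) (\<lambda>u. ?f v w u)" for v w
        by (unfold_locales; simp add: wedge_tensor_add1 wedge_tensor_scale1 wedge_tensor_add2
            wedge_tensor_scale2 wedge_tensor_add3 wedge_tensor_scale3 l.add l.scale)+
    qed (simp_all add: wedge_tensor_self wedge_tensor_self' l.zero)
    moreover have "\<exists>u v w. ?f u v w \<noteq> 0"
    proof (rule ccontr)
      assume "\<nexists>u v w. ?f u v w \<noteq> 0"
      then have "alt_tensors \<subseteq> {t. l t = 0}"
        by (intro alt_tensors_subset[OF l.subspace_kernel, of UNIV]) auto
      then show False using 2(2) by blast
    qed
    moreover have "?f (A *v u) (A *v v) (A *v w) = ?f u v w" if "A \<in> {x, y}" for A u v w
      using that 2(3) wedge_in_alt_tensors by (auto simp flip: tensor3_map_wedge)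
    ultimately show ?thesis by blast
  qed
qed

lemma weighted_basisI:
  assumes alt: "alternating_trilinear f" and b: "indexed_basis {-3..3} b"
    and vanish: "\<And>i j k. i \<in> {-3..3} \<Longrightarrow> j \<in> {-3..3} \<Longrightarrow> k \<in> {-3..3} \<Longrightarrow> i < j \<Longrightarrow> j < k \<Longrightarrow>
      \<not> 7 dvd i + j + k \<Longrightarrow> f (b i) (b j) (b k) = 0"
  shows "weighted_basis f b"
  unfolding weighted_basis_def
proof (intro conjI ballI impI b)
  interpret alternating_form f using alt by unfold_locales
  fix i j k :: int
  assume ijk: "i \<in> {-3..3}" "j \<in> {-3..3}" "k \<in> {-3..3}" and nz: "f (b i) (b j) (b k) \<noteq> 0"
  have vanish': "f (b p) (b q) (b r) = 0" if "p < q" "q < r" "{p, q, r} = {i, j, k}" "p + q + r = i + j + k"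
    "\<not> 7 dvd i + j + k" for p q r
  proof (rule vanish)
    have "p \<in> {i, j, k}" "q \<in> {i, j, k}" "r \<in> {i, j, k}" using that(3) by blast+
    then show "p \<in> {-3..3}" "q \<in> {-3..3}" "r \<in> {-3..3}" using ijk by blast+
  qed (use that in simp_all)
  have ne: "i \<noteq> j" "i \<noteq> k" "j \<noteq> k" using nz by auto
  show "7 dvd i + j + k"
  proof (rule ccontr)
    assume n: "\<not> 7 dvd i + j + k"
    consider "i < j" "j < k" | "i < k" "k < j" | "j < i" "i < k" | "j < k" "k < i" | "k < i" "i < j" | "k < j" "j < i"
      using ne by linarith
    then have "f (b i) (b j) (b k) = 0"
    proof cases
      case 1
      then show ?thesis using vanish'[of i j k] n by simp
    next
      case 2
      then show ?thesis using vanish'[of i k j] n swap(2)[of "b i" "b k" "b j"] by (simp add: insert_commute)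
    next
      case 3
      then show ?thesis using vanish'[of j i k] n swap(1)[of "b i" "b j" "b k"] by (simp add: insert_commute)
    next
      case 4
      then show ?thesis using vanish'[of j k i] n rotate(1)[of "b j" "b k" "b i"] by (simp add: insert_commute)
    next
      case 5
      then show ?thesis using vanish'[of k i j] n rotate(2)[of "b k" "b i" "b j"] by (simp add: insert_commute)
    next
      case 6
      then show ?thesis using vanish'[of k j i] n swap(3)[of "b i" "b j" "b k"] by (simp add: insert_commute)
    qed
    then show False using nz by simp
  qed
qed

subsection \<open>Forms graded by the eigenspaces of an element of order 3\<close>

text \<open>The exponent of the eigenvalue of \<open>y\<close> at index \<open>i\<close>. The
  indices are distributed so that the five index triples of a Dickson form have total weight 0 or
  3.\<close>

definition y_weight :: "int \<Rightarrow> nat" where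
  "y_weight i = (if i = 2 \<or> i = 3 then 1 else if i = -2 \<or> i = -3 then 2 else 0)"

definition graded_basis :: "'a::field^7^7 \<Rightarrow> 'a \<Rightarrow> (int \<Rightarrow> 'a^7) \<Rightarrow> bool" where
  "graded_basis y \<omega> b \<longleftrightarrow> indexed_basis {-3..3} b \<and> (\<forall>i\<in>{-3..3}. y *v b i = \<omega> ^ y_weight i *s b i)"

text \<open>A Fourier transform of length 3 on each 3-cycle of \<open>y\<close>, together with the
  fixed vector \<open>w 0\<close>, gives eigenspaces of dimensions 3, 2 and 2.\<close>

lemma graded_basis_exists:
  fixes y :: "'a::field^7^7"
  assumes y: "spanning_action y perm_y (\<lambda>_. 1) 2 w"
    and \<omega>: "\<omega> * \<omega> = - 1 - \<omega>" and three: "(3 :: 'a) \<noteq> 0"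
  obtains b where "graded_basis y \<omega> b"
proof -
  have yw: "y *v w 0 = w 0" "y *v w 1 = w 2" "y *v w 2 = w 3" "y *v w 3 = w 1"
    "y *v w 4 = w 5" "y *v w 5 = w 6" "y *v w 6 = w 4"
    using y unfolding spanning_action_def all_less_7 by simp_all
  obtain \<omega>' where \<omega>': "\<omega>' = - 1 - \<omega>" by blast
  have mult: "\<omega> * \<omega> = \<omega>'" "\<omega> * \<omega>' = 1" "\<omega>' * \<omega> = 1" "\<omega>' * \<omega>' = \<omega>" and sum0: "1 + \<omega> + \<omega>' = 0"
    using \<omega> \<omega>' by algebra+
  \<comment> \<open>On a 3-cycle \<open>u, v, s\<close> the combinations \<open>u + v + s\<close>,
    \<open>p\<close>, \<open>q\<close> are eigenvectors for 1, \<open>\<omega>\<close> and its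
    square \<open>\<omega>'\<close>.\<close>
  define p where "p u v s = u + \<omega>' *s v + \<omega> *s s" for u v s :: "'a^7"
  define q where "q u v s = u + \<omega> *s v + \<omega>' *s s" for u v s :: "'a^7"
  define b :: "int \<Rightarrow> 'a^7" where "b i = (if i = 0 then w 0 else if i = 1 then w 1 + w 2 + w 3
    else if i = -1 then w 4 + w 5 + w 6 else if i = 2 then p (w 1) (w 2) (w 3)
    else if i = 3 then p (w 4) (w 5) (w 6) else if i = -2 then q (w 1) (w 2) (w 3) else q (w 4) (w 5) (w 6))" for i
  have eig_p: "y *v p u v s = \<omega> *s p u v s" and eig_q: "y *v q u v s = \<omega>' *s q u v s"
    if "y *v u = v" "y *v v = s" "y *v s = u" for u v s
    using that by (simp_all add: p_def q_def vec.add vec.scale vec.scale_right_distrib mult add_ac)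
  have \<omega>2: "\<omega>\<^sup>2 = \<omega>'" using mult(1) by (simp add: power2_eq_square)
  have eig: "y *v b i = \<omega> ^ y_weight i *s b i" if "i \<in> {-3..3}" for i
  proof -
    have "i = 0 \<or> i = 1 \<or> i = -1 \<or> i = 2 \<or> i = 3 \<or> i = -2 \<or> i = -3" using that by simp presburger
    then show ?thesis
      by (elim disjE) (simp_all add: b_def y_weight_def eig_p eig_q \<omega>2 yw[simplified] vec.add add_ac)
  qed
  \<comment> \<open>Inverse Fourier transform, based on
    \<open>1 + \<omega> + \<omega>' = 0\<close>.\<close>
  have rec: "3 *s u = (u + v + s) + p u v s + q u v s" "3 *s v = (u + v + s) + \<omega> *s p u v s + \<omega>' *s q u v s"
    "3 *s s = (u + v + s) + \<omega>' *s p u v s + \<omega> *s q u v s" for u v s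
  proof -
    have "3 * a = (a + b + c) + (a + \<omega>' * b + \<omega> * c) + (a + \<omega> * b + \<omega>' * c)"
      "3 * b = (a + b + c) + \<omega> * (a + \<omega>' * b + \<omega> * c) + \<omega>' * (a + \<omega> * b + \<omega>' * c)"
      "3 * c = (a + b + c) + \<omega>' * (a + \<omega>' * b + \<omega> * c) + \<omega> * (a + \<omega> * b + \<omega>' * c)" for a b c
    proof -
      have "(a + b + c) + (a + \<omega>' * b + \<omega> * c) + (a + \<omega> * b + \<omega>' * c)
        = 3 * a + (1 + \<omega> + \<omega>') * b + (1 + \<omega> + \<omega>') * c" by (simp add: algebra_simps)
      then show "3 * a = (a + b + c) + (a + \<omega>' * b + \<omega> * c) + (a + \<omega> * b + \<omega>' * c)" by (simp add: sum0)
      have "(a + b + c) + \<omega> * (a + \<omega>' * b + \<omega> * c) + \<omega>' * (a + \<omega> * b + \<omega>' * c)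
        = (1 + \<omega> + \<omega>') * a + (1 + \<omega> * \<omega>' + \<omega>' * \<omega>) * b + (1 + \<omega>' * \<omega>' + \<omega> * \<omega>) * c"
        by (simp add: algebra_simps)
      then show "3 * b = (a + b + c) + \<omega> * (a + \<omega>' * b + \<omega> * c) + \<omega>' * (a + \<omega> * b + \<omega>' * c)"
        by (simp add: mult sum0)
      have "(a + b + c) + \<omega>' * (a + \<omega>' * b + \<omega> * c) + \<omega> * (a + \<omega> * b + \<omega>' * c)
        = (1 + \<omega> + \<omega>') * a + (1 + \<omega>' * \<omega>' + \<omega> * \<omega>) * b + (1 + \<omega> * \<omega>' + \<omega>' * \<omega>) * c"
        by (simp add: algebra_simps)
      then show "3 * c = (a + b + c) + \<omega>' * (a + \<omega>' * b + \<omega> * c) + \<omega> * (a + \<omega> * b + \<omega>' * c)"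
        by (simp add: mult sum0)
    qed
    then show "3 *s u = (u + v + s) + p u v s + q u v s" "3 *s v = (u + v + s) + \<omega> *s p u v s + \<omega>' *s q u v s"
      "3 *s s = (u + v + s) + \<omega>' *s p u v s + \<omega> *s q u v s"
      by (simp_all only: p_def q_def vec_eq_iff vector_add_component vector_smult_component) blast+
  qed
  let ?M = "vec.span (b ` {-3..3})"
  have inM: "b i \<in> ?M" if "i \<in> {-3..3}" for i using that by (intro vec.span_base imageI)
  have M: "w 1 + w 2 + w 3 \<in> ?M" "w 4 + w 5 + w 6 \<in> ?M" "p (w 1) (w 2) (w 3) \<in> ?M" "p (w 4) (w 5) (w 6) \<in> ?M"
    "q (w 1) (w 2) (w 3) \<in> ?M" "q (w 4) (w 5) (w 6) \<in> ?M" "w 0 \<in> ?M"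
    using inM[of 1] inM[of "-1"] inM[of 2] inM[of 3] inM[of "-2"] inM[of "-3"] inM[of 0]
    by (simp_all add: b_def)
  have third: "v \<in> ?M" if "3 *s v \<in> ?M" for v
  proof -
    have "inverse 3 *s (3 *s v) \<in> ?M" using that by (rule vec.span_scale)
    then show ?thesis using three by simp
  qed
  have triple: "u \<in> ?M" "v \<in> ?M" "s \<in> ?M" if "u + v + s \<in> ?M" "p u v s \<in> ?M" "q u v s \<in> ?M" for u v s
  proof -
    have "3 *s u \<in> ?M" unfolding rec(1)[of u v s] by (intro vec.span_add that)
    then show "u \<in> ?M" by (rule third)
    have "3 *s v \<in> ?M" unfolding rec(2)[of v u s] by (intro vec.span_add vec.span_scale that)
    then show "v \<in> ?M" by (rule third)
    have "3 *s s \<in> ?M" unfolding rec(3)[of s u v] by (intro vec.span_add vec.span_scale that)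
    then show "s \<in> ?M" by (rule third)
  qed
  have "w 1 \<in> ?M" "w 2 \<in> ?M" "w 3 \<in> ?M" "w 4 \<in> ?M" "w 5 \<in> ?M" "w 6 \<in> ?M"
    by (rule triple[OF M(1,3,5)] triple[OF M(2,4,6)])+
  then have "\<forall>k<7. w k \<in> ?M" using M(7) unfolding all_less_7 by blast
  then have "vec.span (w ` {..<7}) \<subseteq> ?M" by (intro vec.span_minimal) auto
  then have "?M = UNIV" using y unfolding spanning_action_def by auto
  then have "indexed_basis {-3..3} b" by (intro indexed_basis_if_spanning) simp_all
  then show thesis using that[of b] eig unfolding graded_basis_def by blast
qed

text \<open>Invariance under \<open>y\<close> multiplies the coefficient by \<open>\<omega>\<close>
  to the total weight, and \<open>\<omega>\<close> is a primitive cube root of unity.\<close>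

lemma graded_basis_zero:
  fixes f :: "'a::field^7 \<Rightarrow> 'a^7 \<Rightarrow> 'a^7 \<Rightarrow> 'a"
  assumes alt: "alternating_trilinear f" and inv: "\<And>u v w. f (y *v u) (y *v v) (y *v w) = f u v w"
    and \<omega>: "\<omega> * \<omega> = - 1 - \<omega>" "\<omega> \<noteq> 1" and b: "graded_basis y \<omega> b"
    and ijk: "i \<in> {-3..3}" "j \<in> {-3..3}" "k \<in> {-3..3}" "\<not> 3 dvd y_weight i + y_weight j + y_weight k"
  shows "f (b i) (b j) (b k) = 0"
proof -
  interpret alternating_form f using alt by unfold_locales
  have eig: "y *v b i = \<omega> ^ y_weight i *s b i" if "i \<in> {-3..3}" for i
    using b that unfolding graded_basis_def by blast
  define n where "n = y_weight i + y_weight j + y_weight k"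
  have "f (b i) (b j) (b k) = \<omega> ^ n * f (b i) (b j) (b k)"
    using inv[of "b i" "b j" "b k"] ijk by (simp add: eig scale power_add mult_ac n_def)
  moreover have "\<omega> ^ n \<noteq> 1"
  proof -
    have "\<omega> * (\<omega> * \<omega>) = 1" using \<omega>(1) by algebra
    then have "\<omega> ^ 3 = 1" by (simp add: power3_eq_cube mult.assoc)
    then have "\<omega> ^ (3 * (n div 3) + n mod 3) = \<omega> ^ (n mod 3)"
      by (simp only: power_add power_mult power_one mult_1)
    then have red: "\<omega> ^ n = \<omega> ^ (n mod 3)" by simp
    have "n mod 3 = 1 \<or> n mod 3 = 2" using ijk(4) unfolding n_def by presburger
    moreover have "\<omega> \<noteq> 1" by (rule \<omega>(2))
    moreover have "\<omega> * \<omega> \<noteq> 1"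
    proof
      assume "\<omega> * \<omega> = 1"
      then have "\<omega> * (\<omega> * \<omega>) = \<omega>" by simp
      then show False using \<open>\<omega> * (\<omega> * \<omega>) = 1\<close> \<omega>(2) by simp
    qed
    ultimately show ?thesis unfolding red by (auto simp: power2_eq_square)
  qed
  ultimately show ?thesis by (metis mult_cancel_right2)
qed

text \<open>An image of dimension at most 3 in a space of dimension 4 lies in a hyperplane;
  \<open>n\<close> is its coefficient vector.\<close>

lemma linear_3_to_4_functional:
  fixes T :: "'a::field^3 \<Rightarrow> 'a^4"
  assumes T: "Vector_Spaces.linear (*s) (*s) T"
  obtains n where "n \<noteq> 0" "\<And>c. (\<Sum>k\<in>UNIV. n $ k * T c $ k) = 0"
proof -
  have sub: "vec.subspace (range T)"
    by (rule module_hom.subspace_image[OF T[unfolded linear_iff_module_hom]]) simp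
  have "vec.dim (range T) \<le> vec.dim (UNIV :: ('a^3) set)" by (rule vec.dim_image_le[OF T])
  then have "vec.dim (range T) < vec.dim (UNIV :: ('a^4) set)" unfolding vec_dim_card by simp
  then have "range T \<noteq> UNIV" by (metis less_irrefl)
  then obtain v where v: "v \<notin> range T" by blast
  obtain l where l: "Vector_Spaces.linear (*s) (*) l" "l v = 1" "\<And>u. u \<in> range T \<Longrightarrow> l u = 0"
    using exists_functional_vanishing_on[OF sub v] by blast
  interpret l: Vector_Spaces.linear "(*s)" "(*)" l by (fact l(1))
  define n where "n = (\<chi> k. l (axis k 1))"
  have l_eq: "l u = (\<Sum>k\<in>UNIV. n $ k * u $ k)" for u
  proof -
    have "l u = l (\<Sum>k\<in>UNIV. u $ k *s axis k 1)"
      by (rule arg_cong[of _ _ l]) (simp add: vec_eq_iff axis_def if_distrib cong: if_cong)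
    then show ?thesis by (simp add: l.sum l.scale n_def mult.commute)
  qed
  show thesis
  proof (rule that[of n])
    show "n \<noteq> 0" using l(2) l_eq[of v] by auto
    show "(\<Sum>k\<in>UNIV. n $ k * T c $ k) = 0" for c using l(3)[of "T c"] l_eq by simp
  qed
qed

text \<open>For injective \<open>T\<close> the image has dimension 3, hence fills the hyperplane
  that contains it.\<close>

lemma linear_3_to_4_range:
  fixes T :: "'a::field^3 \<Rightarrow> 'a^4"
  assumes T: "Vector_Spaces.linear (*s) (*s) T" and inj: "\<And>c. T c = 0 \<Longrightarrow> c = 0"
    and n: "n \<noteq> 0" "\<And>c. (\<Sum>k\<in>UNIV. n $ k * T c $ k) = 0"
    and X: "(\<Sum>k\<in>UNIV. n $ k * X $ k) = 0"
  shows "\<exists>c. T c = X"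
proof -
  interpret T: Vector_Spaces.linear "(*s)" "(*s)" T by (fact T)
  let ?K = "{X. (\<Sum>k\<in>UNIV. n $ k * X $ k) = 0}"
  have sub: "vec.subspace (range T)"
    by (rule module_hom.subspace_image[OF T[unfolded linear_iff_module_hom]]) simp
  have K: "vec.subspace ?K"
    by (rule vec.subspaceI) (simp_all add: algebra_simps sum.distrib sum_distrib_left[symmetric])
  have "inj T" using inj T.inj_iff_eq_0 by blast
  then have "vec.dim (range T) = vec.dim (UNIV :: ('a^3) set)" by (intro vec.dim_image_eq[OF T]) simp
  then have dT: "vec.dim (range T) = 3" unfolding vec_dim_card by simp
  obtain j where "n $ j \<noteq> 0" using n(1) by (auto simp: vec_eq_iff)
  then have "axis j 1 \<notin> ?K" by (simp add: axis_def if_distrib cong: if_cong)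
  then have "?K \<noteq> UNIV" by blast
  then have "vec.dim ?K \<noteq> vec.dim (UNIV :: ('a^4) set)"
    using vec.subspace_dim_equal[OF K vec.subspace_UNIV] by auto
  moreover have "vec.dim ?K \<le> vec.dim (UNIV :: ('a^4) set)" by (rule vec.dim_subset) simp
  ultimately have "vec.dim ?K \<le> 3" unfolding vec_dim_card by simp
  moreover have "range T \<subseteq> ?K" using n(2) by auto
  ultimately have "range T = ?K" using vec.subspace_dim_equal[OF sub K] dT by simp
  then show ?thesis using X by (metis (mono_tags, lifting) imageE mem_Collect_eq)
qed

section \<open>Alternating forms compared on a basis\<close>

lemma alternating_trilinearI:
  assumes "\<And>u u' v w. f (u + u') v w = f u v w + f u' v w" "\<And>c u v w. f (c *s u) v w = c * f u v w"
    and "\<And>u v v' w. f u (v + v') w = f u v w + f u v' w" "\<And>c u v w. f u (c *s v) w = c * f u v w"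
    and "\<And>u v w w'. f u v (w + w') = f u v w + f u v w'" "\<And>c u v w. f u v (c *s w) = c * f u v w"
    and "\<And>u v. f u u v = 0" "\<And>u v. f u v u = 0" "\<And>u v. f v u u = 0"
  shows "alternating_trilinear f"
  unfolding alternating_trilinear_def
proof (intro conjI allI)
  show "Vector_Spaces.linear (*s) (*) (\<lambda>u. f u v w)" for v w by unfold_locales (simp_all add: assms(1,2))
  show "Vector_Spaces.linear (*s) (*) (\<lambda>v. f u v w)" for u w by unfold_locales (simp_all add: assms(3,4))
  show "Vector_Spaces.linear (*s) (*) (\<lambda>w. f u v w)" for u v by unfold_locales (simp_all add: assms(5,6))
qed (simp_all add: assms(7-9))

lemma alternating_trilinear_add:
  assumes "alternating_trilinear f" "alternating_trilinear g"
  shows "alternating_trilinear (\<lambda>u v w. f u v w + g u v w)"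
proof -
  interpret f: alternating_form f using assms(1) by unfold_locales
  interpret g: alternating_form g using assms(2) by unfold_locales
  show ?thesis
    by (rule alternating_trilinearI) (simp_all add: f.add g.add f.scale g.scale algebra_simps)
qed

lemma alternating_trilinear_wedge3:
  assumes "Vector_Spaces.linear (*s) (*) \<alpha>" "Vector_Spaces.linear (*s) (*) \<beta>" "Vector_Spaces.linear (*s) (*) \<gamma>"
  shows "alternating_trilinear (\<lambda>u v w. c * wedge3 \<alpha> \<beta> \<gamma> u v w)"
proof -
  interpret a: Vector_Spaces.linear "(*s)" "(*)" \<alpha> by fact
  interpret b: Vector_Spaces.linear "(*s)" "(*)" \<beta> by fact
  interpret c: Vector_Spaces.linear "(*s)" "(*)" \<gamma> by fact
  show ?thesis
    by (rule alternating_trilinearI)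
      (simp_all add: wedge3_expand a.add b.add c.add a.scale b.scale c.scale algebra_simps)
qed

lemma alternating_eqI:
  fixes b :: "'i::linorder \<Rightarrow> 'a::field^'n::finite"
  assumes f: "alternating_trilinear f" and g: "alternating_trilinear g" and span: "vec.span (b ` I) = UNIV"
    and eq: "\<And>i j k. i \<in> I \<Longrightarrow> j \<in> I \<Longrightarrow> k \<in> I \<Longrightarrow> i < j \<Longrightarrow> j < k \<Longrightarrow> f (b i) (b j) (b k) = g (b i) (b j) (b k)"
  shows "f u v w = g u v w"
proof -
  interpret f: alternating_form f using f by unfold_locales
  interpret g: alternating_form g using g by unfold_locales
  have first: "f (b i) (b j) (b k) = g (b i) (b j) (b k)"
    if "i \<in> I" "j \<in> I" "k \<in> I" "i < j" "i < k" for i j k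
    using eq[of i j k] eq[of i k j] f.swap(2)[of "b i" "b k" "b j"] g.swap(2)[of "b i" "b k" "b j"] that
    by (cases j k rule: linorder_cases) simp_all
  have all: "f (b i) (b j) (b k) = g (b i) (b j) (b k)" if "i \<in> I" "j \<in> I" "k \<in> I" for i j k
  proof -
    have rot: "f (b i) (b j) (b k) = f (b j) (b k) (b i)" "g (b i) (b j) (b k) = g (b j) (b k) (b i)"
      "f (b i) (b j) (b k) = f (b k) (b i) (b j)" "g (b i) (b j) (b k) = g (b k) (b i) (b j)"
      using f.rotate[where u = "b i" and v = "b j" and w = "b k"]
        g.rotate[where u = "b i" and v = "b j" and w = "b k"] by simp_all
    consider "i = j" | "i = k" | "j = k" | "i < j" "i < k" | "j < i" "j < k" | "k < i" "k < j"
      by (metis linorder_cases order_less_trans)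
    then show ?thesis
    proof cases
      case 4
      then show ?thesis using first that by blast
    next
      case 5
      then show ?thesis unfolding rot(1,2) using first that by blast
    next
      case 6
      then show ?thesis unfolding rot(3,4) using first that by blast
    qed simp_all
  qed
  have 1: "f u v w = g u v w" if "v \<in> b ` I" "w \<in> b ` I" for u v w
    by (rule span_UNIV_induct[OF span, of _ u]) (use that all in \<open>auto simp: f.add g.add f.scale g.scale\<close>)
  have 2: "f u v w = g u v w" if "w \<in> b ` I" for u v w
    by (rule span_UNIV_induct[OF span, of _ v]) (use that in \<open>auto simp: 1 f.add g.add f.scale g.scale\<close>)
  show ?thesis
    by (rule span_UNIV_induct[OF span, of _ w]) (auto simp: 2 f.add g.add f.scale g.scale)
qed

lemma increasing_triples:
  assumes "i \<in> {-3..3::int}" "j \<in> {-3..3}" "k \<in> {-3..3}" "i < j" "j < k"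
  shows "(i, j, k) \<in> {(-3, -2, -1), (-3, -2, 0), (-3, -2, 1), (-3, -2, 2), (-3, -2, 3),
    (-3, -1, 0), (-3, -1, 1), (-3, -1, 2), (-3, -1, 3), (-3, 0, 1),
    (-3, 0, 2), (-3, 0, 3), (-3, 1, 2), (-3, 1, 3), (-3, 2, 3),
    (-2, -1, 0), (-2, -1, 1), (-2, -1, 2), (-2, -1, 3), (-2, 0, 1),
    (-2, 0, 2), (-2, 0, 3), (-2, 1, 2), (-2, 1, 3), (-2, 2, 3),
    (-1, 0, 1), (-1, 0, 2), (-1, 0, 3), (-1, 1, 2), (-1, 1, 3),
    (-1, 2, 3), (0, 1, 2), (0, 1, 3), (0, 2, 3), (1, 2, 3)}"
  using assms unfolding interval_7 by (elim insertE emptyE) simp_all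

text \<open>Weights 1 and 2 occur only twice each, so three distinct indices of total weight
  divisible by 3 are either the three of weight 0 or one of each weight: 1 + 3 * 2 * 2 = 13
  terms.\<close>

lemma graded_expansion:
  fixes f :: "'a::field^7 \<Rightarrow> 'a^7 \<Rightarrow> 'a^7 \<Rightarrow> 'a"
  assumes alt: "alternating_trilinear f" and b: "indexed_basis {-3..3} b"
    and wt: "\<forall>i\<in>{-3..3}. \<forall>j\<in>{-3..3}. \<forall>k\<in>{-3..3}.
      \<not> 3 dvd y_weight i + y_weight j + y_weight k \<longrightarrow> f (b i) (b j) (b k) = 0"
  defines "e \<equiv> dual_basis {-3..3} b"
  shows "f u v w = f (b 0) (b 1) (b (-1)) * wedge3 (e 0) (e 1) (e (-1)) u v w
      + f (b 0) (b 2) (b (-2)) * wedge3 (e 0) (e 2) (e (-2)) u v w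
      + f (b 0) (b 2) (b (-3)) * wedge3 (e 0) (e 2) (e (-3)) u v w
      + f (b 0) (b 3) (b (-2)) * wedge3 (e 0) (e 3) (e (-2)) u v w
      + f (b 0) (b 3) (b (-3)) * wedge3 (e 0) (e 3) (e (-3)) u v w
      + f (b 1) (b 2) (b (-2)) * wedge3 (e 1) (e 2) (e (-2)) u v w
      + f (b 1) (b 2) (b (-3)) * wedge3 (e 1) (e 2) (e (-3)) u v w
      + f (b 1) (b 3) (b (-2)) * wedge3 (e 1) (e 3) (e (-2)) u v w
      + f (b 1) (b 3) (b (-3)) * wedge3 (e 1) (e 3) (e (-3)) u v w
      + f (b (-1)) (b 2) (b (-2)) * wedge3 (e (-1)) (e 2) (e (-2)) u v w
      + f (b (-1)) (b 2) (b (-3)) * wedge3 (e (-1)) (e 2) (e (-3)) u v w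
      + f (b (-1)) (b 3) (b (-2)) * wedge3 (e (-1)) (e 3) (e (-2)) u v w
      + f (b (-1)) (b 3) (b (-3)) * wedge3 (e (-1)) (e 3) (e (-3)) u v w"
    (is "_ = ?g u v w")
proof -
  have lin: "Vector_Spaces.linear (*s) (*) (e i)" for i
    unfolding e_def by unfold_locales (simp_all add: dual_basis_add_scale[OF b])
  have dual: "e i (b j) = (if i = j then 1 else 0)" if "i \<in> {-3..3}" "j \<in> {-3..3}" for i j
    unfolding e_def by (rule indexed_basis_expansion(2)[OF b _ that]) simp
  have span: "vec.span (b ` {-3..3}) = UNIV" using b unfolding indexed_basis_def by blast
  have wts: "y_weight 0 = 0" "y_weight 1 = 0" "y_weight (-1) = 0" "y_weight 2 = 1" "y_weight 3 = 1"
    "y_weight (-2) = 2" "y_weight (-3) = 2" "\<not> 3 dvd Suc (Suc 0)" by (simp_all add: y_weight_def) presburger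
  show ?thesis
  proof (rule alternating_eqI[OF alt _ span])
    show "alternating_trilinear ?g"
      by (intro alternating_trilinear_add alternating_trilinear_wedge3 lin)
    fix i j k :: int
    assume ijk: "i \<in> {-3..3}" "j \<in> {-3..3}" "k \<in> {-3..3}" "i < j" "j < k"
    interpret alternating_form f using alt by unfold_locales
    note perms = permute[where u = "b 0" and v = "b 1" and w = "b (-1)"]
    permute[where u = "b 0" and v = "b 2" and w = "b (-2)"]
    permute[where u = "b 0" and v = "b 2" and w = "b (-3)"]
    permute[where u = "b 0" and v = "b 3" and w = "b (-2)"]
    permute[where u = "b 0" and v = "b 3" and w = "b (-3)"]
    permute[where u = "b 1" and v = "b 2" and w = "b (-2)"]
    permute[where u = "b 1" and v = "b 2" and w = "b (-3)"]
    permute[where u = "b 1" and v = "b 3" and w = "b (-2)"]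
    permute[where u = "b 1" and v = "b 3" and w = "b (-3)"]
    permute[where u = "b (-1)" and v = "b 2" and w = "b (-2)"]
    permute[where u = "b (-1)" and v = "b 2" and w = "b (-3)"]
    permute[where u = "b (-1)" and v = "b 3" and w = "b (-2)"]
    permute[where u = "b (-1)" and v = "b 3" and w = "b (-3)"]
    show "f (b i) (b j) (b k) = ?g (b i) (b j) (b k)"
      using increasing_triples[OF ijk]
      by (elim insertE emptyE; clarify) (simp_all add: dual wedge3_expand wt wts perms)
  qed
qed

context irreducible_form
begin

text \<open>A vector \<open>g\<close> of eigenvalue 1 that is annihilated by the mixed part of \<open>f\<close> is either in the radical
  or has rank 2; in the latter case all vectors of rank 2 are annihilated by the mixed part.\<close>

lemma graded_injective:
  assumes b: "indexed_basis {-3..3} b"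
    and wt: "\<forall>i\<in>{-3..3}. \<forall>j\<in>{-3..3}. \<forall>k\<in>{-3..3}.
      \<not> 3 dvd y_weight i + y_weight j + y_weight k \<longrightarrow> f (b i) (b j) (b k) = 0"
    and c: "\<And>r s. r \<in> {2, 3} \<Longrightarrow> s \<in> {-2, -3} \<Longrightarrow>
      c0 * f (b 0) (b r) (b s) + c1 * f (b 1) (b r) (b s) + c2 * f (b (-1)) (b r) (b s) = 0"
  shows "c0 = 0 \<and> c1 = 0 \<and> c2 = 0"
proof (rule ccontr)
  assume nz: "\<not> ?thesis"
  define e where "e = dual_basis {-3..3} b"
  note form = graded_expansion[OF alternating b wt, folded e_def]
  have dual: "e i (b j) = (if i = j then 1 else 0)" if "i \<in> {-3..3}" "j \<in> {-3..3}" for i j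
    unfolding e_def by (rule indexed_basis_expansion(2)[OF b _ that]) simp
  define g where "g = c0 *s b 0 + c1 *s b 1 + c2 *s b (-1)"
  define a where "a = f (b 0) (b 1) (b (-1))"
  have e_add: "e i (u + v) = e i u + e i v" and e_scale: "e i (k *s u) = k * e i u" for i u v k
    unfolding e_def by (simp_all add: dual_basis_add_scale[OF b])
  have eg: "e 0 g = c0" "e 1 g = c1" "e (-1) g = c2" "e 2 g = 0" "e 3 g = 0" "e (-2) g = 0" "e (-3) g = 0"
    unfolding g_def by (simp_all add: e_add e_scale dual)
  have g_nz: "g \<noteq> 0"
  proof
    assume "g = 0"
    then have "e i g = 0" for i using e_scale[of i 0 0] by simp
    then show False using nz eg by metis
  qed
  \<comment> \<open>The hypothesis on \<open>c0, c1, c2\<close> removes all mixed terms. What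
    remains is a multiple of the contraction by \<open>g\<close> of the volume form on the
    3-dimensional eigenspace, and such a 2-form is decomposable.\<close>
  have fg: "f g v w = a * (c0 * (e 1 v * e (-1) w - e (-1) v * e 1 w) - c1 * (e 0 v * e (-1) w - e (-1) v * e 0 w)
      + c2 * (e 0 v * e 1 w - e 1 v * e 0 w))" for v w
  proof -
    have "f g v w = a * (c0 * (e 1 v * e (-1) w - e (-1) v * e 1 w) - c1 * (e 0 v * e (-1) w - e (-1) v * e 0 w)
        + c2 * (e 0 v * e 1 w - e 1 v * e 0 w))
      + (c0 * f (b 0) (b 2) (b (-2)) + c1 * f (b 1) (b 2) (b (-2)) + c2 * f (b (-1)) (b 2) (b (-2)))
          * (e 2 v * e (-2) w - e (-2) v * e 2 w)
      + (c0 * f (b 0) (b 2) (b (-3)) + c1 * f (b 1) (b 2) (b (-3)) + c2 * f (b (-1)) (b 2) (b (-3)))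
          * (e 2 v * e (-3) w - e (-3) v * e 2 w)
      + (c0 * f (b 0) (b 3) (b (-2)) + c1 * f (b 1) (b 3) (b (-2)) + c2 * f (b (-1)) (b 3) (b (-2)))
          * (e 3 v * e (-2) w - e (-2) v * e 3 w)
      + (c0 * f (b 0) (b 3) (b (-3)) + c1 * f (b 1) (b 3) (b (-3)) + c2 * f (b (-1)) (b 3) (b (-3)))
          * (e 3 v * e (-3) w - e (-3) v * e 3 w)"
      unfolding form[of g v w] wedge3_expand eg a_def by (simp add: algebra_simps)
    then show ?thesis using c by simp
  qed
  have "a \<noteq> 0" using radical_trivial[of g] g_nz fg by auto
  have rank: "rank_le_2 f g"
    unfolding rank_le_2_def fg by (simp add: algebra_simps)
  have mixed: "f v (b r) (b s) = e 0 v * f (b 0) (b r) (b s) + e 1 v * f (b 1) (b r) (b s)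
      + e (-1) v * f (b (-1)) (b r) (b s)" if "r \<in> {2, 3}" "s \<in> {-2, -3}" for v r s
    using that by (elim insertE emptyE) (simp_all add: form[of v] wedge3_expand dual)
  have vanish: "f v (b r) (b s) = 0" if v: "rank_le_2 f v" and rs: "r \<in> {2, 3}" "s \<in> {-2, -3}" for v r s
  proof (rule ccontr)
    assume ne: "f v (b r) (b s) \<noteq> 0"
    \<comment> \<open>Contraction by \<open>g\<close> sees only the eigenspace of 1, so it vanishes
      on \<open>b r\<close> and \<open>b s\<close>; Pluecker's relation then retains a single
      product.\<close>
    have "f v g (b i) = 0" for i
    proof -
      have "f v g (b i) * f v (b r) (b s) - f v g (b r) * f v (b i) (b s) + f v g (b s) * f v (b i) (b r) = 0"
        using v unfolding rank_le_2_def by blast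
      moreover have "f g v (b r) = 0" "f g v (b s) = 0" using rs by (auto simp: fg dual)
      then have "f v g (b r) = 0" "f v g (b s) = 0" by (simp_all add: swap(1)[where u = g and v = v])
      ultimately show ?thesis using ne by simp
    qed
    then have "f g v (b i) = 0" for i by (simp add: swap(1)[where u = v and v = g])
    from this[of 0] this[of 1] this[of "-1"]
    \<comment> \<open>All 2 by 2 minors vanish: the component of \<open>v\<close> in the eigenspace
      of 1 is proportional to \<open>g\<close>, and so the mixed part annihilates it too.\<close>
    have par: "c2 * e 1 v = c1 * e (-1) v" "c2 * e 0 v = c0 * e (-1) v" "c1 * e 0 v = c0 * e 1 v"
      using \<open>a \<noteq> 0\<close> by (auto simp: fg dual algebra_simps)
    have "c0 * f v (b r) (b s) = e 0 v * (c0 * f (b 0) (b r) (b s) + c1 * f (b 1) (b r) (b s) + c2 * f (b (-1)) (b r) (b s))"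
      "c1 * f v (b r) (b s) = e 1 v * (c0 * f (b 0) (b r) (b s) + c1 * f (b 1) (b r) (b s) + c2 * f (b (-1)) (b r) (b s))"
      "c2 * f v (b r) (b s) = e (-1) v * (c0 * f (b 0) (b r) (b s) + c1 * f (b 1) (b r) (b s) + c2 * f (b (-1)) (b r) (b s))"
      unfolding mixed[OF rs, where v = v] using par by algebra+
    then show False using c[OF rs] ne nz by simp
  qed
  \<comment> \<open>Without mixed coefficients only the term on 0, 1, -1 would survive, and
    \<open>b 2\<close> would lie in the radical.\<close>
  have "\<exists>i\<in>{-1, 0, 1}. \<exists>r\<in>{2, 3}. \<exists>s\<in>{-2, -3}. f (b i) (b r) (b s) \<noteq> 0"
  proof (rule ccontr)
    assume "\<not> ?thesis"
    then have "f (b 2) v w = 0" for v w unfolding form[of "b 2"] by (simp add: wedge3_expand dual)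
    then have "b 2 = 0" by (rule radical_trivial)
    then show False using indexed_basis_nonzero[OF b, of 2] by simp
  qed
  then obtain i r s where irs: "r \<in> {2, 3}" "s \<in> {-2, -3}" "f (b i) (b r) (b s) \<noteq> 0" by blast
  show False
  proof (rule rank_le_2_contradiction[OF rank g_nz])
    show "vec.subspace {v. f v (b r) (b s) = 0}" by (rule module_hom.subspace_kernel[OF hom1])
    show "{v. f v (b r) (b s) = 0} \<noteq> UNIV" using irs(3) by blast
    show "v \<in> {v. f v (b r) (b s) = 0}" if "rank_le_2 f v" for v using vanish[OF that irs(1,2)] by simp
  qed
qed

end

section \<open>Changes of basis inside the eigenspaces of \<open>y\<close>\<close>

lemma graded_basis_spanI:
  fixes b b' :: "int \<Rightarrow> 'a::field^7"
  assumes b: "graded_basis y \<omega> b"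
    and span: "\<And>i. i \<in> {-3..3} \<Longrightarrow> b i \<in> vec.span (b' ` {-3..3})"
    and eig: "\<And>i. i \<in> {-3..3} \<Longrightarrow> y *v b' i = \<omega> ^ y_weight i *s b' i"
  shows "graded_basis y \<omega> b'"
proof -
  have "vec.span (b ` {-3..3}) \<subseteq> vec.span (b' ` {-3..3})" using span by (intro vec.span_minimal) auto
  then have "vec.span (b' ` {-3..3}) = UNIV"
    using b unfolding graded_basis_def indexed_basis_def by auto
  then have "indexed_basis {-3..3} b'" by (intro indexed_basis_if_spanning) simp_all
  then show ?thesis using eig unfolding graded_basis_def by blast
qed

text \<open>Cramer's rule for a pair of vectors.\<close>

lemma pair_in_span:
  fixes u v :: "'a::field^'n::finite"
  assumes d: "p1 * q2 - p2 * q1 \<noteq> 0" and "p1 *s u + p2 *s v \<in> vec.span S" "q1 *s u + q2 *s v \<in> vec.span S"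
  shows "u \<in> vec.span S" "v \<in> vec.span S"
proof -
  define d where "d = p1 * q2 - p2 * q1"
  let ?P = "p1 *s u + p2 *s v" and ?Q = "q1 *s u + q2 *s v"
  have "q2 *s ?P - p2 *s ?Q = d *s u" "p1 *s ?Q - q1 *s ?P = d *s v"
    by (simp_all add: d_def vec_eq_iff algebra_simps)
  moreover have "q2 *s ?P - p2 *s ?Q \<in> vec.span S" "p1 *s ?Q - q1 *s ?P \<in> vec.span S"
    by (rule vec.span_diff[OF vec.span_scale[OF assms(2)] vec.span_scale[OF assms(3)]],
        rule vec.span_diff[OF vec.span_scale[OF assms(3)] vec.span_scale[OF assms(2)]])
  ultimately have "d *s u \<in> vec.span S" "d *s v \<in> vec.span S" by simp_all
  then have "inverse d *s (d *s u) \<in> vec.span S" "inverse d *s (d *s v) \<in> vec.span S"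
    by (simp_all only: vec.span_scale)
  moreover have "d \<noteq> 0" using assms(1) unfolding d_def .
  ultimately show "u \<in> vec.span S" "v \<in> vec.span S" by simp_all
qed

lemma graded_basis_change:
  fixes b :: "int \<Rightarrow> 'a::field^7"
  assumes b: "graded_basis y \<omega> b" and p: "p11 * p22 - p12 * p21 \<noteq> 0" and q: "q11 * q22 - q12 * q21 \<noteq> 0"
  shows "graded_basis y \<omega> (b(2 := p11 *s b 2 + p12 *s b 3, 3 := p21 *s b 2 + p22 *s b 3,
    -2 := q11 *s b (-2) + q12 *s b (-3), -3 := q21 *s b (-2) + q22 *s b (-3)))" (is "graded_basis y \<omega> ?b")
proof (rule graded_basis_spanI[OF b])
  have eig: "y *v b i = \<omega> ^ y_weight i *s b i" if "i \<in> {-3..3}" for i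
    using b that unfolding graded_basis_def by blast
  have inS: "?b i \<in> vec.span (?b ` {-3..3})" if "i \<in> {-3..3}" for i using that by (intro vec.span_base imageI)
  fix i :: int
  assume i: "i \<in> {-3..3}"
  have cases: "i = 2 \<or> i = 3 \<or> i = -2 \<or> i = -3 \<or> i \<notin> {2, 3, -2, -3}" by blast
  have "b 2 \<in> vec.span (?b ` {-3..3})" "b 3 \<in> vec.span (?b ` {-3..3})"
    using pair_in_span[OF p, of "b 2" "b 3" "?b ` {-3..3}"] inS[of 2] inS[of 3] by simp_all
  moreover have "b (-2) \<in> vec.span (?b ` {-3..3})" "b (-3) \<in> vec.span (?b ` {-3..3})"
    using pair_in_span[OF q, of "b (-2)" "b (-3)" "?b ` {-3..3}"] inS[of "-2"] inS[of "-3"] by simp_all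
  moreover have "b i \<in> vec.span (?b ` {-3..3})" if "i \<notin> {2, 3, -2, -3}" using inS[OF i] that by simp
  ultimately show "b i \<in> vec.span (?b ` {-3..3})" using cases by blast
  have wts: "y_weight 2 = 1" "y_weight 3 = 1" "y_weight (-2) = 2" "y_weight (-3) = 2" by (simp_all add: y_weight_def)
  show "y *v ?b i = \<omega> ^ y_weight i *s ?b i"
    using cases eig[OF i] by (elim disjE) (simp_all add: vec.add vec.scale eig wts vec.scale_right_distrib mult.commute)
qed

context irreducible_form
begin

text \<open>The coefficients with indices in \<open>{0, 1, -1} \<times> {2, 3} \<times> {-2, -3}\<close> form a linear map \<open>T\<close> from the
  eigenspace of 1 to 2 by 2 matrices. It is injective, so its image is the annihilator of a single
  matrix \<open>n\<close>; making \<open>n\<close> diagonal and choosing suitable preimages under \<open>T\<close> yields the basis.\<close>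

lemma weighted_basis_if_graded:
  assumes inv: "\<And>u v w. f (y *v u) (y *v v) (y *v w) = f u v w"
    and \<omega>: "\<omega> * \<omega> = - 1 - \<omega>" "\<omega> \<noteq> 1" and gb: "graded_basis y \<omega> b"
  shows "\<exists>b. weighted_basis f b"
proof -
  define gv where "gv b c = c $ 1 *s b 0 + c $ 2 *s b 1 + c $ 3 *s b (-1)" for b :: "int \<Rightarrow> 'a^7" and c :: "'a^3"
  define T :: "(int \<Rightarrow> 'a^7) \<Rightarrow> 'a^3 \<Rightarrow> 'a^4" where
    "T b c = (\<chi> k. if k = 1 then f (gv b c) (b 2) (b (-2)) else if k = 2 then f (gv b c) (b 2) (b (-3))
      else if k = 3 then f (gv b c) (b 3) (b (-2)) else f (gv b c) (b 3) (b (-3)))" for b c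
  have T_comp: "T b c $ 1 = f (gv b c) (b 2) (b (-2))" "T b c $ 2 = f (gv b c) (b 2) (b (-3))"
    "T b c $ 3 = f (gv b c) (b 3) (b (-2))" "T b c $ 4 = f (gv b c) (b 3) (b (-3))" for b c
    by (simp_all add: T_def)
  have gv_add: "gv b (c + c') = gv b c + gv b c'" and gv_scale: "gv b (k *s c) = k *s gv b c" for b c c' k
    by (simp_all add: gv_def vec_eq_iff algebra_simps)
  have T_lin: "Vector_Spaces.linear (*s) (*s) (T b)" for b
    by unfold_locales (simp_all add: vec_eq_iff forall_4 T_comp gv_add gv_scale add scale)
  have wt0: "\<forall>i\<in>{-3..3}. \<forall>j\<in>{-3..3}. \<forall>k\<in>{-3..3}.
      \<not> 3 dvd y_weight i + y_weight j + y_weight k \<longrightarrow> f (b i) (b j) (b k) = 0" if "graded_basis y \<omega> b" for b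
    by (intro ballI impI, rule graded_basis_zero[OF alternating _ \<omega> that]) (simp_all add: inv)
  obtain n where n: "n \<noteq> 0" "\<And>c. (\<Sum>k\<in>UNIV. n $ k * T b c $ k) = 0"
    using linear_3_to_4_functional[OF T_lin[of b]] by blast
  have rel: "n $ 1 * f (gv b c) (b 2) (b (-2)) + n $ 2 * f (gv b c) (b 2) (b (-3))
      + n $ 3 * f (gv b c) (b 3) (b (-2)) + n $ 4 * f (gv b c) (b 3) (b (-3)) = 0" for c
    using n(2)[of c] unfolding sum_4 T_comp .
  \<comment> \<open>The entries of \<open>n\<close> are the coefficients of a bilinear relation
    between the eigenspaces of weights 1 and 2. If the 2 by 2 matrix is invertible, its rows give
    new vectors of weight 2 and the relation becomes the identity matrix. Otherwise it is a column
    times a row, and completing both to bases leaves a single diagonal entry.\<close>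
  obtain b' m1 m2 where b': "graded_basis y \<omega> b'" and m: "m1 \<noteq> 0 \<or> m2 \<noteq> 0"
    and diag: "\<And>c. m1 * f (gv b' c) (b' 2) (b' (-2)) + m2 * f (gv b' c) (b' 3) (b' (-3)) = 0"
  proof (cases "n $ 1 * n $ 4 - n $ 2 * n $ 3 = 0")
    case False
    define b' where "b' = b(2 := 1 *s b 2 + 0 *s b 3, 3 := 0 *s b 2 + 1 *s b 3,
      -2 := n $ 1 *s b (-2) + n $ 2 *s b (-3), -3 := n $ 3 *s b (-2) + n $ 4 *s b (-3))"
    have "graded_basis y \<omega> b'" unfolding b'_def by (rule graded_basis_change[OF gb]) (use False in simp_all)
    moreover have "1 * f (gv b' c) (b' 2) (b' (-2)) + 1 * f (gv b' c) (b' 3) (b' (-3)) = 0" for c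
      using rel[of c] by (simp add: b'_def gv_def add scale algebra_simps)
    ultimately show thesis using that[of b' 1 1] by simp
  next
    case True
    obtain \<alpha>1 \<alpha>2 \<alpha>1' \<alpha>2' \<beta>1 \<beta>2 where \<alpha>: "\<alpha>1 * \<alpha>2' - \<alpha>2 * \<alpha>1' \<noteq> 0" and \<beta>: "\<beta>1 \<noteq> 0 \<or> \<beta>2 \<noteq> 0"
      and n_eq: "n $ 1 = \<alpha>1 * \<beta>1" "n $ 2 = \<alpha>1 * \<beta>2" "n $ 3 = \<alpha>2 * \<beta>1" "n $ 4 = \<alpha>2 * \<beta>2"
    proof (cases "n $ 1 = 0 \<and> n $ 2 = 0")
      case True
      then have "n $ 3 \<noteq> 0 \<or> n $ 4 \<noteq> 0" using n(1) by (auto simp: vec_eq_iff forall_4)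
      then show thesis using True that[of 0 0 1 1 "n $ 3" "n $ 4"] by simp
    next
      case n12: False
      have "\<exists>l. n $ 3 = l * n $ 1 \<and> n $ 4 = l * n $ 2"
      proof (cases "n $ 1 = 0")
        case True
        then have "n $ 3 = 0" "n $ 2 \<noteq> 0" using n12 \<open>n $ 1 * n $ 4 - n $ 2 * n $ 3 = 0\<close> by auto
        then show ?thesis using True by (intro exI[of _ "n $ 4 / n $ 2"]) simp
      next
        case False
        have "n $ 4 * n $ 1 = n $ 3 * n $ 2" using \<open>n $ 1 * n $ 4 - n $ 2 * n $ 3 = 0\<close> by (simp add: mult.commute)
        then show ?thesis using False by (intro exI[of _ "n $ 3 / n $ 1"]) (simp add: field_simps)
      qed
      then obtain l where "n $ 3 = l * n $ 1" "n $ 4 = l * n $ 2" by blast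
      then show thesis using n12 that[of 1 1 l 0 "n $ 1" "n $ 2"] by simp
    qed
    \<comment> \<open>The second row is a standard unit vector completing the nonzero row
      \<open>\<beta>1, \<beta>2\<close> to a basis.\<close>
    define \<beta>1' where "\<beta>1' = (if \<beta>1 = 0 then 1 else 0 :: 'a)"
    define \<beta>2' where "\<beta>2' = (if \<beta>1 = 0 then 0 else 1 :: 'a)"
    have \<beta>': "\<beta>1 * \<beta>2' - \<beta>2 * \<beta>1' \<noteq> 0" using \<beta> by (simp add: \<beta>1'_def \<beta>2'_def)
    define b' where "b' = b(2 := \<alpha>1 *s b 2 + \<alpha>2 *s b 3, 3 := \<alpha>1' *s b 2 + \<alpha>2' *s b 3,
      -2 := \<beta>1 *s b (-2) + \<beta>2 *s b (-3), -3 := \<beta>1' *s b (-2) + \<beta>2' *s b (-3))"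
    have "graded_basis y \<omega> b'" unfolding b'_def by (rule graded_basis_change[OF gb \<alpha> \<beta>'])
    moreover have "1 * f (gv b' c) (b' 2) (b' (-2)) + 0 * f (gv b' c) (b' 3) (b' (-3)) = 0" for c
      using rel[of c] unfolding n_eq by (simp add: b'_def gv_def add scale algebra_simps)
    ultimately show thesis using that[of b' 1 0] by simp
  qed

  have ib': "indexed_basis {-3..3} b'" using b' unfolding graded_basis_def by blast
  have inj: "c = 0" if "T b' c = 0" for c
  proof -
    have "f (gv b' c) (b' r) (b' s) = 0" if "r \<in> {2, 3}" "s \<in> {-2, -3}" for r s
      using \<open>T b' c = 0\<close> that by (auto simp: vec_eq_iff forall_4 T_comp)
    then have "c $ 1 = 0 \<and> c $ 2 = 0 \<and> c $ 3 = 0"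
      by (intro graded_injective[OF ib' wt0[OF b']]) (simp add: gv_def add scale)
    then show ?thesis by (simp add: vec_eq_iff forall_3)
  qed
  define N :: "'a^4" where "N = (\<chi> k. if k = 1 then m1 else if k = 4 then m2 else 0)"
  have N: "N $ 1 = m1" "N $ 2 = 0" "N $ 3 = 0" "N $ 4 = m2" by (simp_all add: N_def)
  have N_nz: "N \<noteq> 0" using m by (auto simp: vec_eq_iff forall_4 N)
  have N_T: "(\<Sum>k\<in>UNIV. N $ k * T b' c $ k) = 0" for c
    using diag[of c] by (simp add: sum_4 N T_comp)
  have range: "\<exists>c. T b' c = X" if "m1 * X $ 1 + m2 * X $ 4 = 0" for X
    by (rule linear_3_to_4_range[OF T_lin[of b'] inj N_nz N_T]) (use that in \<open>simp_all add: sum_4 N\<close>)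
  \<comment> \<open>A basis of the matrices annihilated by the diagonal relation: one diagonal
    matrix and the two off-diagonal matrix units. Their preimages under \<open>T\<close> serve as
    new vectors for 0, 1, -1, with mixed coefficients exactly where a Dickson form allows
    them.\<close>
  define X0 X1 X2 :: "'a^4" where "X0 = (\<chi> k. if k = 1 then m2 else if k = 4 then - m1 else 0)"
    and "X1 = (\<chi> k. if k = 2 then 1 else 0)" and "X2 = (\<chi> k. if k = 3 then 1 else 0)"
  have X: "X0 $ 1 = m2" "X0 $ 2 = 0" "X0 $ 3 = 0" "X0 $ 4 = - m1" "X1 $ 1 = 0" "X1 $ 2 = 1" "X1 $ 3 = 0" "X1 $ 4 = 0"
    "X2 $ 1 = 0" "X2 $ 2 = 0" "X2 $ 3 = 1" "X2 $ 4 = 0" by (simp_all add: X0_def X1_def X2_def)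
  obtain c0 where c0: "T b' c0 = X0" using range[of X0] by (auto simp: X)
  obtain c1 where c1: "T b' c1 = X1" using range[of X1] by (auto simp: X)
  obtain c2 where c2: "T b' c2 = X2" using range[of X2] by (auto simp: X)
  interpret T: Vector_Spaces.linear "(*s)" "(*s)" "T b'" by (rule T_lin)
  \<comment> \<open>Subtracting the combination read off from the entries of \<open>T b' c\<close>
    leaves a vector in the kernel of \<open>T b'\<close>, which is zero.\<close>
  have comb: "\<exists>s x1 x2. c = s *s c0 + x1 *s c1 + x2 *s c2" for c
  proof -
    have "m1 * T b' c $ 1 + m2 * T b' c $ 4 = 0" using diag[of c] by (simp add: T_comp)
    then have "\<exists>s. T b' c $ 1 = s * m2 \<and> T b' c $ 4 = - s * m1"
    proof (cases "m2 = 0")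
      case True
      then show ?thesis using m \<open>m1 * T b' c $ 1 + m2 * T b' c $ 4 = 0\<close>
        by (intro exI[of _ "- (T b' c $ 4) / m1"]) simp
    next
      case False
      have "T b' c $ 4 * m2 = - (T b' c $ 1 * m1)"
        using \<open>m1 * T b' c $ 1 + m2 * T b' c $ 4 = 0\<close> by (simp add: eq_neg_iff_add_eq_0 add.commute mult.commute)
      then show ?thesis using False by (intro exI[of _ "T b' c $ 1 / m2"]) (simp add: field_simps)
    qed
    then obtain s where s: "T b' c $ 1 = s * m2" "T b' c $ 4 = - s * m1" by blast
    let ?d = "c - (s *s c0 + T b' c $ 2 *s c1 + T b' c $ 3 *s c2)"
    have "T b' ?d = 0"
      using s by (simp add: T.diff T.add T.scale c0 c1 c2 vec_eq_iff forall_4 X)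
    then have "?d = 0" by (rule inj)
    then have "c = s *s c0 + T b' c $ 2 *s c1 + T b' c $ 3 *s c2" by simp
    then show ?thesis by blast
  qed
  define B where "B = b'(0 := gv b' c0, 1 := gv b' c1, -1 := gv b' c2)"
  have B: "B 0 = gv b' c0" "B 1 = gv b' c1" "B (-1) = gv b' c2" "B 2 = b' 2" "B 3 = b' 3" "B (-2) = b' (-2)" "B (-3) = b' (-3)"
    by (simp_all add: B_def)
  have gB: "graded_basis y \<omega> B"
  proof (rule graded_basis_spanI[OF b'])
    have inS: "B i \<in> vec.span (B ` {-3..3})" if "i \<in> {-3..3}" for i using that by (intro vec.span_base imageI)
    have gv_span: "gv b' c \<in> vec.span (B ` {-3..3})" for c
    proof -
      obtain s x1 x2 where "c = s *s c0 + x1 *s c1 + x2 *s c2" using comb by blast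
      then have "gv b' c = s *s B 0 + x1 *s B 1 + x2 *s B (-1)" by (simp add: gv_add gv_scale B)
      also have "\<dots> \<in> vec.span (B ` {-3..3})" by (intro vec.span_add vec.span_scale inS) simp_all
      finally show ?thesis .
    qed
    fix i :: int
    assume i: "i \<in> {-3..3}"
    have cases: "i = 0 \<or> i = 1 \<or> i = -1 \<or> i \<notin> {0, 1, -1}" by blast
    have "b' 0 = gv b' (axis 1 1)" "b' 1 = gv b' (axis 2 1)" "b' (-1) = gv b' (axis 3 1)"
      by (simp_all add: gv_def axis_def)
    moreover have "b' i \<in> vec.span (B ` {-3..3})" if "i \<notin> {0, 1, -1}" using inS[OF i] that by (simp add: B_def)
    ultimately show "b' i \<in> vec.span (B ` {-3..3})" using cases gv_span by metis
    have eig: "y *v b' i = \<omega> ^ y_weight i *s b' i" if "i \<in> {-3..3}" for i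
      using b' that unfolding graded_basis_def by blast
    have "y *v gv b' c = gv b' c" for c
      by (simp add: gv_def vec.add vec.scale eig y_weight_def)
    then show "y *v B i = \<omega> ^ y_weight i *s B i"
      using cases eig[OF i] by (elim disjE) (simp_all add: B_def y_weight_def)
  qed
  have iB: "indexed_basis {-3..3} B" using gB unfolding graded_basis_def by blast
  have perm0: "f v u w = 0" "f u w v = 0" "f w v u = 0" "f v w u = 0" "f w u v = 0" "f u v w = 0" if "f u v w = 0" for u v w
    using that by (simp_all add: swap[where u = u and v = v and w = w] rotate[where u = u and v = v and w = w])
  have comps: "f (gv b' c) (b' 2) (b' (-2)) = T b' c $ 1" "f (gv b' c) (b' 2) (b' (-3)) = T b' c $ 2"
    "f (gv b' c) (b' 3) (b' (-2)) = T b' c $ 3" "f (gv b' c) (b' 3) (b' (-3)) = T b' c $ 4" for c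
    by (simp_all add: T_comp)
  \<comment> \<open>Of the twelve mixed coefficients these eight are the ones outside the five
    triples of a Dickson form.\<close>
  have z: "f (B 0) (B 2) (B (-3)) = 0" "f (B 0) (B 3) (B (-2)) = 0"
    "f (B 1) (B 2) (B (-2)) = 0" "f (B 1) (B 3) (B (-2)) = 0" "f (B 1) (B 3) (B (-3)) = 0"
    "f (B (-1)) (B 2) (B (-2)) = 0" "f (B (-1)) (B 2) (B (-3)) = 0" "f (B (-1)) (B 3) (B (-3)) = 0"
    unfolding B comps c0 c1 c2 X by simp_all
  have wts: "y_weight 0 = 0" "y_weight 1 = 0" "y_weight (-1) = 0" "y_weight 2 = 1" "y_weight 3 = 1"
    "y_weight (-2) = 2" "y_weight (-3) = 2" "\<not> 3 dvd Suc (Suc 0)" by (simp_all add: y_weight_def) presburger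
  have "weighted_basis f B"
  proof (rule weighted_basisI[OF alternating iB])
    fix i j k :: int
    assume ijk: "i \<in> {-3..3}" "j \<in> {-3..3}" "k \<in> {-3..3}" "i < j" "j < k" and n7: "\<not> 7 dvd i + j + k"
    show "f (B i) (B j) (B k) = 0"
      using increasing_triples[OF ijk] n7
      by (elim insertE emptyE; clarify)
        (simp_all add: wt0[OF gB, rule_format] wts perm0[OF z(1)] perm0[OF z(2)] perm0[OF z(3)] perm0[OF z(4)]
          perm0[OF z(5)] perm0[OF z(6)] perm0[OF z(7)] perm0[OF z(8)])
  qed
  then show ?thesis by blast
qed

end

subsection \<open>The group generated by the triple\<close>

lemma GL_simps: "carrier GL = {A. invertible A}" "A \<otimes>\<^bsub>GL\<^esub> B = A ** B" "\<one>\<^bsub>GL\<^esub> = mat 1"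
  by (simp_all add: GL_def)

lemma group_GL: "group (GL :: ('a::field^'n::finite^'n) monoid)"
proof (rule groupI)
  show "A \<otimes>\<^bsub>GL\<^esub> B \<in> carrier GL"
    if "A \<in> carrier GL" "B \<in> carrier GL" for A B :: "'a^'n^'n"
    using that by (simp add: GL_simps invertible_mult)
  show "\<one>\<^bsub>GL\<^esub> \<in> (carrier GL :: ('a^'n^'n) set)"
    unfolding GL_simps invertible_def by (auto intro: exI[of _ "mat 1"])
  show "\<exists>B\<in>carrier GL. B \<otimes>\<^bsub>GL\<^esub> A = \<one>\<^bsub>GL\<^esub>" if "A \<in> carrier GL" for A :: "'a^'n^'n"
    using that unfolding GL_simps invertible_def by blast
qed (simp_all add: GL_simps matrix_mul_assoc)

lemma GL_inv:
  assumes "A \<in> carrier GL"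
  shows "inv\<^bsub>GL\<^esub> A ** A = mat 1" "A ** inv\<^bsub>GL\<^esub> A = mat 1" "invertible (inv\<^bsub>GL\<^esub> A)"
proof -
  interpret group GL by (rule group_GL)
  show "inv\<^bsub>GL\<^esub> A ** A = mat 1" using l_inv[OF assms] by (simp add: GL_simps)
  show "A ** inv\<^bsub>GL\<^esub> A = mat 1" using r_inv[OF assms] by (simp add: GL_simps)
  show "invertible (inv\<^bsub>GL\<^esub> A)" using inv_closed[OF assms] by (simp add: GL_simps)
qed

lemma subgroup_G2: "subgroup (G2 f) GL"
proof (rule group.subgroupI[OF group_GL])
  show "G2 f \<subseteq> carrier GL" by (auto simp: G2_def GL_simps)
  have "mat 1 \<in> G2 f" by (auto simp: G2_def invertible_def)
  then show "G2 f \<noteq> {}" by blast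
  fix A assume A: "A \<in> G2 f"
  then have inv: "A ** inv\<^bsub>GL\<^esub> A = mat 1" "invertible (inv\<^bsub>GL\<^esub> A)"
    by (simp_all add: GL_inv G2_def GL_simps)
  let ?B = "inv\<^bsub>GL\<^esub> A"
  have "f (?B *v u) (?B *v v) (?B *v w) = f (A *v (?B *v u)) (A *v (?B *v v)) (A *v (?B *v w))" for u v w
    using A by (simp add: G2_def)
  then show "?B \<in> G2 f" using inv by (simp add: G2_def matrix_vector_mul_assoc)
  fix B assume "B \<in> G2 f"
  then show "A \<otimes>\<^bsub>GL\<^esub> B \<in> G2 f"
    using A by (simp add: G2_def GL_simps invertible_mult flip: matrix_vector_mul_assoc)
qed

lemma generate_GL_preserves_subspace:
  assumes gen: "\<And>A w. A \<in> S \<Longrightarrow> w \<in> W \<Longrightarrow> A *v w \<in> W"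
    and inv: "\<And>A w. A \<in> S \<Longrightarrow> w \<in> W \<Longrightarrow> inv\<^bsub>GL\<^esub> A *v w \<in> W"
    and A: "A \<in> generate GL S" and w: "w \<in> W"
  shows "A *v w \<in> W"
  using A w
proof (induction arbitrary: w rule: generate.induct)
  case one
  then show ?case by (simp add: GL_simps)
next
  case (eng h1 h2)
  then show ?case by (simp add: GL_simps flip: matrix_vector_mul_assoc)
qed (use gen inv in auto)

theorem theorem1p1:
  fixes x y :: "'a::alg_closed_field^7^7"
  assumes "x \<in> carrier GL" and "y \<in> carrier GL"
    and "generate GL {x, y} \<subseteq> SL"
    and "acts_irreducibly (generate GL {x, y})"
    and "similarity_invariants x
           [[:0, 1:] + 1, [:0, 1:]^2 - 1, [:0, 1:]^2 - 1, [:0, 1:]^2 - 1]"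
    and "similarity_invariants y
           [[:0, 1:] - 1, [:0, 1:]^3 - 1, [:0, 1:]^3 - 1]"
    and "similarity_invariants (x ** y) [[:0, 1:]^7 - 1]"
  shows "CHAR('a) \<noteq> 2 \<and>
         (\<exists>f. Dickson_form f \<and> subgroup (generate GL {x, y}) (GL\<lparr>carrier := G2 f\<rparr>))"
proof -
  let ?H = "generate GL {x, y}"
  obtain bx where bx: "spanning_action x perm_x (\<lambda>i. if i = 0 then -1 else 1) 1 bx"
    using spanning_action_x[OF assms(5)] by blast
  obtain wy where wy: "spanning_action y perm_y (\<lambda>_. 1) 2 wy"
    using spanning_action_y[OF assms(6)] by blast
  obtain bz where bz: "spanning_action (x ** y) perm_z (\<lambda>_. 1) 6 bz"
    using spanning_action_z[OF assms(7)] by blast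
  have x2: "x *v (x *v w) = w" for w
    using bx unfolding spanning_action_def by simp
  have y3: "y *v (y *v (y *v w)) = w" for w
    using wy unfolding spanning_action_def by (simp add: numeral_2_eq_2)
  \<comment> \<open>From \<open>x^2 = 1\<close> and \<open>y^3 = 1\<close> the inverses of the
    generators are powers of them, so subspaces stable under \<open>x\<close> and \<open>y\<close>
    are stable under the whole group.\<close>
  have inv_x: "inv\<^bsub>GL\<^esub> x *v w = x *v w" for w
  proof -
    have "inv\<^bsub>GL\<^esub> x *v (x *v (x *v w)) = x *v w"
      using GL_inv(1)[OF assms(1)] by (simp add: matrix_vector_mul_assoc matrix_mul_assoc)
    then show ?thesis by (simp only: x2)
  qed
  have inv_y: "inv\<^bsub>GL\<^esub> y *v w = y *v (y *v w)" for w
  proof -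
    have "inv\<^bsub>GL\<^esub> y *v (y *v (y *v (y *v w))) = y *v (y *v w)"
      using GL_inv(1)[OF assms(2)] by (simp add: matrix_vector_mul_assoc matrix_mul_assoc)
    then show ?thesis by (simp only: y3)
  qed
  have irr: "irreducible_pair x y"
    unfolding irreducible_pair_def
  proof (intro conjI allI impI)
    show "surj ((*v) x)" using x2 by (rule surjI)
    show "surj ((*v) y)" using y3 by (rule surjI)
    fix W :: "('a^7) set"
    assume W: "vec.subspace W \<and> (\<forall>w\<in>W. x *v w \<in> W) \<and> (\<forall>w\<in>W. y *v w \<in> W)"
    have "A *v w \<in> W" if "A \<in> ?H" "w \<in> W" for A w
    proof (rule generate_GL_preserves_subspace[OF _ _ that])
      show "A *v w \<in> W" if "A \<in> {x, y}" "w \<in> W" for A w using that W by auto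
      show "inv\<^bsub>GL\<^esub> A *v w \<in> W" if "A \<in> {x, y}" "w \<in> W" for A w
        using that W by (auto simp: inv_x inv_y)
    qed
    then show "W = {0} \<or> W = UNIV" using assms(4) W unfolding acts_irreducibly_def by blast
  qed
  have two: "(2 :: 'a) \<noteq> 0" using invariant_sym_form_exists[OF irr bx wy bz] by blast
  obtain f where alt: "alternating_trilinear f" and nz: "\<exists>u v w. f u v w \<noteq> 0"
    and inv: "\<forall>A\<in>{x, y}. \<forall>u v w. f (A *v u) (A *v v) (A *v w) = f u v w"
    using invariant_trilinear_form_exists[OF irr bx wy bz] by blast
  have "{x, y} \<subseteq> G2 f" using inv assms(1,2) by (simp add: G2_def GL_simps)
  then have H: "?H \<subseteq> G2 f"
    by (rule group.generate_subgroup_incl[OF group_GL _ subgroup_G2])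
  have form: "irreducible_form f ?H"
    using alt assms(4) H nz by unfold_locales
  have inv_y': "f (y *v u) (y *v v) (y *v w) = f u v w" for u v w using inv by simp
  have inv_z: "f ((x ** y) *v u) ((x ** y) *v v) ((x ** y) *v w) = f u v w" for u v w
    using inv by (simp flip: matrix_vector_mul_assoc)
  have "\<exists>b. weighted_basis f b"
  proof (cases "(7 :: 'a) = 0")
    case True
    \<comment> \<open>In characteristic 7 the number 2 is a primitive cube root of unity and serves
      as \<open>\<omega>\<close>.\<close>
    have "(2 :: 'a) * 2 - (- 1 - 2) = 7" by simp
    then have \<omega>: "(2 :: 'a) * 2 = - 1 - 2" unfolding True by simp
    \<comment> \<open>If 3 were zero as well, this identity would turn \<open>7 = 0\<close> into
      \<open>1 = 0\<close>.\<close>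
    have "(7 :: 'a) = 2 * 3 + 1" by simp
    then have "(3 :: 'a) \<noteq> 0" unfolding True by (metis add_0 mult_zero_right zero_neq_one)
    then obtain b where b: "graded_basis y 2 b" using graded_basis_exists[OF wy \<omega>] by blast
    have "(2 :: 'a) \<noteq> 1" by (metis add_cancel_right_right one_add_one one_neq_zero)
    show ?thesis
      by (rule irreducible_form.weighted_basis_if_graded[OF form _ \<omega> \<open>2 \<noteq> 1\<close> b]) (rule inv_y')
  next
    case False
    obtain \<zeta> :: 'a where \<zeta>: "\<zeta> ^ 7 = 1" "\<zeta> \<noteq> 1" using primitive_7th_root_exists[OF False] by blast
    obtain b where b: "indexed_basis {-3..3} b"
      "\<And>i. i \<in> {-3..3} \<Longrightarrow> (x ** y) *v b i = \<zeta> ^ nat (i mod 7) *s b i"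
      using eigenbasis_of_7_cycle[OF bz \<zeta> False] by blast
    have "weighted_basis f b"
      by (rule weighted_basis_if_7_cycle_invariant[OF alt _ \<zeta> b]) (rule inv_z)
    then show ?thesis by blast
  qed
  then have "Dickson_form f" using Dickson_form_if_weighted_basis[OF form] by blast
  moreover have "subgroup ?H (GL\<lparr>carrier := G2 f\<rparr>)"
    by (rule group.subgroup_incl[OF group_GL group.generate_is_subgroup[OF group_GL] subgroup_G2 H])
      (use assms(1,2) in simp)
  moreover have "CHAR('a) \<noteq> 2"
  proof
    assume "CHAR('a) = 2"
    then have "of_nat 2 = (0 :: 'a)" by (metis of_nat_CHAR)
    then show False using two by simp
  qed
  ultimately show ?thesis by blast
qed

end
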